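(* Let $(G,\mu)$ be a measured group, let $(X,\nu)$ be an ergodic $(G,\mu)$-space and let $(Y,\eta)$ be an ergodic probability measure-preserving $G$-space. Suppose that the diagonal action $G\curvearrowright (X\times Y,\nu\otimes\eta)$ is not ergodic. Then there exists a non-trivial factor of $(X,\nu)$ which is an isometric $G$-space.
   Context: A measured group is a pair $(G,\mu)$, where $G$ is a countable group and $\mu$ is a probability measure on $G$ whose support generates $G$ as a semi-group. All $G$-spaces are Borel probability measure spaces $(X,\nu)$ equipped with an action of $G$ by measurable maps with measurable inverses which preserve the class of $\nu$-null sets. The action is ergodic if every Borel set $B\subset X$ with $\nu(B\,\Delta\, gB)=0$ for all $g\in G$ is $\nu$-null or $\nu$-conull. $(X,\nu)$ is a $(G,\mu)$-space if $\sum_{s\in G}\big(\int_X f(sx)\,d\nu(x)\big)\mu(s)=\int_X f\,d\nu$ for all $f\in L^\infty(X,\nu)$. A factor of a $G$-space $(X,\nu)$ is a $G$-space $(W,\xi)$ together with a $G$-equivariant Borel map $p:X'\to W$, where $X'\subset X$ is a $G$-invariant $\nu$-conull set, such that $\nu(p^{-1}(A))=\xi(A)$ for all Borel $A\subset W$. The $G$-spaces $(X,\nu)$ and $(W,\xi)$ are isomorphic if such a $p$ admits a measurable inverse map $q:W'\to X$, defined on a $G$-invariant ($\xi$-conull) subset $W'\subset W$, with $q_*\xi=\nu$. A $G$-space is trivial if its measure is supported on one point. Let $K$ be a compact second countable group, $\tau:G\to K$ a homomorphism with dense image, $L<K$ a closed subgroup, and $m_{K/L}$ the Haar ($K$-invariant)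 probability measure on $K/L$. Then $(K/L,m_{K/L})$ is a $G$-space under $g\cdot kL=\tau(g)kL$. A $G$-space is isometric if it is isomorphic to a $G$-space of this form for some such $K$, $L$ and $\tau$. *)

theory Defs
  imports
    "HOL-Probability.Probability"
    "HOL-Algebra.Left_Coset"
    "HOL-Algebra.Group_Action"
begin

section \<open>Measured groups\<close>

inductive_set generated_semigroup :: "('g, 'c) monoid_scheme \<Rightarrow> 'g set \<Rightarrow> 'g set"
  for G :: "('g, 'c) monoid_scheme" and S :: "'g set" where
  generator: "s \<in> S \<Longrightarrow> s \<in> generated_semigroup G S"
| mult: "\<lbrakk>s \<in> generated_semigroup G S; t \<in> generated_semigroup G S\<rbrakk>
    \<Longrightarrow> s \<otimes>\<^bsub>G\<^esub> t \<in> generated_semigroup G S"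

text \<open>A probability measure on a countable group is a probability mass function; it lives on the
  ambient type of the carrier, and the equation below also forces its support into the carrier.\<close>

definition measured_group :: "('g, 'c) monoid_scheme \<Rightarrow> 'g pmf \<Rightarrow> bool" where
  "measured_group G \<mu> \<longleftrightarrow>
     Group.group G \<and> countable (carrier G) \<and> generated_semigroup G (set_pmf \<mu>) = carrier G"

section \<open>G-spaces\<close>

text \<open>The Borel sets of a \<open>G\<close>-space are the members of \<open>sets M\<close>; the \<open>\<sigma>\<close>-algebra is not required
  to be standard. Measurability of the inverse of \<open>a g\<close> is that of \<open>a (inv g)\<close>. As always with
  \<^const>\<open>group_action\<close>, the maps \<open>a g\<close> are extensional on \<open>space M\<close>.\<close>

definition G_space :: "('g, 'c) monoid_scheme \<Rightarrow> ('g \<Rightarrow> 'x \<Rightarrow> 'x) \<Rightarrow> 'x measure \<Rightarrow> bool" where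
  "G_space G a M \<longleftrightarrow>
     prob_space M \<and> group_action G (space M) a \<and>
     (\<forall>g\<in>carrier G. a g \<in> measurable M M) \<and>
     (\<forall>g\<in>carrier G. \<forall>A\<in>sets M. a g -` A \<inter> space M \<in> null_sets M \<longleftrightarrow> A \<in> null_sets M)"

definition conull :: "'x measure \<Rightarrow> 'x set \<Rightarrow> bool" where
  "conull M A \<longleftrightarrow> A \<in> sets M \<and> space M - A \<in> null_sets M"

definition ergodic :: "('g, 'c) monoid_scheme \<Rightarrow> ('g \<Rightarrow> 'x \<Rightarrow> 'x) \<Rightarrow> 'x measure \<Rightarrow> bool" where
  "ergodic G a M \<longleftrightarrow>
     (\<forall>B\<in>sets M. (\<forall>g\<in>carrier G. sym_diff B (a g ` B) \<in> null_sets M) \<longrightarrow>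
        B \<in> null_sets M \<or> conull M B)"

definition ess_bounded :: "'x measure \<Rightarrow> ('x \<Rightarrow> real) \<Rightarrow> bool" where
  "ess_bounded M f \<longleftrightarrow> f \<in> borel_measurable M \<and> (\<exists>C. AE x in M. \<bar>f x\<bar> \<le> C)"

definition stationary_space ::
  "('g, 'c) monoid_scheme \<Rightarrow> 'g pmf \<Rightarrow> ('g \<Rightarrow> 'x \<Rightarrow> 'x) \<Rightarrow> 'x measure \<Rightarrow> bool" where
  "stationary_space G \<mu> a M \<longleftrightarrow>
     G_space G a M \<and>
     (\<forall>f. ess_bounded M f \<longrightarrow>
        (\<Sum>\<^sub>\<infinity>s\<in>carrier G. (\<integral>x. f (a s x) \<partial>M) * pmf \<mu> s) = (\<integral>x. f x \<partial>M))"

definition pmp_space :: "('g, 'c) monoid_scheme \<Rightarrow> ('g \<Rightarrow> 'x \<Rightarrow> 'x) \<Rightarrow> 'x measure \<Rightarrow> bool" where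
  "pmp_space G a M \<longleftrightarrow> G_space G a M \<and> (\<forall>g\<in>carrier G. distr M M (a g) = M)"

definition diagonal_action ::
  "('g \<Rightarrow> 'x \<Rightarrow> 'x) \<Rightarrow> 'x measure \<Rightarrow> ('g \<Rightarrow> 'y \<Rightarrow> 'y) \<Rightarrow> 'y measure \<Rightarrow> 'g \<Rightarrow> 'x \<times> 'y \<Rightarrow> 'x \<times> 'y" where
  "diagonal_action a M b N g = restrict (map_prod (a g) (b g)) (space M \<times> space N)"

definition trivial_space :: "'x measure \<Rightarrow> bool" where
  "trivial_space M \<longleftrightarrow> (\<exists>x\<^sub>0\<in>space M. AE x in M. x = x\<^sub>0)"

section \<open>Factors and isomorphisms\<close>

definition invariant_conull ::
  "('g, 'c) monoid_scheme \<Rightarrow> ('g \<Rightarrow> 'x \<Rightarrow> 'x) \<Rightarrow> 'x measure \<Rightarrow> 'x set \<Rightarrow> bool" where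
  "invariant_conull G a M X' \<longleftrightarrow> conull M X' \<and> (\<forall>g\<in>carrier G. a g ` X' = X')"

definition factor_map ::
  "('g, 'c) monoid_scheme \<Rightarrow> ('g \<Rightarrow> 'x \<Rightarrow> 'x) \<Rightarrow> 'x measure \<Rightarrow> ('g \<Rightarrow> 'w \<Rightarrow> 'w) \<Rightarrow> 'w measure \<Rightarrow>
    'x set \<Rightarrow> ('x \<Rightarrow> 'w) \<Rightarrow> bool" where
  "factor_map G a M b N X' p \<longleftrightarrow>
     invariant_conull G a M X' \<and>
     p \<in> measurable (restrict_space M X') N \<and>
     (\<forall>g\<in>carrier G. \<forall>x\<in>X'. p (a g x) = b g (p x)) \<and>
     (\<forall>A\<in>sets N. emeasure M (p -` A \<inter> X') = emeasure N A)"

definition is_factor ::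
  "('g, 'c) monoid_scheme \<Rightarrow> ('g \<Rightarrow> 'x \<Rightarrow> 'x) \<Rightarrow> 'x measure \<Rightarrow> ('g \<Rightarrow> 'w \<Rightarrow> 'w) \<Rightarrow> 'w measure \<Rightarrow> bool" where
  "is_factor G a M b N \<longleftrightarrow> G_space G b N \<and> (\<exists>X' p. factor_map G a M b N X' p)"

text \<open>The set \<open>X'\<close> may be shrunk to the (invariant conull) preimage of \<open>W'\<close>, so that the mutually
  inverse maps are genuinely defined between \<open>X'\<close> and \<open>W'\<close>.\<close>

definition isomorphic_spaces ::
  "('g, 'c) monoid_scheme \<Rightarrow> ('g \<Rightarrow> 'x \<Rightarrow> 'x) \<Rightarrow> 'x measure \<Rightarrow> ('g \<Rightarrow> 'w \<Rightarrow> 'w) \<Rightarrow> 'w measure \<Rightarrow> bool" where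
  "isomorphic_spaces G a M b N \<longleftrightarrow>
     (\<exists>X' p W' q.
        factor_map G a M b N X' p \<and>
        invariant_conull G b N W' \<and>
        q \<in> measurable (restrict_space N W') M \<and>
        (\<forall>x\<in>X'. p x \<in> W' \<and> q (p x) = x) \<and>
        (\<forall>w\<in>W'. q w \<in> X' \<and> p (q w) = w) \<and>
        (\<forall>A\<in>sets M. emeasure N (q -` A \<inter> W') = emeasure M A))"

section \<open>Homogeneous spaces of compact groups\<close>

text \<open>As usual, compact groups are Hausdorff.\<close>

definition compact_sc_group :: "('k, 'd) monoid_scheme \<Rightarrow> 'k topology \<Rightarrow> bool" where
  "compact_sc_group K T \<longleftrightarrow>
     Group.group K \<and> topspace T = carrier K \<and>
     continuous_map (prod_topology T T) T (\<lambda>(x, y). x \<otimes>\<^bsub>K\<^esub> y) \<and>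
     continuous_map T T (\<lambda>x. inv\<^bsub>K\<^esub> x) \<and>
     compact_space T \<and> Hausdorff_space T \<and> second_countable T"

definition coset_topology :: "('k, 'd) monoid_scheme \<Rightarrow> 'k topology \<Rightarrow> 'k set \<Rightarrow> 'k set topology" where
  "coset_topology K T L =
     topology (\<lambda>U. U \<subseteq> lcosets\<^bsub>K\<^esub> L \<and> openin T {k \<in> topspace T. k <#\<^bsub>K\<^esub> L \<in> U})"

lemma openin_coset_topology:
  "openin (coset_topology K T L) U \<longleftrightarrow>
     U \<subseteq> lcosets\<^bsub>K\<^esub> L \<and> openin T {k \<in> topspace T. k <#\<^bsub>K\<^esub> L \<in> U}"
proof -
  have "istopology (\<lambda>U. U \<subseteq> lcosets\<^bsub>K\<^esub> L \<and> openin T {k \<in> topspace T. k <#\<^bsub>K\<^esub> L \<in> U})"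
    unfolding istopology_def
  proof (intro conjI allI impI)
    fix U V
    assume U: "U \<subseteq> lcosets\<^bsub>K\<^esub> L \<and> openin T {k \<in> topspace T. k <#\<^bsub>K\<^esub> L \<in> U}"
      and V: "V \<subseteq> lcosets\<^bsub>K\<^esub> L \<and> openin T {k \<in> topspace T. k <#\<^bsub>K\<^esub> L \<in> V}"
    then show "U \<inter> V \<subseteq> lcosets\<^bsub>K\<^esub> L" by blast
    have "{k \<in> topspace T. k <#\<^bsub>K\<^esub> L \<in> U \<inter> V} =
        {k \<in> topspace T. k <#\<^bsub>K\<^esub> L \<in> U} \<inter> {k \<in> topspace T. k <#\<^bsub>K\<^esub> L \<in> V}"
      by blast
    then show "openin T {k \<in> topspace T. k <#\<^bsub>K\<^esub> L \<in> U \<inter> V}"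
      using U V by auto
  next
    fix \<U>
    assume *: "\<forall>U\<in>\<U>. U \<subseteq> lcosets\<^bsub>K\<^esub> L \<and> openin T {k \<in> topspace T. k <#\<^bsub>K\<^esub> L \<in> U}"
    then show "\<Union>\<U> \<subseteq> lcosets\<^bsub>K\<^esub> L" by blast
    have "{k \<in> topspace T. k <#\<^bsub>K\<^esub> L \<in> \<Union>\<U>} = (\<Union>U\<in>\<U>. {k \<in> topspace T. k <#\<^bsub>K\<^esub> L \<in> U})"
      by blast
    then show "openin T {k \<in> topspace T. k <#\<^bsub>K\<^esub> L \<in> \<Union>\<U>}"
      using * by (auto intro: openin_Union)
  qed
  then show ?thesis
    by (simp add: coset_topology_def)
qed

lemma topspace_coset_topology:
  assumes "topspace T = carrier K"
  shows "topspace (coset_topology K T L) = lcosets\<^bsub>K\<^esub> L"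
proof
  show "topspace (coset_topology K T L) \<subseteq> lcosets\<^bsub>K\<^esub> L"
    using openin_topspace[of "coset_topology K T L"] unfolding openin_coset_topology by (rule conjunct1)
  have "{k \<in> topspace T. k <#\<^bsub>K\<^esub> L \<in> lcosets\<^bsub>K\<^esub> L} = topspace T"
    using assms by (auto simp: LCOSETS_def)
  then have "openin (coset_topology K T L) (lcosets\<^bsub>K\<^esub> L)"
    by (simp add: openin_coset_topology)
  then show "lcosets\<^bsub>K\<^esub> L \<subseteq> topspace (coset_topology K T L)"
    by (rule openin_subset)
qed

lemma quotient_map_coset_topology:
  assumes "topspace T = carrier K"
  shows "quotient_map T (coset_topology K T L) (\<lambda>k. k <#\<^bsub>K\<^esub> L)"
  using assms unfolding quotient_map_def
  by (auto simp: topspace_coset_topology openin_coset_topology LCOSETS_def)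

definition coset_translation ::
  "('k, 'd) monoid_scheme \<Rightarrow> 'k set \<Rightarrow> 'k \<Rightarrow> 'k set \<Rightarrow> 'k set" where
  "coset_translation K L k = (\<lambda>C\<in>lcosets\<^bsub>K\<^esub> L. k <#\<^bsub>K\<^esub> C)"

definition haar_prob ::
  "('k, 'd) monoid_scheme \<Rightarrow> 'k topology \<Rightarrow> 'k set \<Rightarrow> 'k set measure \<Rightarrow> bool" where
  "haar_prob K T L m \<longleftrightarrow>
     prob_space m \<and> space m = lcosets\<^bsub>K\<^esub> L \<and>
     sets m = sigma_sets (lcosets\<^bsub>K\<^esub> L) {U. openin (coset_topology K T L) U} \<and>
     (\<forall>k\<in>carrier K. coset_translation K L k \<in> measurable m m \<and>
        distr m m (coset_translation K L k) = m)"

section \<open>Isometric G-spaces\<close>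

text \<open>One cannot quantify over all types carrying a compact second countable group. Nothing is lost
  by taking the elements of \<open>K\<close> from \<open>\<real>\<^sup>\<nat>\<close>: a compact second countable (Hausdorff) space embeds
  topologically in \<open>\<real>\<^sup>\<nat>\<close> by Urysohn's theorem, and the group structure can be transported along the
  embedding. The topology \<open>T\<close> on \<open>K\<close> is arbitrary, not required to be that of \<open>\<real>\<^sup>\<nat>\<close>.\<close>

type_synonym point = "nat \<Rightarrow> real"

definition isometric_space ::
  "('g, 'c) monoid_scheme \<Rightarrow> ('g \<Rightarrow> 'x \<Rightarrow> 'x) \<Rightarrow> 'x measure \<Rightarrow> bool" where
  "isometric_space G a M \<longleftrightarrow>
     G_space G a M \<and>
     (\<exists>(K :: point monoid) T \<tau> L m.
        compact_sc_group K T \<and>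
        \<tau> \<in> hom G K \<and> T closure_of (\<tau> ` carrier G) = carrier K \<and>
        subgroup L K \<and> closedin T L \<and>
        haar_prob K T L m \<and>
        isomorphic_spaces G a M (\<lambda>g. coset_translation K L (\<tau> g)) m)"

end

theory Submission
  imports Defs
begin

text \<open>
  Let \<open>B\<close> be an invariant subset of \<open>X \<times> Y\<close> of measure strictly between \<open>0\<close> and \<open>1\<close>, and
  \<open>f = 1\<^sub>B - c\<close> with \<open>c\<close> its measure. The kernel \<open>t(y, y') = \<integral> f(x, y) f(x, y') d\<nu>(x)\<close> is the mean of its
  translates in \<open>L\<^sup>2(Y \<times> Y)\<close>, because \<open>\<nu>\<close> is stationary; as these have equal norms, strict convexity
  makes \<open>t\<close> invariant. Hence so is \<open>q(x, x') = \<integral>\<integral> t(y, y') f(x, y) f(x', y') dy dy'\<close>, and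
  \<open>d(x, x') = sup\<^sub>g |q(x, g w) - q(x', g w)|\<close> is an invariant pseudometric on a conull subset of \<open>X\<close>. It is
  totally bounded since \<open>t\<close> defines a compact operator, and non-trivial for a suitable \<open>w\<close>. By ergodicity
  almost every point lies in the closure of the orbit of any base point in the support. The translations of
  that orbit have a compact group \<open>K\<close> of isometries as completion, acting transitively on the
  closure, which gives an equivariant map from \<open>X\<close> to \<open>K/L\<close>. The image measure is \<open>K\<close>-invariant by the
  maximum principle: for a Lipschitz function \<open>F\<close>, the function \<open>g \<mapsto> \<integral> F(g x) d\<nu>(x)\<close> is harmonic on
  \<open>G\<close> and uniformly continuous for a totally bounded bi-invariant pseudometric, hence constant.
\<close>

section \<open>Total boundedness\<close>

text \<open>The obstacle is that the measure on \<open>X\<close> is only quasi-invariant: a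
  translation may not be substituted in an integral over \<open>X\<close>, so invariance is routed
  through \<open>Y\<close>, whose measure is preserved. The kernel k(x, z) = \<integral> f(x, y)
  f(z, y) dy is invariant for that reason alone, but offers no visible compactness, since the slices
  f(x, .) are merely bounded. Integrating two copies of k over \<open>X\<close> yields q and gains
  compactness. Invariance of q is then no longer formal: here stationarity enters, through t. The
  sigma-algebras need not be standard, so null sets are not repaired afterwards. The construction
  stays on an explicit invariant conull set where the identities hold for all group elements at
  once, and only countably many balls are ever combined. The elements of \<open>K\<close> must be of
  type \<open>point\<close>; the completion is therefore made of distance functions to an
  enumeration of \<open>G\<close>. Its elements do not act on \<open>X\<close>, and statements about
  them are reached by uniform approximation with group elements.\<close>

text \<open>Stated through colourings, so that it is meaningful for functions of two variables that are
  not known to be pseudometrics, and so that colourings can simply be paired.\<close>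

definition totally_bounded_on :: "'a set \<Rightarrow> ('a \<Rightarrow> 'a \<Rightarrow> real) \<Rightarrow> bool" where
  "totally_bounded_on S e \<longleftrightarrow>
     (\<forall>\<epsilon>>0. \<exists>c::'a \<Rightarrow> nat. finite (c ` S) \<and> (\<forall>x\<in>S. \<forall>y\<in>S. c x = c y \<longrightarrow> e x y < \<epsilon>))"

text \<open>Colours may have any type here. The definition has to fix one type, and
  \<open>nat\<close> suffices because a finite set of colours can be numbered by
  \<open>to_nat_on\<close>.\<close>

lemma totally_bounded_onI:
  assumes "\<And>\<epsilon>. \<epsilon> > 0 \<Longrightarrow> \<exists>c::'a \<Rightarrow> 'b. finite (c ` S) \<and> (\<forall>x\<in>S. \<forall>y\<in>S. c x = c y \<longrightarrow> e x y < \<epsilon>)"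
  shows "totally_bounded_on S e"
  unfolding totally_bounded_on_def
proof (intro allI impI)
  fix \<epsilon> :: real assume "\<epsilon> > 0"
  then obtain c :: "'a \<Rightarrow> 'b" where c: "finite (c ` S)"
    "\<And>x y. \<lbrakk>x \<in> S; y \<in> S; c x = c y\<rbrakk> \<Longrightarrow> e x y < \<epsilon>"
    using assms by metis
  have "inj_on (to_nat_on (c ` S)) (c ` S)"
    by (simp add: c(1) countable_finite inj_on_to_nat_on)
  then have "finite ((to_nat_on (c ` S) \<circ> c) ` S) \<and>
      (\<forall>x\<in>S. \<forall>y\<in>S. (to_nat_on (c ` S) \<circ> c) x = (to_nat_on (c ` S) \<circ> c) y \<longrightarrow> e x y < \<epsilon>)"
    using c by (auto simp flip: image_image simp: image_comp[symmetric] inj_on_eq_iff)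
  then show "\<exists>c::'a \<Rightarrow> nat. finite (c ` S) \<and> (\<forall>x\<in>S. \<forall>y\<in>S. c x = c y \<longrightarrow> e x y < \<epsilon>)"
    by blast
qed

lemma totally_bounded_onE:
  assumes "totally_bounded_on S e" "\<epsilon> > 0"
  obtains c :: "'a \<Rightarrow> nat" where "finite (c ` S)"
    "\<And>x y. \<lbrakk>x \<in> S; y \<in> S; c x = c y\<rbrakk> \<Longrightarrow> e x y < \<epsilon>"
  using assms unfolding totally_bounded_on_def by metis

text \<open>One representative per colour gives a net inside \<open>S\<close> itself, without any
  triangle inequality.\<close>

lemma totally_bounded_on_net:
  assumes "totally_bounded_on S e" "\<epsilon> > 0"
  obtains F where "finite F" "F \<subseteq> S" "\<And>x. x \<in> S \<Longrightarrow> \<exists>y\<in>F. e x y < \<epsilon>"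
proof -
  obtain c :: "'a \<Rightarrow> nat" where c: "finite (c ` S)"
    "\<And>x y. \<lbrakk>x \<in> S; y \<in> S; c x = c y\<rbrakk> \<Longrightarrow> e x y < \<epsilon>"
    using totally_bounded_onE[OF assms] by metis
  obtain F where F: "finite F" "F \<subseteq> S" "c ` F = c ` S"
    using finite_subset_image[OF c(1), of c S] by (metis subset_refl)
  show ?thesis
  proof
    fix x assume "x \<in> S"
    then obtain y where "y \<in> F" "c x = c y"
      using F(3) by (metis imageE imageI)
    then show "\<exists>y\<in>F. e x y < \<epsilon>" using c(2) F(2) \<open>x \<in> S\<close> by blast
  qed (use F in auto)
qed

lemma totally_bounded_on_add:
  assumes "totally_bounded_on S e" "totally_bounded_on S e'"
  shows "totally_bounded_on S (\<lambda>x y. e x y + e' x y)"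
proof (rule totally_bounded_onI)
  fix \<epsilon> :: real assume "\<epsilon> > 0"
  then have \<epsilon>: "\<epsilon> / 2 > 0" by simp
  obtain c :: "'a \<Rightarrow> nat" where c: "finite (c ` S)"
    "\<And>x y. \<lbrakk>x \<in> S; y \<in> S; c x = c y\<rbrakk> \<Longrightarrow> e x y < \<epsilon> / 2"
    using totally_bounded_onE[OF assms(1) \<epsilon>] by blast
  obtain c' :: "'a \<Rightarrow> nat" where c': "finite (c' ` S)"
    "\<And>x y. \<lbrakk>x \<in> S; y \<in> S; c' x = c' y\<rbrakk> \<Longrightarrow> e' x y < \<epsilon> / 2"
    using totally_bounded_onE[OF assms(2) \<epsilon>] by blast
  have "finite ((\<lambda>x. (c x, c' x)) ` S)"
    by (rule finite_subset[of _ "c ` S \<times> c' ` S"]) (use c c' in auto)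
  then show "\<exists>c::'a \<Rightarrow> nat \<times> nat. finite (c ` S) \<and> (\<forall>x\<in>S. \<forall>y\<in>S. c x = c y \<longrightarrow> e x y + e' x y < \<epsilon>)"
    using c(2) c'(2) by (intro exI[of _ "\<lambda>x. (c x, c' x)"]) fastforce
qed

text \<open>Half of \<epsilon> pays for the approximation, half for the colouring of
  \<open>e'\<close>. This allows the tail of an infinite union to be dropped in
  \<open>kernel_totally_bounded\<close>.\<close>

lemma totally_bounded_on_approx:
  assumes "\<And>\<epsilon>. \<epsilon> > 0 \<Longrightarrow>
    \<exists>e'. totally_bounded_on S e' \<and> (\<forall>x\<in>S. \<forall>y\<in>S. e x y \<le> e' x y + \<epsilon>)"
  shows "totally_bounded_on S e"
proof (rule totally_bounded_onI)
  fix \<epsilon> :: real assume "\<epsilon> > 0"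
  then have \<epsilon>: "\<epsilon> / 2 > 0" by simp
  obtain e' where e': "totally_bounded_on S e'" "\<forall>x\<in>S. \<forall>y\<in>S. e x y \<le> e' x y + \<epsilon> / 2"
    using assms[OF \<epsilon>] by blast
  obtain c :: "'a \<Rightarrow> nat" where c: "finite (c ` S)"
    "\<And>x y. \<lbrakk>x \<in> S; y \<in> S; c x = c y\<rbrakk> \<Longrightarrow> e' x y < \<epsilon> / 2"
    using totally_bounded_onE[OF e'(1) \<epsilon>] by blast
  show "\<exists>c::'a \<Rightarrow> nat. finite (c ` S) \<and> (\<forall>x\<in>S. \<forall>y\<in>S. c x = c y \<longrightarrow> e x y < \<epsilon>)"
    using c e'(2) by (intro exI[of _ c]) fastforce
qed

lemma totally_bounded_on_mono:
  assumes "totally_bounded_on S e'" "\<And>x y. \<lbrakk>x \<in> S; y \<in> S\<rbrakk> \<Longrightarrow> e x y \<le> e' x y"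
  shows "totally_bounded_on S e"
  using assms by (intro totally_bounded_on_approx) (smt (verit) assms)

lemma totally_bounded_on_comp:
  assumes "totally_bounded_on S e" "\<And>x. x \<in> S' \<Longrightarrow> h x \<in> S"
  shows "totally_bounded_on S' (\<lambda>x y. e (h x) (h y))"
proof (rule totally_bounded_onI)
  fix \<epsilon> :: real assume "\<epsilon> > 0"
  obtain c :: "'a \<Rightarrow> nat" where c: "finite (c ` S)"
    "\<And>x y. \<lbrakk>x \<in> S; y \<in> S; c x = c y\<rbrakk> \<Longrightarrow> e x y < \<epsilon>"
    using totally_bounded_onE[OF assms(1) \<open>\<epsilon> > 0\<close>] by blast
  have "finite ((c \<circ> h) ` S')"
    by (rule finite_subset[OF _ c(1)]) (use assms(2) in auto)
  then show "\<exists>c::_ \<Rightarrow> nat. finite (c ` S') \<and> (\<forall>x\<in>S'. \<forall>y\<in>S'. c x = c y \<longrightarrow> e (h x) (h y) < \<epsilon>)"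
    using c(2) assms(2) by (intro exI[of _ "c \<circ> h"]) auto
qed

lemma totally_bounded_on_bounded_function:
  fixes h :: "'a \<Rightarrow> real"
  assumes "\<And>x. x \<in> S \<Longrightarrow> \<bar>h x\<bar> \<le> b"
  shows "totally_bounded_on S (\<lambda>x y. \<bar>h x - h y\<bar>)"
proof (rule totally_bounded_onI)
  fix \<epsilon> :: real assume \<epsilon>: "\<epsilon> > 0"
  define c where "c x = \<lfloor>h x / \<epsilon>\<rfloor>" for x
  have "c x \<in> {\<lfloor>- b / \<epsilon>\<rfloor>..\<lfloor>b / \<epsilon>\<rfloor>}" if "x \<in> S" for x
  proof -
    have "- b \<le> h x" "h x \<le> b" using assms[OF that] by auto
    then show ?thesis
      using \<epsilon> unfolding c_def atLeastAtMost_iff by (intro conjI floor_mono divide_right_mono) auto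
  qed
  then have "finite (c ` S)"
    by (meson finite_atLeastAtMost_int finite_subset image_subsetI)
  moreover have "\<bar>h x - h y\<bar> < \<epsilon>" if "c x = c y" for x y
  proof -
    have "\<bar>h x / \<epsilon> - h y / \<epsilon>\<bar> < 1"
      using that unfolding c_def by linarith
    then have "\<bar>h x - h y\<bar> / \<epsilon> < 1"
      using \<epsilon> by (simp add: diff_divide_distrib[symmetric] abs_divide)
    then show ?thesis using \<epsilon> by (simp add: divide_simps)
  qed
  ultimately show "\<exists>c::'a \<Rightarrow> int. finite (c ` S) \<and> (\<forall>x\<in>S. \<forall>y\<in>S. c x = c y \<longrightarrow> \<bar>h x - h y\<bar> < \<epsilon>)"
    by blast
qed

lemma totally_bounded_on_sum:
  assumes "\<And>i. i < (N::nat) \<Longrightarrow> totally_bounded_on S (e i)"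
  shows "totally_bounded_on S (\<lambda>x y. \<Sum>i<N. e i x y)"
  using assms
proof (induction N)
  case 0
  show ?case by (rule totally_bounded_onI) (auto intro!: exI[of _ "\<lambda>_. 0::nat"] intro: finite_subset[of _ "{0}"])
next
  case (Suc N)
  then show ?case by (simp add: totally_bounded_on_add)
qed

section \<open>Infima of real functions\<close>

lemma abs_INF_diff_le:
  fixes f g :: "'a \<Rightarrow> real"
  assumes "A \<noteq> {}" "bdd_below (f ` A)" "bdd_below (g ` A)" "\<And>x. x \<in> A \<Longrightarrow> \<bar>f x - g x\<bar> \<le> \<epsilon>"
  shows "\<bar>(INF x\<in>A. f x) - (INF x\<in>A. g x)\<bar> \<le> \<epsilon>"
proof -
  have "(INF x\<in>A. f x) - \<epsilon> \<le> (INF x\<in>A. g x)"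
  proof (rule cINF_greatest[OF assms(1)])
    fix x assume x: "x \<in> A"
    have "(INF x\<in>A. f x) \<le> f x" by (rule cINF_lower[OF assms(2) x])
    then show "(INF x\<in>A. f x) - \<epsilon> \<le> g x" using assms(4)[OF x] by linarith
  qed
  moreover have "(INF x\<in>A. g x) - \<epsilon> \<le> (INF x\<in>A. f x)"
  proof (rule cINF_greatest[OF assms(1)])
    fix x assume x: "x \<in> A"
    have "(INF x\<in>A. g x) \<le> g x" by (rule cINF_lower[OF assms(3) x])
    then show "(INF x\<in>A. g x) - \<epsilon> \<le> f x" using assms(4)[OF x] by linarith
  qed
  ultimately show ?thesis by linarith
qed

lemma INF_eqI_real:
  fixes f :: "'a \<Rightarrow> real"
  assumes "\<And>x. x \<in> A \<Longrightarrow> v \<le> f x" "x\<^sub>0 \<in> A" "f x\<^sub>0 = v"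
  shows "(INF x\<in>A. f x) = v"
proof (rule antisym)
  have "bdd_below (f ` A)" using assms(1) by (auto intro!: bdd_belowI)
  then show "(INF x\<in>A. f x) \<le> v" using cINF_lower[of f A x\<^sub>0] assms by simp
  show "v \<le> (INF x\<in>A. f x)" using assms by (intro cINF_greatest) auto
qed

lemma tendsto_fun_iff:
  fixes f :: "'b \<Rightarrow> 'i \<Rightarrow> 'a::topological_space"
  shows "(f \<longlongrightarrow> l) F \<longleftrightarrow> (\<forall>i. ((\<lambda>x. f x i) \<longlongrightarrow> l i) F)"
  using limitin_componentwise[where I = UNIV and X = "\<lambda>_. euclidean" and f = f and l = l and F = F]
  by (simp add: euclidean_product_topology)

section \<open>The compact completion of a group with a bi-invariant totally bounded pseudometric\<close>

text \<open>Sup-distance at most \<epsilon>, as a relation, because the supremum of the differences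
  of two arbitrary values of type \<open>point\<close> need not be finite.\<close>

definition near :: "point \<Rightarrow> point \<Rightarrow> real \<Rightarrow> bool" where
  "near k l \<epsilon> \<longleftrightarrow> (\<forall>n. \<bar>k n - l n\<bar> \<le> \<epsilon>)"

lemma nearD: "near k l \<epsilon> \<Longrightarrow> \<bar>k n - l n\<bar> \<le> \<epsilon>"
  by (simp add: near_def)

lemma near_sym: "near k l \<epsilon> \<Longrightarrow> near l k \<epsilon>"
  by (simp add: near_def abs_minus_commute)

lemma near_trans:
  assumes "near k l \<epsilon>" "near l j \<delta>"
  shows "near k j (\<epsilon> + \<delta>)"
  unfolding near_def
proof
  fix n
  show "\<bar>k n - j n\<bar> \<le> \<epsilon> + \<delta>"
    using nearD[OF assms(1), of n] nearD[OF assms(2), of n] by linarith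
qed

lemma near_mono: "near k l \<epsilon> \<Longrightarrow> \<epsilon> \<le> \<delta> \<Longrightarrow> near k l \<delta>"
  unfolding near_def by (meson order_trans)

text \<open>\<open>C\<close> collects the number of approximations that a calculation has spent, so
  that \<epsilon> need not be divided in advance.\<close>

lemma near_eqI:
  assumes "\<And>\<epsilon>. \<epsilon> > 0 \<Longrightarrow> near k l (C * \<epsilon>)"
  shows "k = l"
proof
  fix n
  have "\<bar>k n - l n\<bar> \<le> \<epsilon>" if "\<epsilon> > 0" for \<epsilon>
  proof -
    have "\<epsilon> / (\<bar>C\<bar> + 1) > 0" using that by (intro divide_pos_pos) auto
    from nearD[OF assms[OF this], of n]
    have "\<bar>k n - l n\<bar> \<le> C * (\<epsilon> / (\<bar>C\<bar> + 1))" .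
    also have "\<dots> \<le> (\<bar>C\<bar> + 1) * (\<epsilon> / (\<bar>C\<bar> + 1))"
      using that by (intro mult_right_mono) auto
    also have "\<dots> = \<epsilon>" by (simp add: add_eq_0_iff_both_eq_0)
    finally show ?thesis .
  qed
  then have "\<bar>k n - l n\<bar> \<le> 0" by (rule field_le_epsilon) simp
  then show "k n = l n" by simp
qed

locale bi_invariant_group = group G for G (structure) +
  fixes D :: "'a \<Rightarrow> 'a \<Rightarrow> real" and b :: real
  assumes countable_carrier: "countable (carrier G)"
    and D_self: "g \<in> carrier G \<Longrightarrow> D g g = 0"
    and D_nonneg: "\<lbrakk>g \<in> carrier G; h \<in> carrier G\<rbrakk> \<Longrightarrow> 0 \<le> D g h"
    and D_le: "\<lbrakk>g \<in> carrier G; h \<in> carrier G\<rbrakk> \<Longrightarrow> D g h \<le> b"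
    and D_sym: "\<lbrakk>g \<in> carrier G; h \<in> carrier G\<rbrakk> \<Longrightarrow> D g h = D h g"
    and D_triangle: "\<lbrakk>g \<in> carrier G; h \<in> carrier G; k \<in> carrier G\<rbrakk> \<Longrightarrow> D g k \<le> D g h + D h k"
    and D_left: "\<lbrakk>k \<in> carrier G; g \<in> carrier G; h \<in> carrier G\<rbrakk> \<Longrightarrow> D (k \<otimes> g) (k \<otimes> h) = D g h"
    and D_right: "\<lbrakk>k \<in> carrier G; g \<in> carrier G; h \<in> carrier G\<rbrakk> \<Longrightarrow> D (g \<otimes> k) (h \<otimes> k) = D g h"
    and D_totally_bounded: "totally_bounded_on (carrier G) D"
begin

text \<open>The enumeration is onto the carrier but repeats elements when the group is finite. Hence
  \<open>enum (idx g) = g\<close> holds on the carrier, whereas \<open>idx (enum n) = n\<close> may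
  fail.\<close>

definition enum :: "nat \<Rightarrow> 'a" where "enum = from_nat_into (carrier G)"

definition idx :: "'a \<Rightarrow> nat" where "idx = to_nat_on (carrier G)"

lemma enum_closed [simp]: "enum n \<in> carrier G"
  unfolding enum_def by (rule from_nat_into) (use one_closed in blast)

lemma enum_idx [simp]: "g \<in> carrier G \<Longrightarrow> enum (idx g) = g"
  unfolding enum_def idx_def using countable_carrier by simp

text \<open>An element \<open>k\<close> of the completion is encoded by the distances \<open>n \<mapsto> D(k, enum n)\<close>. In terms of
  these functions, multiplication becomes an infimal convolution.\<close>

definition emb :: "'a \<Rightarrow> point" where "emb g = (\<lambda>n. D g (enum n))"

definition ulimits :: "point set" where
  "ulimits = {k. \<forall>\<epsilon>>0. \<exists>g\<in>carrier G. near k (emb g) \<epsilon>}"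

definition mul :: "point \<Rightarrow> point \<Rightarrow> point" where
  "mul k l = (\<lambda>n. INF m. k m + l (idx (inv (enum m) \<otimes> enum n)))"

definition inve :: "point \<Rightarrow> point" where
  "inve k = (\<lambda>n. k (idx (inv (enum n))))"

definition completion :: "point monoid" where
  "completion = \<lparr>carrier = ulimits, mult = mul, one = emb \<one>\<rparr>"

lemma ulimitsE:
  assumes "k \<in> ulimits" "\<epsilon> > 0"
  obtains g where "g \<in> carrier G" "near k (emb g) \<epsilon>"
  using assms unfolding ulimits_def by blast

lemma emb_idx: "\<lbrakk>g \<in> carrier G; h \<in> carrier G\<rbrakk> \<Longrightarrow> emb g (idx h) = D g h"
  by (simp add: emb_def)

text \<open>The Kuratowski embedding is isometric: the coordinate of \<open>h\<close> itself
  witnesses the distance, and the triangle inequality controls all other coordinates.\<close>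

lemma near_emb_iff:
  assumes "g \<in> carrier G" "h \<in> carrier G"
  shows "near (emb g) (emb h) \<epsilon> \<longleftrightarrow> D g h \<le> \<epsilon>"
proof
  assume "near (emb g) (emb h) \<epsilon>"
  from nearD[OF this, of "idx h"] show "D g h \<le> \<epsilon>"
    using assms by (simp add: emb_idx D_self)
next
  assume "D g h \<le> \<epsilon>"
  then show "near (emb g) (emb h) \<epsilon>"
    unfolding near_def emb_def
    using D_triangle[OF assms(1,2) enum_closed] D_triangle[OF assms(2,1) enum_closed] D_sym[OF assms]
    by (smt (verit))
qed

lemma emb_in_ulimits [simp]: "g \<in> carrier G \<Longrightarrow> emb g \<in> ulimits"
  unfolding ulimits_def using near_emb_iff D_self by fastforce

lemma ulimits_nonneg: 
  assumes "k \<in> ulimits" shows "0 \<le> k n"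
proof (rule field_le_epsilon)
  fix \<epsilon> :: real assume "\<epsilon> > 0"
  with assms obtain g where g: "g \<in> carrier G" "near k (emb g) \<epsilon>" by (rule ulimitsE)
  then show "0 \<le> k n + \<epsilon>"
    using nearD[OF g(2), of n] D_nonneg[OF g(1) enum_closed[of n]] unfolding emb_def by linarith
qed

lemma ulimits_le: 
  assumes "k \<in> ulimits" shows "k n \<le> b"
proof (rule field_le_epsilon)
  fix \<epsilon> :: real assume "\<epsilon> > 0"
  with assms obtain g where g: "g \<in> carrier G" "near k (emb g) \<epsilon>" by (rule ulimitsE)
  then show "k n \<le> b + \<epsilon>"
    using nearD[OF g(2), of n] D_le[OF g(1) enum_closed[of n]] unfolding emb_def by linarith
qed

lemma ulimits_lipschitz:
  assumes "k \<in> ulimits" shows "\<bar>k m - k n\<bar> \<le> D (enum m) (enum n)"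
proof (rule field_le_epsilon)
  fix \<epsilon> :: real assume "\<epsilon> > 0"
  then have "\<epsilon> / 2 > 0" by simp
  with assms obtain g where g: "g \<in> carrier G" "near k (emb g) (\<epsilon> / 2)" by (rule ulimitsE)
  show "\<bar>k m - k n\<bar> \<le> D (enum m) (enum n) + \<epsilon>"
    using nearD[OF g(2), of n] nearD[OF g(2), of m] D_triangle[OF g(1) enum_closed[of n] enum_closed[of m]]
      D_triangle[OF g(1) enum_closed[of m] enum_closed[of n]] D_sym[OF enum_closed[of n] enum_closed[of m]]
    unfolding emb_def by linarith
qed

lemma ulimits_closed_near:
  assumes "\<And>\<epsilon>. \<epsilon> > 0 \<Longrightarrow> \<exists>l\<in>ulimits. near k l (C * \<epsilon>)"
  shows "k \<in> ulimits"
  unfolding ulimits_def mem_Collect_eq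
proof (intro allI impI)
  fix \<epsilon> :: real assume \<epsilon>: "\<epsilon> > 0"
  define \<delta> where "\<delta> = \<epsilon> / (2 * (\<bar>C\<bar> + 1))"
  have \<delta>: "\<delta> > 0" unfolding \<delta>_def using \<epsilon> by (intro divide_pos_pos) auto
  have "C * \<delta> \<le> (\<bar>C\<bar> + 1) * \<delta>" using \<delta> by (intro mult_right_mono) auto
  also have "\<dots> = \<epsilon> / 2" unfolding \<delta>_def by (simp add: divide_simps)
  finally have C: "C * \<delta> \<le> \<epsilon> / 2" .
  obtain l where l: "l \<in> ulimits" "near k l (C * \<delta>)" using assms[OF \<delta>] by blast
  have "\<epsilon> / 2 > 0" using \<epsilon> by simp
  with l(1) obtain g where g: "g \<in> carrier G" "near l (emb g) (\<epsilon> / 2)" by (rule ulimitsE)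
  have "near k (emb g) \<epsilon>"
    by (rule near_mono[OF near_trans[OF l(2) g(2)]]) (use C in simp)
  then show "\<exists>g\<in>carrier G. near k (emb g) \<epsilon>" using g by blast
qed

text \<open>Each competing term moves by at most \<epsilon> + \<delta>, hence so does the infimum;
  nonnegativity keeps the infima bounded below. Together with approximation by \<open>emb\<close>,
  this transfers the group laws from \<open>G\<close> to \<open>ulimits\<close>.\<close>

lemma mul_near:
  assumes "\<And>n. 0 \<le> k n" "\<And>n. 0 \<le> l n" "\<And>n. 0 \<le> k' n" "\<And>n. 0 \<le> l' n"
    and "near k k' \<epsilon>" "near l l' \<delta>"
  shows "near (mul k l) (mul k' l') (\<epsilon> + \<delta>)"
  unfolding near_def mul_def
proof
  fix n
  show "\<bar>(INF m. k m + l (idx (inv (enum m) \<otimes> enum n))) - (INF m. k' m + l' (idx (inv (enum m) \<otimes> enum n)))\<bar> \<le> \<epsilon> + \<delta>"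
  proof (rule abs_INF_diff_le)
    fix m
    show "\<bar>k m + l (idx (inv (enum m) \<otimes> enum n)) - (k' m + l' (idx (inv (enum m) \<otimes> enum n)))\<bar> \<le> \<epsilon> + \<delta>"
      using nearD[OF assms(5), of m] nearD[OF assms(6), of "idx (inv (enum m) \<otimes> enum n)"] by linarith
  qed (auto intro!: bdd_belowI[of _ 0] add_nonneg_nonneg assms)
qed

text \<open>With \<open>u = enum m\<close> and \<open>v = enum n\<close>, bi-invariance turns a term
  of the infimum into D(gh, uh) + D(uh, v). The triangle inequality bounds it below by D(gh, v), and
  u = g attains the bound.\<close>

lemma mul_emb:
  assumes g: "g \<in> carrier G" and h: "h \<in> carrier G"
  shows "mul (emb g) (emb h) = emb (g \<otimes> h)"
proof
  fix n
  have eq: "D h (inv u \<otimes> enum n) = D (u \<otimes> h) (enum n)" if u: "u \<in> carrier G" for u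
    using D_left[OF u h, of "inv u \<otimes> enum n"] u by (simp add: m_assoc[symmetric])
  have "(INF m. D g (enum m) + D h (inv (enum m) \<otimes> enum n)) = D (g \<otimes> h) (enum n)"
  proof (rule INF_eqI_real)
    fix m
    have "D (g \<otimes> h) (enum n) \<le> D (g \<otimes> h) (enum m \<otimes> h) + D (enum m \<otimes> h) (enum n)"
      using g h by (intro D_triangle) auto
    then show "D (g \<otimes> h) (enum n) \<le> D g (enum m) + D h (inv (enum m) \<otimes> enum n)"
      using g h by (simp add: D_right eq)
    show "D g (enum (idx g)) + D h (inv (enum (idx g)) \<otimes> enum n) = D (g \<otimes> h) (enum n)"
      using g h by (simp add: eq D_self)
  qed simp
  then show "mul (emb g) (emb h) n = emb (g \<otimes> h) n"
    using g h by (simp add: mul_def emb_idx) (simp add: emb_def)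
qed

lemma mul_near_emb:
  assumes "k \<in> ulimits" "l \<in> ulimits" "g \<in> carrier G" "h \<in> carrier G"
    and "near k (emb g) \<epsilon>" "near l (emb h) \<delta>"
  shows "near (mul k l) (emb (g \<otimes> h)) (\<epsilon> + \<delta>)"
  unfolding mul_emb[OF assms(3,4), symmetric]
  using assms by (intro mul_near) (auto intro: ulimits_nonneg)

section \<open>Group laws on the completion, by approximation\<close>

lemma mul_closed:
  assumes "k \<in> ulimits" "l \<in> ulimits"
  shows "mul k l \<in> ulimits"
proof (rule ulimits_closed_near[where C = 2])
  fix \<epsilon> :: real assume \<epsilon>: "\<epsilon> > 0"
  obtain g where g: "g \<in> carrier G" "near k (emb g) \<epsilon>" using assms(1) \<epsilon> by (rule ulimitsE)
  obtain h where h: "h \<in> carrier G" "near l (emb h) \<epsilon>" using assms(2) \<epsilon> by (rule ulimitsE)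
  show "\<exists>l'\<in>ulimits. near (mul k l) l' (2 * \<epsilon>)"
    using mul_near_emb[OF assms g(1) h(1) g(2) h(2)] g h by (intro bexI[of _ "emb (g \<otimes> h)"]) auto
qed

lemma mul_assoc:
  assumes "k \<in> ulimits" "l \<in> ulimits" "j \<in> ulimits"
  shows "mul (mul k l) j = mul k (mul l j)"
\<comment> \<open>Each side is within 3\<epsilon> of the encoding of the same product of three
  approximants.\<close>
proof (rule near_eqI[where C = 6])
  fix \<epsilon> :: real assume \<epsilon>: "\<epsilon> > 0"
  obtain g where g: "g \<in> carrier G" "near k (emb g) \<epsilon>" using assms(1) \<epsilon> by (rule ulimitsE)
  obtain h where h: "h \<in> carrier G" "near l (emb h) \<epsilon>" using assms(2) \<epsilon> by (rule ulimitsE)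
  obtain u where u: "u \<in> carrier G" "near j (emb u) \<epsilon>" using assms(3) \<epsilon> by (rule ulimitsE)
  have 1: "near (mul (mul k l) j) (emb (g \<otimes> h \<otimes> u)) (\<epsilon> + \<epsilon> + \<epsilon>)"
    using assms g h u by (intro mul_near_emb mul_closed) auto
  have 2: "near (mul k (mul l j)) (emb (g \<otimes> (h \<otimes> u))) (\<epsilon> + (\<epsilon> + \<epsilon>))"
    using assms g h u by (intro mul_near_emb mul_closed) auto
  have eq: "g \<otimes> (h \<otimes> u) = g \<otimes> h \<otimes> u" using g h u by (simp add: m_assoc)
  show "near (mul (mul k l) j) (mul k (mul l j)) (6 * \<epsilon>)"
    using near_trans[OF 1 near_sym[OF 2[unfolded eq]]] by (rule near_mono) simp
qed

lemma mul_one: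
  assumes "k \<in> ulimits"
  shows "mul (emb \<one>) k = k"
proof (rule near_eqI[where C = 2])
  fix \<epsilon> :: real assume \<epsilon>: "\<epsilon> > 0"
  obtain g where g: "g \<in> carrier G" "near k (emb g) \<epsilon>" using assms(1) \<epsilon> by (rule ulimitsE)
  have "near (emb \<one>) (emb \<one>) 0" by (simp add: near_def)
  then have "near (mul (emb \<one>) k) (emb (\<one> \<otimes> g)) (0 + \<epsilon>)"
    using assms g by (intro mul_near_emb) auto
  then have "near (mul (emb \<one>) k) (emb g) \<epsilon>" using g by simp
  from near_trans[OF this near_sym[OF g(2)]]
  show "near (mul (emb \<one>) k) k (2 * \<epsilon>)" by (rule near_mono) simp
qed

lemma inve_near: "near k l \<epsilon> \<Longrightarrow> near (inve k) (inve l) \<epsilon>"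
  by (simp add: near_def inve_def)

text \<open>Inversion is an isometry by bi-invariance: multiplying by the inverse of g on the left
  and by \<open>enum n\<close> on the right turns the distance from g to the inverse of
  \<open>enum n\<close> into the distance from \<open>enum n\<close> to the inverse of g.\<close>

lemma inve_emb:
  assumes g: "g \<in> carrier G"
  shows "inve (emb g) = emb (inv g)"
proof
  fix n
  have "D g (inv (enum n)) = D \<one> (inv g \<otimes> inv (enum n))"
    using D_left[of "inv g" g "inv (enum n)"] g by simp
  also have "\<dots> = D (enum n) (inv g)"
    using D_right[of "enum n" \<one> "inv g \<otimes> inv (enum n)"] g by (simp add: m_assoc)
  also have "\<dots> = D (inv g) (enum n)" using g by (simp add: D_sym)
  finally show "inve (emb g) n = emb (inv g) n"
    using g by (simp add: inve_def emb_idx) (simp add: emb_def)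
qed

lemma inve_near_emb: "\<lbrakk>g \<in> carrier G; near k (emb g) \<epsilon>\<rbrakk> \<Longrightarrow> near (inve k) (emb (inv g)) \<epsilon>"
  using inve_near[of k "emb g"] by (simp add: inve_emb)

lemma inve_closed:
  assumes "k \<in> ulimits"
  shows "inve k \<in> ulimits"
proof (rule ulimits_closed_near[where C = 1])
  fix \<epsilon> :: real assume \<epsilon>: "\<epsilon> > 0"
  obtain g where g: "g \<in> carrier G" "near k (emb g) \<epsilon>" using assms(1) \<epsilon> by (rule ulimitsE)
  show "\<exists>l\<in>ulimits. near (inve k) l (1 * \<epsilon>)"
    using inve_near_emb[OF g] g by (intro bexI[of _ "emb (inv g)"]) auto
qed

lemma mul_inve:
  assumes "k \<in> ulimits"
  shows "mul (inve k) k = emb \<one>"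
proof (rule near_eqI[where C = 2])
  fix \<epsilon> :: real assume \<epsilon>: "\<epsilon> > 0"
  obtain g where g: "g \<in> carrier G" "near k (emb g) \<epsilon>" using assms(1) \<epsilon> by (rule ulimitsE)
  have "near (mul (inve k) k) (emb (inv g \<otimes> g)) (\<epsilon> + \<epsilon>)"
    using assms g by (intro mul_near_emb inve_closed inve_near_emb) auto
  then show "near (mul (inve k) k) (emb \<one>) (2 * \<epsilon>)" using g by simp
qed

lemma completion_simps [simp]:
  "carrier completion = ulimits" "mult completion = mul" "one completion = emb \<one>"
  by (simp_all add: completion_def)

lemma group_completion: "Group.group completion"
proof (rule groupI)
  show "\<exists>y\<in>carrier completion. y \<otimes>\<^bsub>completion\<^esub> x = \<one>\<^bsub>completion\<^esub>"
    if "x \<in> carrier completion" for x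
    using that by (intro bexI[of _ "inve x"]) (auto simp: mul_inve inve_closed)
qed (auto simp: mul_closed mul_assoc mul_one)

lemma inv_completion: "k \<in> ulimits \<Longrightarrow> inv\<^bsub>completion\<^esub> k = inve k"
  using group.inv_equality[OF group_completion, of "inve k" k] by (simp add: mul_inve inve_closed)

lemma emb_hom: "emb \<in> hom G completion"
  by (auto simp: hom_def mul_emb)

text \<open>The Arzela-Ascoli argument: the functions are uniformly Lipschitz over a totally bounded
  index space, so convergence on a finite net controls all coordinates. Thus the product topology of
  \<open>point\<close> and uniform convergence agree on \<open>ulimits\<close>.\<close>

lemma pointwise_imp_near:
  assumes lip: "\<And>i m n. \<bar>f i m - f i n\<bar> \<le> D (enum m) (enum n)" and lim: "f \<longlonglongrightarrow> k" and "\<epsilon> > 0"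
  shows "\<forall>\<^sub>F i in sequentially. near (f i) k \<epsilon>"
proof -
  have lim': "(\<lambda>i. f i n) \<longlonglongrightarrow> k n" for n
    using lim by (simp add: tendsto_fun_iff)
  have lipk: "\<bar>k m - k n\<bar> \<le> D (enum m) (enum n)" for m n
    by (rule tendsto_upperbound[where F = sequentially and f = "\<lambda>i. \<bar>f i m - f i n\<bar>"])
      (auto intro!: tendsto_intros lim' lip always_eventually)
  have "\<epsilon> / 3 > 0" using \<open>\<epsilon> > 0\<close> by simp
  then obtain F where F: "finite F" "F \<subseteq> carrier G" "\<And>g. g \<in> carrier G \<Longrightarrow> \<exists>h\<in>F. D g h < \<epsilon> / 3"
    by (rule totally_bounded_on_net[OF D_totally_bounded]) blast
  have "\<forall>\<^sub>F i in sequentially. \<forall>h\<in>F. \<bar>f i (idx h) - k (idx h)\<bar> < \<epsilon> / 3"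
    unfolding eventually_ball_finite_distrib[OF F(1)]
    using tendstoD[OF lim' \<open>\<epsilon> / 3 > 0\<close>] by (auto simp: dist_real_def)
  then show ?thesis
  proof eventually_elim
    case (elim i)
    show ?case unfolding near_def
    proof
      fix n
      obtain h where h: "h \<in> F" "D (enum n) h < \<epsilon> / 3" using F(3) enum_closed by blast
      then have "enum (idx h) = h" using F(2) by auto
      then have "\<bar>f i n - f i (idx h)\<bar> < \<epsilon> / 3" "\<bar>k n - k (idx h)\<bar> < \<epsilon> / 3"
        using lip[of i n "idx h"] lipk[of n "idx h"] h(2) by auto
      moreover have "\<bar>f i (idx h) - k (idx h)\<bar> < \<epsilon> / 3" using elim h(1) by blast
      ultimately show "\<bar>f i n - k n\<bar> \<le> \<epsilon>" by argo
    qed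
  qed
qed

lemma ulimits_tendsto_near:
  assumes "\<And>i. f i \<in> ulimits" "f \<longlonglongrightarrow> k" "\<epsilon> > 0"
  shows "\<forall>\<^sub>F i in sequentially. near (f i) k \<epsilon>"
  using assms by (intro pointwise_imp_near ulimits_lipschitz)

lemma near_imp_tendsto:
  assumes "\<And>\<epsilon>. \<epsilon> > 0 \<Longrightarrow> \<forall>\<^sub>F i in sequentially. near (f i) k \<epsilon>"
  shows "f \<longlonglongrightarrow> k"
  unfolding tendsto_fun_iff
proof (intro allI tendstoI)
  fix n and \<epsilon> :: real assume "\<epsilon> > 0"
  then have "\<forall>\<^sub>F i in sequentially. near (f i) k (\<epsilon> / 2)" using assms by simp
  then show "\<forall>\<^sub>F i in sequentially. dist (f i n) (k n) < \<epsilon>"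
    by eventually_elim (use \<open>\<epsilon> > 0\<close> in \<open>auto simp: dist_real_def dest: nearD[where n = n]\<close>)
qed

text \<open>A closed subset of a cube that is compact by Tychonoff. It is closed for pointwise
  convergence because pointwise limits of sequences in \<open>ulimits\<close> are uniform.\<close>

lemma compact_ulimits: "compact ulimits"
proof -
  have "closed ulimits"
    unfolding closed_sequential_limits
  proof (intro allI impI)
    fix f k assume "(\<forall>n. f n \<in> ulimits) \<and> f \<longlonglongrightarrow> k"
    then have f: "\<And>n. f n \<in> ulimits" "f \<longlonglongrightarrow> k" by auto
    show "k \<in> ulimits"
    proof (rule ulimits_closed_near[where C = 1])
      fix \<epsilon> :: real assume "\<epsilon> > 0"
      from ulimits_tendsto_near[OF f this] obtain i where "near (f i) k \<epsilon>"
        by (auto simp: eventually_sequentially)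
      then show "\<exists>l\<in>ulimits. near k l (1 * \<epsilon>)"
          using f(1) by (intro bexI[of _ "f i"]) (simp_all add: near_sym)
    qed
  qed
  moreover have "compact (PiE UNIV (\<lambda>_::nat. {0..b}))"
    using compactin_PiE[of "\<lambda>_. euclidean" UNIV "\<lambda>_::nat. {0..b}"]
    by (simp add: euclidean_product_topology)
  moreover have "ulimits \<subseteq> PiE UNIV (\<lambda>_::nat. {0..b})"
    using ulimits_nonneg ulimits_le by auto
  ultimately show ?thesis
    by (metis compact_Int_closed inf.absorb_iff2)
qed

lemma continuous_mul: "continuous_on (ulimits \<times> ulimits) (\<lambda>(k, l). mul k l)"
proof (rule continuous_on_sequentiallyI)
  fix u :: "nat \<Rightarrow> point \<times> point" and v
  assume u: "\<forall>n. u n \<in> ulimits \<times> ulimits" and v: "v \<in> ulimits \<times> ulimits" and lim: "u \<longlonglongrightarrow> v"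
  show "(\<lambda>n. case u n of (k, l) \<Rightarrow> mul k l) \<longlonglongrightarrow> (case v of (k, l) \<Rightarrow> mul k l)"
  proof (rule near_imp_tendsto)
    fix \<epsilon> :: real assume "\<epsilon> > 0"
    then have \<epsilon>: "\<epsilon> / 2 > 0" by simp
    have "\<forall>\<^sub>F i in sequentially. near (fst (u i)) (fst v) (\<epsilon> / 2)"
      by (rule ulimits_tendsto_near[OF _ tendsto_fst[OF lim] \<epsilon>]) (use u in \<open>auto simp: mem_Times_iff\<close>)
    moreover have "\<forall>\<^sub>F i in sequentially. near (snd (u i)) (snd v) (\<epsilon> / 2)"
      by (rule ulimits_tendsto_near[OF _ tendsto_snd[OF lim] \<epsilon>]) (use u in \<open>auto simp: mem_Times_iff\<close>)
    ultimately show "\<forall>\<^sub>F i in sequentially. near (case u i of (k, l) \<Rightarrow> mul k l) (case v of (k, l) \<Rightarrow> mul k l) \<epsilon>"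
    proof eventually_elim
      case (elim i)
      have "near (mul (fst (u i)) (snd (u i))) (mul (fst v) (snd v)) (\<epsilon> / 2 + \<epsilon> / 2)"
        using elim u v by (intro mul_near) (auto simp: mem_Times_iff intro: ulimits_nonneg)
      then show ?case by (simp add: case_prod_beta)
    qed
  qed
qed

lemma continuous_inve: "continuous_on ulimits inve"
  unfolding inve_def
  by (rule continuous_on_coordinatewise_then_product)
    (rule continuous_on_product_then_coordinatewise[OF continuous_on_id])

section \<open>The completion as a compact group, and density of the image of the group\<close>

abbreviation ulimits_top :: "point topology" where "ulimits_top \<equiv> top_of_set ulimits"

lemma compact_sc_group_completion: "compact_sc_group completion ulimits_top"
proof -
  have "continuous_map (prod_topology ulimits_top ulimits_top) ulimits_top (\<lambda>(x, y). x \<otimes>\<^bsub>completion\<^esub> y)"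
    using continuous_mul by (auto simp: subtopology_Times[symmetric] mul_closed)
  moreover have "continuous_map ulimits_top ulimits_top (\<lambda>x. inv\<^bsub>completion\<^esub> x)"
    using continuous_inve by (auto simp: inve_closed inv_completion cong: continuous_on_cong)
  moreover have "second_countable (euclidean :: point topology)"
  proof -
    obtain B :: "point set set" where B: "countable B" "topological_basis B"
      using ex_countable_basis by auto
    then show ?thesis
      unfolding second_countable_def
      using B by (intro exI[of _ B]) (auto simp: topological_basis_open elim!: topological_basisE)
  qed
  ultimately show ?thesis
    unfolding compact_sc_group_def
    using group_completion compact_ulimits
    by (auto simp: compact_space_subtopology Hausdorff_space_subtopology second_countable_subtopology)
qed

lemma emb_dense: "ulimits_top closure_of (emb ` carrier G) = ulimits"
proof
  show "ulimits_top closure_of (emb ` carrier G) \<subseteq> ulimits"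
    using closure_of_subset_topspace[of ulimits_top] by simp
  show "ulimits \<subseteq> ulimits_top closure_of (emb ` carrier G)"
  proof
    fix k assume k: "k \<in> ulimits"
    have "\<exists>g\<in>carrier G. near k (emb g) (inverse (Suc n))" for n
      using k unfolding ulimits_def by simp
    then obtain f where f: "\<And>n. f n \<in> carrier G" "\<And>n. near k (emb (f n)) (inverse (Suc n))"
      by metis
    have "(\<lambda>n. emb (f n)) \<longlonglongrightarrow> k"
    proof (rule near_imp_tendsto)
      fix \<epsilon> :: real assume "\<epsilon> > 0"
      then have "\<forall>\<^sub>F n in sequentially. inverse (Suc n) < \<epsilon>"
        using LIMSEQ_inverse_real_of_nat by (rule order_tendstoD(2)[rotated])
      then show "\<forall>\<^sub>F n in sequentially. near (emb (f n)) k \<epsilon>"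
        by eventually_elim (meson f(2) less_imp_le near_mono near_sym)
    qed
    then have "k \<in> closure (emb ` carrier G)"
      unfolding closure_sequential using f(1) by (intro exI[of _ "\<lambda>n. emb (f n)"]) auto
    then show "k \<in> ulimits_top closure_of (emb ` carrier G)"
      using k by (subst closure_of_subtopology) (auto simp: Int_absorb1 image_subset_iff)
  qed
qed

end

section \<open>Isometric actions on totally bounded spaces\<close>

locale isometric_orbit = group G for G (structure) +
  fixes a :: "'a \<Rightarrow> 'x \<Rightarrow> 'x" and S :: "'x set" and d :: "'x \<Rightarrow> 'x \<Rightarrow> real" and b :: real and x\<^sub>0 :: 'x
  assumes countable_G: "countable (carrier G)"
    and act_closed: "\<lbrakk>g \<in> carrier G; x \<in> S\<rbrakk> \<Longrightarrow> a g x \<in> S"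
    and act_one: "x \<in> S \<Longrightarrow> a \<one> x = x"
    and act_mult: "\<lbrakk>g \<in> carrier G; h \<in> carrier G; x \<in> S\<rbrakk> \<Longrightarrow> a (g \<otimes> h) x = a g (a h x)"
    and d_self: "x \<in> S \<Longrightarrow> d x x = 0"
    and d_nonneg: "\<lbrakk>x \<in> S; y \<in> S\<rbrakk> \<Longrightarrow> 0 \<le> d x y"
    and d_le: "\<lbrakk>x \<in> S; y \<in> S\<rbrakk> \<Longrightarrow> d x y \<le> b"
    and d_sym: "\<lbrakk>x \<in> S; y \<in> S\<rbrakk> \<Longrightarrow> d x y = d y x"
    and d_triangle: "\<lbrakk>x \<in> S; y \<in> S; z \<in> S\<rbrakk> \<Longrightarrow> d x z \<le> d x y + d y z"
    and d_act: "\<lbrakk>g \<in> carrier G; x \<in> S; y \<in> S\<rbrakk> \<Longrightarrow> d (a g x) (a g y) = d x y"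
    and d_totally_bounded: "totally_bounded_on S d"
    and base: "x\<^sub>0 \<in> S"
begin

text \<open>The sup-distance of two translations over the orbit. The single distance from g
  \<open>x\<^sub>0\<close> to h \<open>x\<^sub>0\<close> is left-invariant but in general not
  right-invariant; right multiplication merely permutes the orbit over which the supremum is
  taken.\<close>

definition D :: "'a \<Rightarrow> 'a \<Rightarrow> real" where
  "D g h = (SUP c\<in>carrier G. d (a g (a c x\<^sub>0)) (a h (a c x\<^sub>0)))"

lemma orb [simp]: "g \<in> carrier G \<Longrightarrow> a g x\<^sub>0 \<in> S"
  by (simp add: act_closed base)

lemma D_upper:
  assumes "g \<in> carrier G" "h \<in> carrier G" "c \<in> carrier G"
  shows "d (a g (a c x\<^sub>0)) (a h (a c x\<^sub>0)) \<le> D g h"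
  unfolding D_def
  by (rule cSUP_upper) (use assms in \<open>auto intro!: bdd_aboveI[of _ b] d_le act_closed base\<close>)

lemma D_upper_base:
  assumes "g \<in> carrier G" "h \<in> carrier G"
  shows "d (a g x\<^sub>0) (a h x\<^sub>0) \<le> D g h"
  using D_upper[OF assms one_closed] by (simp add: act_one base)

lemma D_least:
  assumes "\<And>c. c \<in> carrier G \<Longrightarrow> d (a g (a c x\<^sub>0)) (a h (a c x\<^sub>0)) \<le> r"
  shows "D g h \<le> r"
  unfolding D_def by (rule cSUP_least) (use assms one_closed in auto)

lemma D_bi_invariant: "bi_invariant_group G D b"
proof (intro bi_invariant_group.intro bi_invariant_group_axioms.intro)
  show "Group.group G" by (rule is_group)
  show "countable (carrier G)" by (rule countable_G)
  fix g h k assume [simp]: "g \<in> carrier G" "h \<in> carrier G"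
  show "D g g = 0"
  proof -
    have "D g g = (SUP c\<in>carrier G. 0)"
      unfolding D_def by (rule SUP_cong) (auto simp: d_self act_closed)
    also have "\<dots> = 0" using one_closed by (intro cSUP_const) auto
    finally show ?thesis .
  qed
  show "0 \<le> D g h"
    using D_upper_base[of g h] d_nonneg[of "a g x\<^sub>0" "a h x\<^sub>0"] by simp
  show "D g h \<le> b" by (rule D_least) (simp add: d_le act_closed)
  show "D g h = D h g"
    unfolding D_def by (rule SUP_cong) (auto simp: d_sym act_closed)
  assume [simp]: "k \<in> carrier G"
  show "D g k \<le> D g h + D h k"
  proof (rule D_least)
    fix c assume c: "c \<in> carrier G"
    have "d (a g (a c x\<^sub>0)) (a k (a c x\<^sub>0)) \<le> d (a g (a c x\<^sub>0)) (a h (a c x\<^sub>0)) + d (a h (a c x\<^sub>0)) (a k (a c x\<^sub>0))"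
      using c by (intro d_triangle) (auto simp: act_closed)
    then show "d (a g (a c x\<^sub>0)) (a k (a c x\<^sub>0)) \<le> D g h + D h k"
      using D_upper[of g h c] D_upper[of h k c] c by simp
  qed
next
  fix k g h assume [simp]: "k \<in> carrier G" "g \<in> carrier G" "h \<in> carrier G"
  show "D (k \<otimes> g) (k \<otimes> h) = D g h"
    unfolding D_def by (rule SUP_cong) (auto simp: act_mult act_closed d_act)
  have le: "D (g \<otimes> k) (h \<otimes> k) \<le> D g h" if [simp]: "k \<in> carrier G" "g \<in> carrier G" "h \<in> carrier G" for g h k
  proof (rule D_least)
    fix c assume [simp]: "c \<in> carrier G"
    show "d (a (g \<otimes> k) (a c x\<^sub>0)) (a (h \<otimes> k) (a c x\<^sub>0)) \<le> D g h"
      using D_upper[of g h "k \<otimes> c"] by (simp add: act_mult act_closed base)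
  qed
  show "D (g \<otimes> k) (h \<otimes> k) = D g h"
    using le[of k g h] le[of "inv k" "g \<otimes> k" "h \<otimes> k"] by (simp add: m_assoc)
next
  show "totally_bounded_on (carrier G) D"
  proof (rule totally_bounded_onI)
    fix \<epsilon> :: real assume "\<epsilon> > 0"
    then have \<epsilon>: "\<epsilon> / 5 > 0" by simp
    have tb: "totally_bounded_on (carrier G) (\<lambda>g h. d (a g x\<^sub>0) (a h x\<^sub>0))"
      by (rule totally_bounded_on_comp[OF d_totally_bounded]) simp
    obtain F where F: "finite F" "F \<subseteq> carrier G"
      "\<And>g. g \<in> carrier G \<Longrightarrow> \<exists>f\<in>F. d (a g x\<^sub>0) (a f x\<^sub>0) < \<epsilon> / 5"
      by (rule totally_bounded_on_net[OF tb \<epsilon>]) blast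
    define c where "c g = (\<lambda>f\<in>F. SOME f'. f' \<in> F \<and> d (a g (a f x\<^sub>0)) (a f' x\<^sub>0) < \<epsilon> / 5)" for g
    have c: "c g f \<in> F \<and> d (a g (a f x\<^sub>0)) (a (c g f) x\<^sub>0) < \<epsilon> / 5" if "g \<in> carrier G" "f \<in> F" for g f
    proof -
      have f: "f \<in> carrier G" using that F by auto
      then have "\<exists>f'\<in>F. d (a g (a f x\<^sub>0)) (a f' x\<^sub>0) < \<epsilon> / 5"
        using F(3)[of "g \<otimes> f"] that by (simp add: act_mult base)
      then have "\<exists>f'. f' \<in> F \<and> d (a g (a f x\<^sub>0)) (a f' x\<^sub>0) < \<epsilon> / 5" by blast
      from someI_ex[OF this] show ?thesis using that(2) by (simp add: c_def)
    qed
    have "c ` carrier G \<subseteq> F \<rightarrow>\<^sub>E F"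
      using c by (auto simp: c_def PiE_iff extensional_def)
    then have "finite (c ` carrier G)"
      using finite_PiE[OF F(1), of "\<lambda>_. F"] F(1) by (meson finite_subset)
    moreover have "D g h < \<epsilon>" if [simp]: "g \<in> carrier G" "h \<in> carrier G" and eq: "c g = c h" for g h
    proof -
      have "D g h \<le> 4 * (\<epsilon> / 5)"
      proof (rule D_least)
        fix u assume [simp]: "u \<in> carrier G"
        obtain f where f: "f \<in> F" "d (a u x\<^sub>0) (a f x\<^sub>0) < \<epsilon> / 5" using F(3)[of u] by auto
        have fc [simp]: "f \<in> carrier G" "c h f \<in> carrier G" using f F(2) c[of h f] by auto
        have "d (a g (a f x\<^sub>0)) (a (c h f) x\<^sub>0) < \<epsilon> / 5" using c[of g f] f(1) eq by simp
        moreover have "d (a (c h f) x\<^sub>0) (a h (a f x\<^sub>0)) < \<epsilon> / 5"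
          using c[of h f] f(1) d_sym[of "a (c h f) x\<^sub>0" "a h (a f x\<^sub>0)"] by (simp add: act_closed)
        moreover have "d (a g (a u x\<^sub>0)) (a g (a f x\<^sub>0)) < \<epsilon> / 5" "d (a h (a f x\<^sub>0)) (a h (a u x\<^sub>0)) < \<epsilon> / 5"
          using f(2) d_sym[of "a u x\<^sub>0" "a f x\<^sub>0"] by (simp_all add: d_act)
        moreover have "d (a g (a u x\<^sub>0)) (a h (a u x\<^sub>0)) \<le> d (a g (a u x\<^sub>0)) (a g (a f x\<^sub>0)) + d (a g (a f x\<^sub>0)) (a h (a u x\<^sub>0))"
          "d (a g (a f x\<^sub>0)) (a h (a u x\<^sub>0)) \<le> d (a g (a f x\<^sub>0)) (a (c h f) x\<^sub>0) + d (a (c h f) x\<^sub>0) (a h (a u x\<^sub>0))"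
          "d (a (c h f) x\<^sub>0) (a h (a u x\<^sub>0)) \<le> d (a (c h f) x\<^sub>0) (a h (a f x\<^sub>0)) + d (a h (a f x\<^sub>0)) (a h (a u x\<^sub>0))"
          by (intro d_triangle; simp add: act_closed)+
        ultimately show "d (a g (a u x\<^sub>0)) (a h (a u x\<^sub>0)) \<le> 4 * (\<epsilon> / 5)" by linarith
      qed
      then show ?thesis using \<epsilon> by linarith
    qed
    ultimately show "\<exists>c::'a \<Rightarrow> 'a \<Rightarrow> 'a. finite (c ` carrier G) \<and>
        (\<forall>g\<in>carrier G. \<forall>h\<in>carrier G. c g = c h \<longrightarrow> D g h < \<epsilon>)"
      by blast
  qed
qed

sublocale bi_invariant_group G D b
  by (rule D_bi_invariant)

text \<open>For \<^term>\<open>\<alpha> = emb g\<close> this is the distance to the translate of the base point by \<^term>\<open>g\<close>;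
  for \<^term>\<open>k \<in> ulimits\<close> it is the distance to the image of the base point under \<^term>\<open>k\<close>,
  a point of the completion of the orbit.\<close>

definition infd :: "point \<Rightarrow> 'x \<Rightarrow> real" where
  "infd \<alpha> x = (INF m. \<alpha> m + d (a (enum m) x\<^sub>0) x)"

lemma bdd_infd:
  assumes "\<And>n. 0 \<le> \<alpha> n" "x \<in> S"
  shows "bdd_below (range (\<lambda>m. \<alpha> m + d (a (enum m) x\<^sub>0) x))"
  by (rule bdd_belowI[of _ 0]) (use assms in \<open>auto intro!: add_nonneg_nonneg d_nonneg\<close>)

lemma infd_nonneg: 
  assumes "\<And>n. 0 \<le> \<alpha> n" "x \<in> S"
  shows "0 \<le> infd \<alpha> x"
  unfolding infd_def by (rule cINF_greatest) (use assms in \<open>auto intro!: add_nonneg_nonneg d_nonneg\<close>)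

lemma infd_less_iff:
  assumes "\<And>n. 0 \<le> \<alpha> n" "x \<in> S"
  shows "infd \<alpha> x < \<epsilon> \<longleftrightarrow> (\<exists>m. \<alpha> m + d (a (enum m) x\<^sub>0) x < \<epsilon>)"
  unfolding infd_def using cINF_less_iff[OF _ bdd_infd[OF assms]] by simp

lemma infd_near:
  assumes "\<And>n. 0 \<le> \<alpha> n" "\<And>n. 0 \<le> \<beta> n" "near \<alpha> \<beta> \<epsilon>" "x \<in> S"
  shows "\<bar>infd \<alpha> x - infd \<beta> x\<bar> \<le> \<epsilon>"
  unfolding infd_def
  by (rule abs_INF_diff_le) (use assms bdd_infd in \<open>auto dest: nearD\<close>)

lemma infd_lipschitz:
  assumes "\<And>n. 0 \<le> \<alpha> n" "x \<in> S" "y \<in> S"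
  shows "\<bar>infd \<alpha> x - infd \<alpha> y\<bar> \<le> d x y"
  unfolding infd_def
proof (rule abs_INF_diff_le)
  fix m
  have "d (a (enum m) x\<^sub>0) x \<le> d (a (enum m) x\<^sub>0) y + d y x" "d (a (enum m) x\<^sub>0) y \<le> d (a (enum m) x\<^sub>0) x + d x y"
    using assms by (intro d_triangle; simp)+
  then show "\<bar>\<alpha> m + d (a (enum m) x\<^sub>0) x - (\<alpha> m + d (a (enum m) x\<^sub>0) y)\<bar> \<le> d x y"
    using d_sym[OF assms(2,3)] by linarith
qed (use assms bdd_infd in auto)

lemma infd_emb:
  assumes [simp]: "g \<in> carrier G" "x \<in> S"
  shows "infd (emb g) x = d (a g x\<^sub>0) x"
  unfolding infd_def
proof (rule INF_eqI_real)
  fix m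
  have "d (a g x\<^sub>0) x \<le> d (a g x\<^sub>0) (a (enum m) x\<^sub>0) + d (a (enum m) x\<^sub>0) x"
    by (intro d_triangle) simp_all
  then show "d (a g x\<^sub>0) x \<le> emb g m + d (a (enum m) x\<^sub>0) x"
    using D_upper_base[of g "enum m"] by (simp add: emb_def)
  show "emb g (idx g) + d (a (enum (idx g)) x\<^sub>0) x = d (a g x\<^sub>0) x"
    by (simp add: emb_idx D_self)
qed simp

lemma infd_near_emb:
  assumes "k \<in> ulimits" "g \<in> carrier G" "near k (emb g) \<epsilon>" "x \<in> S"
  shows "\<bar>infd k x - d (a g x\<^sub>0) x\<bar> \<le> \<epsilon>"
  using infd_near[OF _ _ assms(3,4)] assms by (simp add: infd_emb ulimits_nonneg)

lemma continuous_infd: "x \<in> S \<Longrightarrow> continuous_on ulimits (\<lambda>k. infd k x)"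
proof (rule continuous_on_sequentiallyI)
  fix u v assume x: "x \<in> S" and u: "\<forall>n. u n \<in> ulimits" and v: "v \<in> ulimits" and lim: "u \<longlonglongrightarrow> v"
  show "(\<lambda>n. infd (u n) x) \<longlonglongrightarrow> infd v x"
  proof (rule tendstoI)
    fix \<epsilon> :: real assume "\<epsilon> > 0"
    then have "\<forall>\<^sub>F i in sequentially. near (u i) v (\<epsilon> / 2)"
      using ulimits_tendsto_near[of u v "\<epsilon> / 2"] u lim by simp
    then show "\<forall>\<^sub>F i in sequentially. dist (infd (u i) x) (infd v x) < \<epsilon>"
    proof eventually_elim
      case (elim i)
      have "\<bar>infd (u i) x - infd v x\<bar> \<le> \<epsilon> / 2"
        by (rule infd_near) (use u v x elim ulimits_nonneg in auto)
      then show ?case using \<open>\<epsilon> > 0\<close> by (simp add: dist_real_def)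
    qed
  qed
qed

section \<open>The orbit closure as a homogeneous space of the completion\<close>

definition points :: "'x \<Rightarrow> point set" where
  "points x = {k\<in>ulimits. infd k x = 0}"

lemma pointsD:
  assumes "k \<in> points x" "g \<in> carrier G" "near k (emb g) \<epsilon>" "x \<in> S"
  shows "d (a g x\<^sub>0) x \<le> \<epsilon>"
  using infd_near_emb[of k g \<epsilon> x] assms by (simp add: points_def)

lemma pointsI:
  assumes "k \<in> ulimits" "x \<in> S"
    and ex: "\<And>\<epsilon>. \<epsilon> > 0 \<Longrightarrow> \<exists>g\<in>carrier G. near k (emb g) (2 * \<epsilon>) \<and> d (a g x\<^sub>0) x \<le> 2 * \<epsilon>"
  shows "k \<in> points x"
proof -
  have "infd k x \<le> 0"
  proof (rule field_le_epsilon)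
    fix \<epsilon> :: real assume "\<epsilon> > 0"
    then have "\<epsilon> / 4 > 0" by simp
    from ex[OF this] obtain g where g: "g \<in> carrier G" "near k (emb g) (\<epsilon> / 2)" "d (a g x\<^sub>0) x \<le> \<epsilon> / 2"
      by auto
    show "infd k x \<le> 0 + \<epsilon>"
      using infd_near_emb[OF assms(1) g(1,2) assms(2)] g(3) by linarith
  qed
  then show ?thesis
    using assms(1,2) infd_nonneg[of k x] ulimits_nonneg[of k] by (auto simp: points_def)
qed

lemma points_subset: "points x \<subseteq> ulimits"
  by (auto simp: points_def)

abbreviation stab :: "point set" where "stab \<equiv> points x\<^sub>0"

lemma points_mul_stab:
  assumes x: "x \<in> S" and k: "k \<in> points x" and l: "l \<in> stab"
  shows "mul k l \<in> points x"
proof (rule pointsI[OF _ x])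
  have kl: "k \<in> ulimits" "l \<in> ulimits" using k l points_subset by auto
  then show "mul k l \<in> ulimits" by (rule mul_closed)
  fix \<epsilon> :: real assume \<epsilon>: "\<epsilon> > 0"
  obtain g where g: "g \<in> carrier G" "near k (emb g) \<epsilon>" using kl(1) \<epsilon> by (rule ulimitsE)
  obtain h where h: "h \<in> carrier G" "near l (emb h) \<epsilon>" using kl(2) \<epsilon> by (rule ulimitsE)
  have "d (a (g \<otimes> h) x\<^sub>0) x \<le> d (a (g \<otimes> h) x\<^sub>0) (a g x\<^sub>0) + d (a g x\<^sub>0) x"
    using g h x by (intro d_triangle) simp_all
  also have "d (a (g \<otimes> h) x\<^sub>0) (a g x\<^sub>0) = d (a h x\<^sub>0) x\<^sub>0"
    using g h by (simp add: act_mult base d_act)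
  finally have "d (a (g \<otimes> h) x\<^sub>0) x \<le> 2 * \<epsilon>"
    using pointsD[OF l h base] pointsD[OF k g x] by linarith
  then show "\<exists>g\<in>carrier G. near (mul k l) (emb g) (2 * \<epsilon>) \<and> d (a g x\<^sub>0) x \<le> 2 * \<epsilon>"
    using mul_near_emb[OF kl g(1) h(1) g(2) h(2)] g h by (intro bexI[of _ "g \<otimes> h"]) auto
qed

text \<open>Two elements carrying the base point to x differ by one that fixes it. On approximants g
  and h this is invariance of \<open>d\<close> under g followed by the triangle inequality through
  x.\<close>

lemma points_diff_stab:
  assumes x: "x \<in> S" and k: "k \<in> points x" and l: "l \<in> points x"
  shows "mul (inve k) l \<in> stab"
proof (rule pointsI[OF _ base])
  have kl: "k \<in> ulimits" "l \<in> ulimits" using k l points_subset by auto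
  then show "mul (inve k) l \<in> ulimits" by (intro mul_closed inve_closed)
  fix \<epsilon> :: real assume \<epsilon>: "\<epsilon> > 0"
  obtain g where g: "g \<in> carrier G" "near k (emb g) \<epsilon>" using kl(1) \<epsilon> by (rule ulimitsE)
  obtain h where h: "h \<in> carrier G" "near l (emb h) \<epsilon>" using kl(2) \<epsilon> by (rule ulimitsE)
  have "d (a (inv g \<otimes> h) x\<^sub>0) x\<^sub>0 = d (a h x\<^sub>0) (a g x\<^sub>0)"
    using d_act[of g "a (inv g \<otimes> h) x\<^sub>0" x\<^sub>0] g h by (simp add: base m_assoc[symmetric] flip: act_mult)
  also have "\<dots> \<le> d (a h x\<^sub>0) x + d x (a g x\<^sub>0)"
    using g h x by (intro d_triangle) simp_all
  finally have "d (a (inv g \<otimes> h) x\<^sub>0) x\<^sub>0 \<le> 2 * \<epsilon>"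
    using pointsD[OF l h x] pointsD[OF k g x] d_sym[of "a g x\<^sub>0" x] g x by simp
  then show "\<exists>g\<in>carrier G. near (mul (inve k) l) (emb g) (2 * \<epsilon>) \<and> d (a g x\<^sub>0) x\<^sub>0 \<le> 2 * \<epsilon>"
    using mul_near_emb[OF inve_closed[OF kl(1)] kl(2) _ h(1) inve_near_emb[OF g] h(2)] g h
    by (intro bexI[of _ "inv g \<otimes> h"]) auto
qed

lemma points_act:
  assumes u: "u \<in> carrier G" and x: "x \<in> S" and k: "k \<in> points x"
  shows "mul (emb u) k \<in> points (a u x)"
proof (rule pointsI)
  have ku: "k \<in> ulimits" using k points_subset by auto
  then show "mul (emb u) k \<in> ulimits" using u by (simp add: mul_closed)
  show "a u x \<in> S" using u x by (rule act_closed)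
  fix \<epsilon> :: real assume \<epsilon>: "\<epsilon> > 0"
  obtain g where g: "g \<in> carrier G" "near k (emb g) \<epsilon>" using ku \<epsilon> by (rule ulimitsE)
  have "near (mul (emb u) k) (emb (u \<otimes> g)) (0 + \<epsilon>)"
    using u g ku by (intro mul_near_emb) (auto simp: near_def)
  then have "near (mul (emb u) k) (emb (u \<otimes> g)) (2 * \<epsilon>)" by (rule near_mono) (use \<epsilon> in simp)
  moreover have "d (a (u \<otimes> g) x\<^sub>0) (a u x) \<le> 2 * \<epsilon>"
    using pointsD[OF k g x] u g x \<epsilon> by (simp add: act_mult base d_act)
  ultimately show "\<exists>g\<in>carrier G. near (mul (emb u) k) (emb g) (2 * \<epsilon>) \<and> d (a g x\<^sub>0) (a u x) \<le> 2 * \<epsilon>"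
    using u g by (intro bexI[of _ "u \<otimes> g"]) auto
qed

lemma one_in_stab: "emb \<one> \<in> stab"
  by (simp add: points_def infd_emb base act_one d_self)

lemma mul_cancel: "\<lbrakk>k \<in> ulimits; l \<in> ulimits\<rbrakk> \<Longrightarrow> mul k (mul (inve k) l) = l"
  using group.r_inv[OF group_completion, of k] by (simp add: mul_assoc[symmetric] inve_closed mul_one inv_completion)

lemma subgroup_stab: "subgroup stab completion"
proof (rule group.subgroupI[OF group_completion])
  show "stab \<subseteq> carrier completion" using points_subset by simp
  show "stab \<noteq> {}" using one_in_stab by blast
  show "inv\<^bsub>completion\<^esub> k \<in> stab" if "k \<in> stab" for k
  proof -
    have k: "k \<in> ulimits" using that points_subset by auto
    have "mul (inve k) (emb \<one>) = inve k"
      using group.is_monoid[OF group_completion] monoid.r_one[of completion "inve k"] k by (simp add: inve_closed)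
    then show ?thesis
      using points_diff_stab[OF base that one_in_stab] k by (simp add: inv_completion)
  qed
  show "k \<otimes>\<^bsub>completion\<^esub> l \<in> stab" if "k \<in> stab" "l \<in> stab" for k l
    using points_mul_stab[OF base that] by simp
qed

abbreviation coset :: "point \<Rightarrow> point set" where
  "coset k \<equiv> k <#\<^bsub>completion\<^esub> stab"

abbreviation translate :: "point \<Rightarrow> point set \<Rightarrow> point set" where
  "translate \<equiv> coset_translation completion stab"

text \<open>\<open>points x\<close> consists of the elements that carry the base point to x, up to
  distance zero; such a set is a left coset of the stabiliser. So \<open>points\<close> itself
  serves as the factor map.\<close>

lemma points_eq_coset:
  assumes "x \<in> S" "k \<in> points x"
  shows "points x = coset k"
proof
  have k: "k \<in> ulimits" using assms points_subset by auto
  show "points x \<subseteq> coset k"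
  proof
    fix l assume l: "l \<in> points x"
    then have "l = mul k (mul (inve k) l)" using k points_subset[of x] by (simp add: mul_cancel subset_iff)
    then show "l \<in> coset k"
      using points_diff_stab[OF assms l] by (auto simp: l_coset_def)
  qed
  show "coset k \<subseteq> points x"
    using points_mul_stab[OF assms] by (auto simp: l_coset_def)
qed

lemma compact_points: "x \<in> S \<Longrightarrow> compact (points x)"
proof -
  assume x: "x \<in> S"
  have "closedin (top_of_set ulimits) (ulimits \<inter> (\<lambda>k. infd k x) -` {0})"
    by (rule continuous_closedin_preimage[OF continuous_infd[OF x]]) simp
  moreover have "ulimits \<inter> (\<lambda>k. infd k x) -` {0} = points x" by (auto simp: points_def)
  ultimately show ?thesis by (metis closedin_compact compact_ulimits)
qed

definition orbit_closure :: "'x set" where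
  "orbit_closure = {x\<in>S. \<forall>\<epsilon>>0. \<exists>g\<in>carrier G. d (a g x\<^sub>0) x < \<epsilon>}"

text \<open>A continuous function attains its infimum on a compact set, so arbitrarily small
  distances yield an exact zero.\<close>

lemma infd_attains_0:
  assumes C: "compact C" "C \<subseteq> ulimits" and x: "x \<in> S" and small: "\<And>\<epsilon>. \<epsilon> > 0 \<Longrightarrow> \<exists>k\<in>C. infd k x < \<epsilon>"
  shows "\<exists>k\<in>C. k \<in> points x"
proof -
  have "C \<noteq> {}" using small[of 1] by auto
  then obtain k where k: "k \<in> C" "\<And>l. l \<in> C \<Longrightarrow> infd k x \<le> infd l x"
    using continuous_attains_inf[OF C(1) _ continuous_on_subset[OF continuous_infd[OF x] C(2)]] by blast
  have "infd k x \<le> 0"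
    by (rule field_le_epsilon) (use small k(2) in \<open>fastforce intro: order_trans less_imp_le\<close>)
  then have "infd k x = 0" using infd_nonneg[of k x] ulimits_nonneg[of k] k(1) C(2) x by fastforce
  then show ?thesis using k(1) C(2) by (auto simp: points_def)
qed

text \<open>Compactness of the completion turns the approximate transitivity of \<open>G\<close> on
  the orbit closure into genuine transitivity.\<close>

lemma points_nonempty:
  assumes "x \<in> orbit_closure"
  shows "points x \<noteq> {}"
proof -
  have x: "x \<in> S" using assms by (simp add: orbit_closure_def)
  have "\<exists>k\<in>ulimits. k \<in> points x"
  proof (rule infd_attains_0[OF compact_ulimits subset_refl x])
    fix \<epsilon> :: real assume "\<epsilon> > 0"
    then obtain g where "g \<in> carrier G" "d (a g x\<^sub>0) x < \<epsilon>" using assms by (auto simp: orbit_closure_def)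
    then show "\<exists>k\<in>ulimits. infd k x < \<epsilon>" using x by (intro bexI[of _ "emb g"]) (auto simp: infd_emb)
  qed
  then show ?thesis by blast
qed

lemma points_in_cosets:
  assumes "x \<in> orbit_closure"
  shows "points x \<in> lcosets\<^bsub>completion\<^esub> stab"
proof -
  obtain k where "k \<in> points x" using points_nonempty[OF assms] by blast
  then show ?thesis
    using points_eq_coset[of x k] points_subset assms by (auto simp: LCOSETS_def orbit_closure_def)
qed

lemma orbit_closure_act:
  assumes "x \<in> orbit_closure" "u \<in> carrier G"
  shows "a u x \<in> orbit_closure"
  unfolding orbit_closure_def mem_Collect_eq
proof (intro conjI allI impI)
  have x: "x \<in> S" using assms by (simp add: orbit_closure_def)
  then show "a u x \<in> S" using assms by (simp add: act_closed)
  fix \<epsilon> :: real assume "\<epsilon> > 0"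
  then obtain g where "g \<in> carrier G" "d (a g x\<^sub>0) x < \<epsilon>" using assms by (auto simp: orbit_closure_def)
  then show "\<exists>g\<in>carrier G. d (a g x\<^sub>0) (a u x) < \<epsilon>"
    using assms(2) x by (intro bexI[of _ "u \<otimes> g"]) (auto simp: act_mult base d_act)
qed

lemma translate_coset:
  assumes "k \<in> ulimits" "l \<in> ulimits"
  shows "l <#\<^bsub>completion\<^esub> (coset k) = coset (mul l k)"
  using group.lcos_m_assoc[OF group_completion, of stab l k] points_subset assms by simp

lemma coset_translation_points:
  assumes "x \<in> orbit_closure" "u \<in> carrier G"
  shows "translate (emb u) (points x) = points (a u x)"
proof -
  have x: "x \<in> S" "a u x \<in> S" using assms by (auto simp: orbit_closure_def act_closed)
  obtain k where k: "k \<in> points x" using points_nonempty[OF assms(1)] by blast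
  then have ku: "k \<in> ulimits" using points_subset by auto
  show ?thesis
    using points_in_cosets[OF assms(1)] points_eq_coset[OF x(1) k] translate_coset[of k "emb u"]
      points_eq_coset[OF x(2) points_act[OF assms(2) x(1) k]] ku assms(2)
    by (simp add: coset_translation_def)
qed

text \<open>Passing to cosets identifies only points at distance zero; this is what later keeps the
  factor from being trivial.\<close>

lemma points_eq_imp_d:
  assumes "x \<in> orbit_closure" "y \<in> S" "points x = points y"
  shows "d x y = 0"
proof -
  have x: "x \<in> S" using assms by (simp add: orbit_closure_def)
  obtain k where k: "k \<in> points x" using points_nonempty[OF assms(1)] by blast
  then have ku: "k \<in> ulimits" using points_subset by auto
  have "d x y \<le> 0"
  proof (rule field_le_epsilon)
    fix \<epsilon> :: real assume "\<epsilon> > 0"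
    then have \<epsilon>: "\<epsilon> / 2 > 0" by simp
    obtain g where g: "g \<in> carrier G" "near k (emb g) (\<epsilon> / 2)" using ku \<epsilon> by (rule ulimitsE)
    have "d x y \<le> d x (a g x\<^sub>0) + d (a g x\<^sub>0) y" using g x assms(2) by (intro d_triangle) auto
    then show "d x y \<le> 0 + \<epsilon>"
      using pointsD[OF k g x] pointsD[OF k[unfolded assms(3)] g assms(2)] d_sym[of x "a g x\<^sub>0"] x g by simp
  qed
  then show ?thesis using d_nonneg[OF x assms(2)] by simp
qed

text \<open>The supremum in \<open>D\<close> sees only the orbit; density extends the bound to its
  closure, which carries the whole measure in \<open>isometric_model\<close>. The Lipschitz estimate
  in \<open>bump_integral_act\<close> rests on this.\<close>

lemma d_act_le_D:
  assumes "g \<in> carrier G" "h \<in> carrier G" "x \<in> orbit_closure"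
  shows "d (a g x) (a h x) \<le> D g h"
proof (rule field_le_epsilon)
  fix \<epsilon> :: real assume "\<epsilon> > 0"
  then have "\<epsilon> / 2 > 0" by simp
  then obtain c where c: "c \<in> carrier G" "d (a c x\<^sub>0) x < \<epsilon> / 2"
    using assms(3) unfolding orbit_closure_def by blast
  have x: "x \<in> S" using assms by (simp add: orbit_closure_def)
  have "d (a g x) (a h x) \<le> d (a g x) (a g (a c x\<^sub>0)) + d (a g (a c x\<^sub>0)) (a h x)"
    "d (a g (a c x\<^sub>0)) (a h x) \<le> d (a g (a c x\<^sub>0)) (a h (a c x\<^sub>0)) + d (a h (a c x\<^sub>0)) (a h x)"
    using assms c x by (intro d_triangle; simp add: act_closed)+
  then show "d (a g x) (a h x) \<le> D g h + \<epsilon>"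
    using D_upper[OF assms(1,2) c(1)] c(2) assms c x d_sym[of x "a c x\<^sub>0"] by (simp add: d_act)
qed

text \<open>The distance of the points of the enumerated orbit to a set of cosets, so that
  \<^term>\<open>infd (set_dist C)\<close> is the distance to \<^term>\<open>C\<close> pulled back along \<^term>\<open>points\<close>.\<close>

definition set_dist :: "point set \<Rightarrow> point" where
  "set_dist C = (\<lambda>n. INF k\<in>C. k n)"

lemma bdd_set_dist: "C \<subseteq> ulimits \<Longrightarrow> bdd_below ((\<lambda>k. k n) ` C)"
  by (rule bdd_belowI[of _ 0]) (auto intro: ulimits_nonneg)

lemma set_dist_nonneg: "\<lbrakk>C \<subseteq> ulimits; C \<noteq> {}\<rbrakk> \<Longrightarrow> 0 \<le> set_dist C n"
  unfolding set_dist_def by (rule cINF_greatest) (auto intro: ulimits_nonneg)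

text \<open>Compactness makes the infimum over \<open>C\<close> attained. Membership in a closed set
  of cosets thereby becomes the vanishing of one Lipschitz function on the space, through which
  measurability and measure are accessible.\<close>

lemma infd_set_dist_0_iff:
  assumes C: "compact C" "C \<subseteq> ulimits" "C \<noteq> {}" and x: "x \<in> S"
  shows "infd (set_dist C) x = 0 \<longleftrightarrow> (\<exists>k\<in>C. k \<in> points x)"
proof
  assume 0: "infd (set_dist C) x = 0"
  show "\<exists>k\<in>C. k \<in> points x"
  proof (rule infd_attains_0[OF C(1,2) x])
    fix \<epsilon> :: real assume "\<epsilon> > 0"
    then obtain m where m: "set_dist C m + d (a (enum m) x\<^sub>0) x < \<epsilon>"
      using infd_less_iff[of "set_dist C" x \<epsilon>] 0 set_dist_nonneg[OF C(2,3)] x by auto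
    then obtain k where k: "k \<in> C" "k m < \<epsilon> - d (a (enum m) x\<^sub>0) x"
      using cINF_less_iff[OF C(3) bdd_set_dist[OF C(2)], of m "\<epsilon> - d (a (enum m) x\<^sub>0) x"]
      unfolding set_dist_def by (auto simp: less_diff_eq)
    have "k m + d (a (enum m) x\<^sub>0) x < \<epsilon>" using k(2) by simp
    then have "infd k x < \<epsilon>"
      using infd_less_iff[of k x \<epsilon>] ulimits_nonneg[of k] k(1) C(2) x by blast
    then show "\<exists>k\<in>C. infd k x < \<epsilon>" using k(1) by blast
  qed
next
  assume "\<exists>k\<in>C. k \<in> points x"
  then obtain k where k: "k \<in> C" "infd k x = 0" by (auto simp: points_def)
  have "infd (set_dist C) x \<le> 0"
  proof (rule field_le_epsilon)
    fix \<epsilon> :: real assume "\<epsilon> > 0"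
    then obtain m where m: "k m + d (a (enum m) x\<^sub>0) x < \<epsilon>"
      using infd_less_iff[of k x \<epsilon>] k ulimits_nonneg[of k] C(2) x by auto
    have "set_dist C m \<le> k m"
      unfolding set_dist_def by (rule cINF_lower[OF bdd_set_dist[OF C(2)] k(1)])
    then have "set_dist C m + d (a (enum m) x\<^sub>0) x < \<epsilon>" using m by simp
    then show "infd (set_dist C) x \<le> 0 + \<epsilon>"
      using infd_less_iff[of "set_dist C" x \<epsilon>] set_dist_nonneg[OF C(2,3)] x by auto
  qed
  then show "infd (set_dist C) x = 0"
    using infd_nonneg[of "set_dist C" x] set_dist_nonneg[OF C(2,3)] x by simp
qed

text \<open>Moving \<open>C\<close> by the inverse of k amounts to moving x by k. Since k does not
  act on x, a group element g close to k acts instead, at a cost \<epsilon> that does not depend on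
  x.\<close>

lemma infd_set_dist_translate:
  assumes C: "C \<subseteq> ulimits" "C \<noteq> {}" and k: "k \<in> ulimits" and g: "g \<in> carrier G" and near: "near k (emb g) \<epsilon>"
    and x: "x \<in> S"
  shows "\<bar>infd (set_dist (mul (inve k) ` C)) x - infd (set_dist C) (a g x)\<bar> \<le> \<epsilon>"
proof -
  \<comment> \<open>The distance function of the translate of \<open>C\<close> by the inverse of g,
    exactly: it differs from the one for k by at most \<epsilon>, and its \<open>infd\<close> at x
    is that of \<open>C\<close> at g x.\<close>
  define \<beta> where "\<beta> n = set_dist C (idx (g \<otimes> enum n))" for n
  have kC: "mul (inve k) ` C \<subseteq> ulimits" "mul (inve k) ` C \<noteq> {}"
    using C k by (auto intro!: mul_closed inve_closed)
  have shift: "mul (emb (inv g)) c n = c (idx (g \<otimes> enum n))" if c: "c \<in> ulimits" for c n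
  proof (rule antisym; rule field_le_epsilon)
    have *: "\<bar>mul (emb (inv g)) c n - c (idx (g \<otimes> enum n))\<bar> \<le> 2 * \<delta>" if "\<delta> > 0" for \<delta>
    proof -
      obtain h where h: "h \<in> carrier G" "near c (emb h) \<delta>" by (rule ulimitsE[OF c \<open>\<delta> > 0\<close>])
      have "near (mul (emb (inv g)) c) (emb (inv g \<otimes> h)) (0 + \<delta>)"
        using g h c by (intro mul_near_emb) (auto simp: near_def)
      moreover have "emb (inv g \<otimes> h) n = emb h (idx (g \<otimes> enum n))"
        using g h D_left[of g "inv g \<otimes> h" "enum n"] by (simp add: emb_idx m_assoc[symmetric]) (simp add: emb_def)
      ultimately show ?thesis
        using nearD[OF h(2), of "idx (g \<otimes> enum n)"] by (auto dest!: nearD[where n = n])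
    qed
    show "mul (emb (inv g)) c n \<le> c (idx (g \<otimes> enum n)) + \<delta>"
      "c (idx (g \<otimes> enum n)) \<le> mul (emb (inv g)) c n + \<delta>" if "\<delta> > 0" for \<delta>
      using *[of "\<delta> / 2"] that by auto
  qed
  have \<beta>: "\<beta> n = (INF c\<in>C. mul (emb (inv g)) c n)" for n
    unfolding \<beta>_def set_dist_def by (rule INF_cong) (use C(1) shift in auto)
  have "near (set_dist (mul (inve k) ` C)) \<beta> \<epsilon>"
    unfolding near_def set_dist_def \<beta> image_image
  proof (intro allI abs_INF_diff_le)
    fix n c assume c: "c \<in> C"
    have "near (mul (inve k) c) (mul (emb (inv g)) c) (\<epsilon> + 0)"
    proof (rule mul_near)
      show "near (inve k) (emb (inv g)) \<epsilon>" using g near by (rule inve_near_emb)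
    qed (use c C k g in \<open>auto simp: near_def intro!: ulimits_nonneg inve_closed\<close>)
    then show "\<bar>mul (inve k) c n - mul (emb (inv g)) c n\<bar> \<le> \<epsilon>" by (simp add: near_def)
  qed (use C k g in \<open>auto intro!: bdd_belowI[of _ 0] ulimits_nonneg[OF mul_closed] inve_closed\<close>)
  moreover have "0 \<le> \<beta> n" for n unfolding \<beta>_def by (rule set_dist_nonneg[OF C])
  ultimately have "\<bar>infd (set_dist (mul (inve k) ` C)) x - infd \<beta> x\<bar> \<le> \<epsilon>"
    using set_dist_nonneg[OF kC] x by (intro infd_near)
  moreover have "infd \<beta> x = infd (set_dist C) (a g x)"
  proof -
    have eq: "\<beta> m + d (a (enum m) x\<^sub>0) x =
        set_dist C (idx (g \<otimes> enum m)) + d (a (g \<otimes> enum m) x\<^sub>0) (a g x)" for m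
      using g x by (simp add: \<beta>_def act_mult base d_act)
    have gx: "a g x \<in> S" using g x by (rule act_closed)
    \<comment> \<open>Strict sublevel sets are compared instead of reindexing the infimum, because
      multiplication by g need not induce a bijection of indices when \<open>enum\<close> repeats
      elements.\<close>
    have less: "infd \<beta> x < r \<longleftrightarrow> infd (set_dist C) (a g x) < r" for r
    proof -
      have "infd \<beta> x < r \<longleftrightarrow> (\<exists>m. set_dist C (idx (g \<otimes> enum m)) + d (a (g \<otimes> enum m) x\<^sub>0) (a g x) < r)"
        using infd_less_iff[of \<beta> x r] \<open>\<And>n. 0 \<le> \<beta> n\<close> x by (simp add: eq)
      also have "\<dots> \<longleftrightarrow> (\<exists>h\<in>carrier G. set_dist C (idx h) + d (a h x\<^sub>0) (a g x) < r)"
      proof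
        assume "\<exists>h\<in>carrier G. set_dist C (idx h) + d (a h x\<^sub>0) (a g x) < r"
        then obtain h where h: "h \<in> carrier G" "set_dist C (idx h) + d (a h x\<^sub>0) (a g x) < r" by blast
        then show "\<exists>m. set_dist C (idx (g \<otimes> enum m)) + d (a (g \<otimes> enum m) x\<^sub>0) (a g x) < r"
          using g by (intro exI[of _ "idx (inv g \<otimes> h)"]) (simp add: m_assoc[symmetric])
      qed (use g in auto)
      also have "\<dots> \<longleftrightarrow> (\<exists>m. set_dist C m + d (a (enum m) x\<^sub>0) (a g x) < r)"
      proof
        assume "\<exists>m. set_dist C m + d (a (enum m) x\<^sub>0) (a g x) < r"
        then obtain m where m: "set_dist C m + d (a (enum m) x\<^sub>0) (a g x) < r" by blast
        \<comment> \<open>The indices \<open>m\<close> and \<open>idx (enum m)\<close> may differ,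
          but they name the same group element, and the Lipschitz property forces equal
          values.\<close>
        have "c m = c (idx (enum m))" if "c \<in> ulimits" for c
          using ulimits_lipschitz[OF that, of m "idx (enum m)"] by (simp add: D_self)
        then have "set_dist C m = set_dist C (idx (enum m))"
          unfolding set_dist_def using C(1) by (intro INF_cong) auto
        then show "\<exists>h\<in>carrier G. set_dist C (idx h) + d (a h x\<^sub>0) (a g x) < r"
          using m by (intro bexI[of _ "enum m"]) auto
      next
        assume "\<exists>h\<in>carrier G. set_dist C (idx h) + d (a h x\<^sub>0) (a g x) < r"
        then obtain h where h: "h \<in> carrier G" "set_dist C (idx h) + d (a h x\<^sub>0) (a g x) < r" by blast
        then show "\<exists>m. set_dist C m + d (a (enum m) x\<^sub>0) (a g x) < r"
          by (intro exI[of _ "idx h"]) simp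
      qed
      also have "\<dots> \<longleftrightarrow> infd (set_dist C) (a g x) < r"
        using infd_less_iff[of "set_dist C" "a g x" r] set_dist_nonneg[OF C] gx by simp
      finally show ?thesis .
    qed
    show ?thesis
      using less[of "infd \<beta> x"] less[of "infd (set_dist C) (a g x)"] by linarith
  qed
  ultimately show ?thesis by simp
qed

end

section \<open>Measure-class preserving actions\<close>

locale measured_action =
  fixes G (structure) and a :: "'a \<Rightarrow> 'x \<Rightarrow> 'x" and M :: "'x measure"
  assumes G_space: "G_space G a M"
begin

sublocale prob_space M
  using G_space by (simp add: G_space_def)

sublocale group_action G "space M" a
  using G_space by (simp add: G_space_def)

sublocale group G
  by (rule group_hom.axioms(1)[OF group_hom])

lemma act_measurable [measurable (raw)]: "g \<in> carrier G \<Longrightarrow> a g \<in> measurable M M"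
  using G_space by (simp add: G_space_def)

lemma act_space: "\<lbrakk>g \<in> carrier G; x \<in> space M\<rbrakk> \<Longrightarrow> a g x \<in> space M"
  using element_image by blast

lemma act_one: "x \<in> space M \<Longrightarrow> a \<one> x = x"
  using id_eq_one by (metis restrict_apply')

lemma act_mult: "\<lbrakk>g \<in> carrier G; h \<in> carrier G; x \<in> space M\<rbrakk> \<Longrightarrow> a (g \<otimes> h) x = a g (a h x)"
  by (rule composition_rule)

lemma act_inv [simp]:
  assumes "g \<in> carrier G" "x \<in> space M"
  shows "a g (a (inv g) x) = x" "a (inv g) (a g x) = x"
  using assms by (simp_all add: act_one flip: act_mult)

lemma act_image:
  assumes "g \<in> carrier G" "B \<subseteq> space M"
  shows "a g ` B = a (inv g) -` B \<inter> space M"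
proof
  show "a g ` B \<subseteq> a (inv g) -` B \<inter> space M"
    using assms by (auto simp: act_space subset_iff)
  show "a (inv g) -` B \<inter> space M \<subseteq> a g ` B"
    using assms by (metis (no_types, lifting) IntE act_inv(1) image_eqI subsetI vimageE)
qed

lemma AE_act:
  assumes "g \<in> carrier G" "AE x in M. P x"
  shows "AE x in M. P (a g x)"
proof -
  obtain N where N: "N \<in> null_sets M" "{x\<in>space M. \<not> P x} \<subseteq> N"
    using assms(2) by (auto simp: eventually_ae_filter)
  have "a g -` N \<inter> space M \<in> null_sets M"
    using G_space assms(1) N(1) by (auto simp: G_space_def)
  then show ?thesis
    by (rule AE_I') (use N(2) assms(1) act_space in auto)
qed

text \<open>The set where u lies below its mean is invariant up to null sets. It is not conull, as
  the integral would then be smaller than itself, so ergodicity makes it null. Applied to u and to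
  -u this gives constancy.\<close>

lemma ergodic_AE_ge_integral:
  assumes erg: "ergodic G a M" and u [measurable]: "u \<in> borel_measurable M"
    and bound: "\<And>x. x \<in> space M \<Longrightarrow> \<bar>u x\<bar> \<le> (C::real)"
    and inv: "\<And>g. g \<in> carrier G \<Longrightarrow> AE x in M. u (a g x) = u x"
  shows "AE x in M. u x \<ge> (\<integral>x. u x \<partial>M)"
proof -
  define r where "r = (\<integral>x. u x \<partial>M)"
  define B where "B = {x\<in>space M. u x < r}"
  have [measurable]: "B \<in> sets M" unfolding B_def by measurable
  have "sym_diff B (a g ` B) \<in> null_sets M" if g: "g \<in> carrier G" for g
  proof -
    have im: "a g ` B = a (inv g) -` B \<inter> space M"
      using g by (intro act_image) (auto simp: B_def)
    have [measurable]: "a g ` B \<in> sets M"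
      unfolding im using g by (intro measurable_sets[OF act_measurable]) auto
    have "AE x in M. u (a (inv g) x) = u x" using g by (intro inv) simp
    then have "AE x in M. x \<notin> sym_diff B (a g ` B)"
      unfolding im by (rule AE_mp) (use g in \<open>auto simp: B_def act_space intro!: AE_I2\<close>)
    then show ?thesis by (subst AE_iff_null_sets) auto
  qed
  then have "B \<in> null_sets M \<or> conull M B"
    using erg by (auto simp: ergodic_def)
  moreover have "\<not> conull M B"
  proof
    assume "conull M B"
    then have "AE x in M. x \<notin> space M - B" unfolding conull_def by (intro AE_not_in) simp
    then have "AE x in M. u x < r" by (rule AE_mp) (auto simp: B_def intro!: AE_I2)
    moreover have "integrable M u"
      by (rule integrable_const_bound[of _ C]) (use bound in auto)
    ultimately have "(\<integral>x. u x \<partial>M) < (\<integral>x. r \<partial>M)"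
      by (intro integral_less_AE_space) (auto simp: emeasure_space_1)
    then show False by (simp add: r_def prob_space)
  qed
  ultimately have "AE x in M. x \<notin> B" by (auto intro: AE_not_in)
  then show ?thesis unfolding r_def[symmetric]
    by (rule AE_mp) (auto simp: B_def intro!: AE_I2)
qed

lemma ergodic_AE_const:
  assumes erg: "ergodic G a M" and u [measurable]: "u \<in> borel_measurable M"
    and bound: "\<And>x. x \<in> space M \<Longrightarrow> \<bar>u x\<bar> \<le> (C::real)"
    and inv: "\<And>g. g \<in> carrier G \<Longrightarrow> AE x in M. u (a g x) = u x"
  shows "AE x in M. u x = (\<integral>x. u x \<partial>M)"
  using ergodic_AE_ge_integral[OF assms] ergodic_AE_ge_integral[OF erg, of "\<lambda>x. - u x" C] bound inv
  by (auto elim: AE_mp intro: AE_I2)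

lemma invariant_image:
  assumes "A \<subseteq> space M" "\<And>h x. \<lbrakk>h \<in> carrier G; x \<in> A\<rbrakk> \<Longrightarrow> a h x \<in> A" "g \<in> carrier G"
  shows "a g ` A = A"
proof
  show "a g ` A \<subseteq> A" using assms by auto
  show "A \<subseteq> a g ` A"
  proof
    fix x assume x: "x \<in> A"
    then have "x = a g (a (inv g) x)" using assms by auto
    then show "x \<in> a g ` A" using assms x by (metis image_eqI inv_closed)
  qed
qed

lemma ergodic_invariant_set:
  assumes "ergodic G a M" "A \<in> sets M" "\<And>g x. \<lbrakk>g \<in> carrier G; x \<in> A\<rbrakk> \<Longrightarrow> a g x \<in> A"
  shows "A \<in> null_sets M \<or> conull M A"
  using assms(1,2) invariant_image[OF sets.sets_into_space[OF assms(2)] assms(3)]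
  by (simp add: ergodic_def)

end

locale stationary_action =
  fixes G (structure) and \<mu> :: "'a pmf" and a :: "'a \<Rightarrow> 'x \<Rightarrow> 'x" and M :: "'x measure"
  assumes measured: "measured_group G \<mu>" and stationary: "stationary_space G \<mu> a M"
begin

sublocale measured_action G a M
  by (rule measured_action.intro) (use stationary in \<open>simp add: stationary_space_def\<close>)

lemma countable_carrier: "countable (carrier G)"
  using measured by (simp add: measured_group_def)

lemma generated: "generated_semigroup G (set_pmf \<mu>) = carrier G"
  using measured by (simp add: measured_group_def)

lemma set_pmf_carrier: "s \<in> set_pmf \<mu> \<Longrightarrow> s \<in> carrier G"
  unfolding generated[symmetric] by (rule generated_semigroup.generator)

lemma pmf_summable: "pmf \<mu> summable_on carrier G"
proof (rule nonneg_bdd_above_summable_on)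
  show "bdd_above (sum (pmf \<mu>) ` {F. F \<subseteq> carrier G \<and> finite F})"
    by (rule bdd_aboveI[of _ 1]) (auto simp flip: measure_measure_pmf_finite)
qed simp

lemma bounded_summable:
  assumes "\<And>s. s \<in> carrier G \<Longrightarrow> \<bar>v s\<bar> \<le> C"
  shows "(\<lambda>s. v s * pmf \<mu> s) summable_on carrier G"
proof (rule Infinite_Sum.abs_summable_summable, rule Infinite_Sum.abs_summable_on_comparison_test)
  show "(\<lambda>s. norm (C * pmf \<mu> s)) summable_on carrier G"
    using summable_on_cmult_right[OF pmf_summable, of "\<bar>C\<bar>"] by (simp add: abs_mult)
  show "norm (v s * pmf \<mu> s) \<le> norm (C * pmf \<mu> s)" if "s \<in> carrier G" for s
    using assms[OF that] by (auto simp: abs_mult intro!: mult_right_mono)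
qed

text \<open>An infinite sum without summability defaults to 0, so the equation in the definition of
  stationarity is first upgraded to genuine convergence.\<close>

lemma stationary_has_sum:
  assumes [measurable]: "f \<in> borel_measurable M" and C: "\<And>x. x \<in> space M \<Longrightarrow> \<bar>f x\<bar> \<le> C"
  shows "((\<lambda>s. (\<integral>x. f (a s x) \<partial>M) * pmf \<mu> s) has_sum (\<integral>x. f x \<partial>M)) (carrier G)"
proof -
  have "ess_bounded M f" using C by (auto simp: ess_bounded_def intro!: exI[of _ C])
  then have "(\<Sum>\<^sub>\<infinity>s\<in>carrier G. (\<integral>x. f (a s x) \<partial>M) * pmf \<mu> s) = (\<integral>x. f x \<partial>M)"
    using stationary by (simp add: stationary_space_def)
  moreover have "\<bar>\<integral>x. f (a s x) \<partial>M\<bar> \<le> C" if s: "s \<in> carrier G" for s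
  proof -
    have "\<bar>\<integral>x. f (a s x) \<partial>M\<bar> \<le> (\<integral>x. \<bar>f (a s x)\<bar> \<partial>M)" by (rule integral_abs_bound)
    also have "\<dots> \<le> (\<integral>x. C \<partial>M)"
      by (rule integral_mono') (use C s in \<open>auto simp: act_space\<close>, meson abs_ge_zero act_space order_trans)
    finally show ?thesis by (simp add: prob_space)
  qed
  then have "(\<lambda>s. (\<integral>x. f (a s x) \<partial>M) * pmf \<mu> s) summable_on carrier G" by (rule bounded_summable)
  ultimately show ?thesis using has_sum_infsum by metis
qed

lemma pmf_has_sum: "(pmf \<mu> has_sum 1) (carrier G)"
  using stationary_has_sum[of "\<lambda>_. 1" 1] by (simp add: prob_space)

text \<open>The deficits m - v s are nonnegative and average to m - r, so no single weighted deficit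
  exceeds m - r. It drives both the maximum principle and the equality case in
  \<open>average_invariant\<close>.\<close>

lemma deviation_from_average:
  assumes sum: "((\<lambda>s. v s * pmf \<mu> s) has_sum r) (carrier G)" and le: "\<And>s. s \<in> carrier G \<Longrightarrow> v s \<le> (m::real)"
    and t: "t \<in> carrier G"
  shows "pmf \<mu> t * (m - v t) \<le> m - r"
proof -
  have "((\<lambda>s. m * pmf \<mu> s + - 1 * (v s * pmf \<mu> s)) has_sum (m * 1 + - 1 * r)) (carrier G)"
    by (intro has_sum_add has_sum_cmult_right sum pmf_has_sum)
  then have "((\<lambda>s. pmf \<mu> s * (m - v s)) has_sum (m - r)) (carrier G)"
    by (simp add: algebra_simps)
  then have "(\<Sum>s\<in>{t}. pmf \<mu> s * (m - v s)) \<le> m - r"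
    by (rule finite_sum_le_has_sum) (use t le in auto)
  then show ?thesis by simp
qed

text \<open>The maximum principle. A maximising sequence stays maximising after multiplication from the
  right by any group element; by total boundedness finitely many right factors suffice.\<close>

lemma harmonic_constant:
  assumes D: "bi_invariant_group G D b"
    and harmonic: "\<And>g. g \<in> carrier G \<Longrightarrow> ((\<lambda>s. \<phi> (g \<otimes> s) * pmf \<mu> s) has_sum \<phi> g) (carrier G)"
    and lip: "\<And>g h. \<lbrakk>g \<in> carrier G; h \<in> carrier G\<rbrakk> \<Longrightarrow> \<bar>\<phi> g - \<phi> h\<bar> \<le> C * D g h" and C: "C > 0"
    and g: "g \<in> carrier G"
  shows "\<phi> g = \<phi> \<one>"
proof -
  interpret D: bi_invariant_group G D b by (rule D)
  define m where "m = (SUP g\<in>carrier G. \<phi> g)"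
  have bdd: "bdd_above (\<phi> ` carrier G)"
  proof (rule bdd_aboveI[of _ "\<phi> \<one> + C * b"])
    fix r assume "r \<in> \<phi> ` carrier G"
    then obtain h where h: "h \<in> carrier G" "r = \<phi> h" by blast
    have "C * D h \<one> \<le> C * b" using C h D.D_le by (intro mult_left_mono) auto
    then show "r \<le> \<phi> \<one> + C * b" using lip[OF h(1) one_closed] h by linarith
  qed
  have le_m: "\<phi> h \<le> m" if "h \<in> carrier G" for h
    unfolding m_def by (rule cSUP_upper[OF that bdd])
  have step: "\<exists>\<delta>'>0. \<forall>g\<in>carrier G. \<phi> g > m - \<delta>' \<longrightarrow> \<phi> (g \<otimes> h) > m - \<delta>"
    if "h \<in> generated_semigroup G (set_pmf \<mu>)" "\<delta> > 0" for h \<delta>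
    using that
  proof (induction arbitrary: \<delta>)
    case (generator s)
    have s: "s \<in> carrier G" using generator set_pmf_carrier by blast
    have pos: "pmf \<mu> s > 0" using generator by (simp add: pmf_positive)
    show ?case
    proof (intro exI conjI ballI impI)
      show "pmf \<mu> s * \<delta> > 0" using pos generator by simp
      fix g assume g: "g \<in> carrier G" and gt: "m - pmf \<mu> s * \<delta> < \<phi> g"
      have "pmf \<mu> s * (m - \<phi> (g \<otimes> s)) \<le> m - \<phi> g"
        by (rule deviation_from_average[OF harmonic[OF g]]) (use le_m g s in auto)
      also have "\<dots> < pmf \<mu> s * \<delta>" using gt by simp
      finally show "m - \<delta> < \<phi> (g \<otimes> s)" using pos by (simp add: mult_less_cancel_left_pos)
    qed
  next
    case (mult s t)
    then have st: "s \<in> carrier G" "t \<in> carrier G" using generated by auto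
    obtain \<delta>' where \<delta>': "\<delta>' > 0" "\<forall>g\<in>carrier G. \<phi> g > m - \<delta>' \<longrightarrow> \<phi> (g \<otimes> t) > m - \<delta>"
      using mult by blast
    obtain \<delta>'' where \<delta>'': "\<delta>'' > 0" "\<forall>g\<in>carrier G. \<phi> g > m - \<delta>'' \<longrightarrow> \<phi> (g \<otimes> s) > m - \<delta>'"
      using mult \<delta>' by blast
    show ?case
      using \<delta>' \<delta>'' st by (intro exI[of _ \<delta>'']) (auto simp flip: m_assoc)
  qed
  have ge: "m \<le> \<phi> h" if h: "h \<in> carrier G" for h
  proof (rule field_le_epsilon)
    fix \<epsilon> :: real assume \<epsilon>: "\<epsilon> > 0"
    then have "\<epsilon> / 2 / C > 0" using C by simp
    then obtain F where F: "finite F" "F \<subseteq> carrier G"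
      "\<And>u. u \<in> carrier G \<Longrightarrow> \<exists>f\<in>F. D u f < \<epsilon> / 2 / C"
      by (rule totally_bounded_on_net[OF D.D_totally_bounded]) blast
    have "\<forall>f\<in>F. \<exists>\<delta>'>0. \<forall>g\<in>carrier G. \<phi> g > m - \<delta>' \<longrightarrow> \<phi> (g \<otimes> f) > m - \<epsilon> / 2"
      using step[of _ "\<epsilon> / 2"] generated F(2) \<epsilon> by auto
    then obtain \<delta> where \<delta>: "\<And>f. f \<in> F \<Longrightarrow> \<delta> f > 0"
      "\<And>f g. \<lbrakk>f \<in> F; g \<in> carrier G; \<phi> g > m - \<delta> f\<rbrakk> \<Longrightarrow> \<phi> (g \<otimes> f) > m - \<epsilon> / 2"
      by metis
    \<comment> \<open>One near-maximiser g has to work for every right factor in the net, hence the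
      minimum; inserting 1 keeps the set nonempty.\<close>
    define \<delta>\<^sub>0 where "\<delta>\<^sub>0 = Min (insert 1 (\<delta> ` F))"
    have "\<delta>\<^sub>0 > 0" unfolding \<delta>\<^sub>0_def using F(1) \<delta>(1) by auto
    moreover have "\<delta>\<^sub>0 \<le> \<delta> f" if "f \<in> F" for f unfolding \<delta>\<^sub>0_def using F(1) that by auto
    moreover obtain g where g: "g \<in> carrier G" "\<phi> g > m - \<delta>\<^sub>0"
    proof -
      have "\<exists>g\<in>carrier G. m - \<delta>\<^sub>0 < \<phi> g"
        using \<open>\<delta>\<^sub>0 > 0\<close> one_closed bdd unfolding m_def
        by (subst less_cSUP_iff[symmetric]) auto
      then show ?thesis using that by blast
    qed
    \<comment> \<open>Left invariance lets a fixed net of right factors reach every h from g: if f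
      is close to the quotient of h by g, then g f is equally close to h.\<close>
    obtain f where f: "f \<in> F" "D (inv g \<otimes> h) f < \<epsilon> / 2 / C" using F(3)[of "inv g \<otimes> h"] g h by auto
    have fc: "f \<in> carrier G" using f F by auto
    have "D h (g \<otimes> f) = D (inv g \<otimes> h) f"
      using D.D_left[of g "inv g \<otimes> h" f] g h fc by (simp add: m_assoc[symmetric])
    then have "C * D h (g \<otimes> f) < \<epsilon> / 2" using f(2) C by (simp add: field_simps)
    then have "\<bar>\<phi> h - \<phi> (g \<otimes> f)\<bar> < \<epsilon> / 2" using lip[of h "g \<otimes> f"] h g fc by simp
    moreover have "\<phi> (g \<otimes> f) > m - \<epsilon> / 2"
      using \<delta>(2)[OF f(1) g(1)] g(2) \<open>\<And>f. f \<in> F \<Longrightarrow> \<delta>\<^sub>0 \<le> \<delta> f\<close>[OF f(1)] by linarith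
    ultimately show "m \<le> \<phi> h + \<epsilon>" by linarith
  qed
  show ?thesis using ge[OF g] ge[OF one_closed] le_m[OF g] le_m[OF one_closed] by linarith
qed

end

section \<open>Homogeneous spaces\<close>

lemma group_actionI:
  assumes G: "Group.group G"
    and ext: "\<And>g. g \<in> carrier G \<Longrightarrow> \<phi> g \<in> extensional E"
    and closed: "\<And>g x. \<lbrakk>g \<in> carrier G; x \<in> E\<rbrakk> \<Longrightarrow> \<phi> g x \<in> E"
    and one: "\<And>x. x \<in> E \<Longrightarrow> \<phi> \<one>\<^bsub>G\<^esub> x = x"
    and mult: "\<And>g h x. \<lbrakk>g \<in> carrier G; h \<in> carrier G; x \<in> E\<rbrakk> \<Longrightarrow> \<phi> (g \<otimes>\<^bsub>G\<^esub> h) x = \<phi> g (\<phi> h x)"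
  shows "group_action G E \<phi>"
proof -
  interpret group G by (rule G)
  have inv: "\<phi> g (\<phi> (inv\<^bsub>G\<^esub> g) x) = x" "\<phi> (inv\<^bsub>G\<^esub> g) (\<phi> g x) = x" if "g \<in> carrier G" "x \<in> E" for g x
    using that by (simp_all add: one flip: mult)
  have Bij: "\<phi> g \<in> Bij E" if g: "g \<in> carrier G" for g
  proof -
    have "bij_betw (\<phi> g) E E"
      by (rule bij_betw_byWitness[where f' = "\<phi> (inv\<^bsub>G\<^esub> g)"]) (use g in \<open>auto simp: inv closed\<close>)
    then show ?thesis using ext[OF g] by (simp add: Bij_def)
  qed
  have "\<phi> (g \<otimes>\<^bsub>G\<^esub> h) = compose E (\<phi> g) (\<phi> h)" if "g \<in> carrier G" "h \<in> carrier G" for g h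
    using that by (intro extensionalityI[of _ E]) (auto simp: ext compose_def mult)
  then have "\<phi> \<in> hom G (BijGroup E)"
    using Bij by (auto simp: hom_def BijGroup_def)
  then show ?thesis
    by (intro group_action.intro group_hom.intro G group_BijGroup group_hom_axioms.intro)
qed

lemma isometric_space_coset:
  fixes K :: "point monoid"
  assumes G: "Group.group G" and K: "compact_sc_group K T"
    and \<tau>: "\<tau> \<in> hom G K" "T closure_of (\<tau> ` carrier G) = carrier K"
    and L: "subgroup L K" "closedin T L" and m: "haar_prob K T L m"
  shows "isometric_space G (\<lambda>g. coset_translation K L (\<tau> g)) m"
proof -
  let ?t = "\<lambda>g. coset_translation K L (\<tau> g)"
  interpret K: group K using K by (simp add: compact_sc_group_def)
  interpret G: group G by (rule G)
  interpret m: prob_space m using m by (simp add: haar_prob_def)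
  have \<tau>K: "\<tau> g \<in> carrier K" if "g \<in> carrier G" for g using \<tau>(1) that by (auto simp: hom_def)
  have LK: "L \<subseteq> carrier K" using L(1) by (rule subgroup.subset)
  have space_m: "space m = lcosets\<^bsub>K\<^esub> L" using m by (simp add: haar_prob_def)
  have meas: "coset_translation K L k \<in> measurable m m"
    and inv: "distr m m (coset_translation K L k) = m" if "k \<in> carrier K" for k
    using m that by (auto simp: haar_prob_def)
  have "group_action G (space m) ?t"
  proof (rule group_actionI[OF G])
    show "?t g \<in> extensional (space m)" for g
      by (simp add: coset_translation_def space_m)
    show "?t g x \<in> space m" if "g \<in> carrier G" "x \<in> space m" for g x
      using that meas[OF \<tau>K] by (meson measurable_space)
    show "coset_translation K L (\<tau> \<one>\<^bsub>G\<^esub>) x = x" if "x \<in> space m" for x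
    proof -
      have "\<tau> \<one>\<^bsub>G\<^esub> = \<one>\<^bsub>K\<^esub>" by (rule group_hom.hom_one) (intro group_hom.intro G K.is_group group_hom_axioms.intro \<tau>)
      moreover have "x \<subseteq> carrier K" using that K.lcosets_subset_PowG[OF L(1)] space_m by auto
      ultimately show ?thesis using that by (simp add: coset_translation_def space_m K.lcos_mult_one)
    qed
    show "coset_translation K L (\<tau> (g \<otimes>\<^bsub>G\<^esub> h)) x = ?t g (coset_translation K L (\<tau> h) x)"
      if "g \<in> carrier G" "h \<in> carrier G" "x \<in> space m" for g h x
    proof -
      have "coset_translation K L (\<tau> h) x \<in> lcosets\<^bsub>K\<^esub> L"
        using measurable_space[OF meas[OF \<tau>K[OF that(2)]] that(3)] by (simp add: space_m)
      moreover have "x \<subseteq> carrier K" using that K.lcosets_subset_PowG[OF L(1)] space_m by auto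
      moreover have "\<tau> (g \<otimes>\<^bsub>G\<^esub> h) = \<tau> g \<otimes>\<^bsub>K\<^esub> \<tau> h" using \<tau>(1) that by (simp add: hom_mult)
      ultimately show ?thesis
        using that(3) \<tau>K that by (simp add: coset_translation_def space_m K.lcos_m_assoc)
    qed
  qed
  moreover have "?t g -` A \<inter> space m \<in> null_sets m \<longleftrightarrow> A \<in> null_sets m"
    if "g \<in> carrier G" "A \<in> sets m" for g A
    using emeasure_distr[OF meas[OF \<tau>K[OF that(1)]] that(2)] inv[OF \<tau>K[OF that(1)]]
      measurable_sets[OF meas[OF \<tau>K[OF that(1)]] that(2)] that(2) by (auto simp: null_sets_def)
  ultimately have act: "G_space G ?t m"
    using meas \<tau>K m.prob_space_axioms by (auto simp: G_space_def)
  interpret act: measured_action G "?t" m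
    by (rule measured_action.intro) (rule act)
  have "invariant_conull G ?t m (space m)"
    using act.surj_prop by (auto simp: invariant_conull_def conull_def)
  then have "isomorphic_spaces G ?t m ?t m"
    unfolding isomorphic_spaces_def factor_map_def
    by (intro exI[of _ "space m"] exI[of _ "\<lambda>x. x"]) (auto intro!: measurable_restrict_space1)
  then show ?thesis
    using act K \<tau> L m unfolding isometric_space_def by blast
qed

section \<open>The isometric factor of a stationary space\<close>

text \<open>The last assumption puts the base point in the support with respect to \<open>d\<close>.
  Measurability is asked only of the sections \<open>d x\<close>, because the balls that are
  combined have centres in one countable orbit.\<close>

locale isometric_model =
  stationary_action G \<mu> a X + iso: isometric_orbit G a S d b x\<^sub>0
  for G (structure) and \<mu> :: "'a pmf" and a :: "'a \<Rightarrow> 'x \<Rightarrow> 'x" and X :: "'x measure"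
    and S d b x\<^sub>0 +
  assumes ergodic: "ergodic G a X"
    and S_sets: "S \<in> sets X"
    and d_measurable: "\<And>x. x \<in> S \<Longrightarrow> d x \<in> borel_measurable X"
    and base_support: "\<And>r. r > 0 \<Longrightarrow> {x\<in>S. d x\<^sub>0 x < r} \<notin> null_sets X"
begin

abbreviation X\<^sub>1 :: "'x set" where "X\<^sub>1 \<equiv> iso.orbit_closure"

section \<open>The orbit closure is conull\<close>

lemma S_space: "x \<in> S \<Longrightarrow> x \<in> space X"
  using sets.sets_into_space[OF S_sets] by auto

lemma ball_sets: "x \<in> S \<Longrightarrow> {y\<in>S. d x y < r} \<in> sets X"
proof -
  assume x: "x \<in> S"
  have [measurable]: "d x \<in> borel_measurable X" using x by (rule d_measurable)
  have "{y\<in>S. d x y < r} = S \<inter> {y\<in>space X. d x y < r}" using S_space by auto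
  also have "\<dots> \<in> sets X" using S_sets by measurable
  finally show ?thesis .
qed

abbreviation near_orbit :: "real \<Rightarrow> 'x set" where
  "near_orbit r \<equiv> \<Union>m. {x\<in>S. d (a (iso.enum m) x\<^sub>0) x < r}"

text \<open>Invariance of \<open>d\<close> makes this neighbourhood of the orbit invariant, and it
  contains a ball about the base point, which is not null; ergodicity does the rest.\<close>

lemma orbit_ball_conull:
  assumes "r > 0"
  shows "conull X (near_orbit r)" (is "conull X ?A")
proof -
  have sets: "?A \<in> sets X" by (intro sets.countable_UN) (auto intro!: ball_sets)
  have "?A \<in> null_sets X \<or> conull X ?A"
  proof (rule ergodic_invariant_set[OF ergodic sets])
    fix g x assume g: "g \<in> carrier G" and "x \<in> ?A"
    then obtain m where "x \<in> S" "d (a (iso.enum m) x\<^sub>0) x < r" by auto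
    then show "a g x \<in> ?A"
      using g by (intro UN_I[of "iso.idx (g \<otimes> iso.enum m)"])
        (auto simp: iso.act_mult iso.base iso.d_act iso.act_closed)
  qed
  moreover have "?A \<notin> null_sets X"
  proof
    assume "?A \<in> null_sets X"
    moreover have "{x\<in>S. d x\<^sub>0 x < r} \<subseteq> ?A"
      by (auto intro!: exI[of _ "iso.idx \<one>"] simp: iso.act_one iso.base)
    ultimately have "{x\<in>S. d x\<^sub>0 x < r} \<in> null_sets X"
      using ball_sets[OF iso.base] null_sets_subset by blast
    then show False using base_support[OF assms] by simp
  qed
  ultimately show ?thesis by blast
qed

lemma orbit_closure_eq: "X\<^sub>1 = (\<Inter>n. near_orbit (inverse (real (Suc n))))"
proof (intro equalityI subsetI)
  fix x assume x: "x \<in> X\<^sub>1"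
  show "x \<in> (\<Inter>n. near_orbit (inverse (real (Suc n))))"
  proof
    fix n
    have "inverse (real (Suc n)) > 0" by simp
    then obtain g where "g \<in> carrier G" "d (a g x\<^sub>0) x < inverse (real (Suc n))"
      using x unfolding iso.orbit_closure_def by blast
    then show "x \<in> near_orbit (inverse (real (Suc n)))"
      using x by (intro UN_I[of "iso.idx g"]) (auto simp: iso.orbit_closure_def)
  qed
next
  fix x assume x: "x \<in> (\<Inter>n. near_orbit (inverse (real (Suc n))))"
  show "x \<in> X\<^sub>1"
    unfolding iso.orbit_closure_def mem_Collect_eq
  proof (intro conjI allI impI)
    show "x \<in> S" using x by blast
    fix \<epsilon> :: real assume "\<epsilon> > 0"
    then obtain n where n: "inverse (real (Suc n)) < \<epsilon>" using reals_Archimedean by blast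
    obtain m where "d (a (iso.enum m) x\<^sub>0) x < inverse (real (Suc n))" using x by blast
    then show "\<exists>g\<in>carrier G. d (a g x\<^sub>0) x < \<epsilon>" using n by (intro bexI[of _ "iso.enum m"]) auto
  qed
qed

lemma X1_conull: "conull X X\<^sub>1"
proof -
  let ?A = "\<lambda>n. near_orbit (inverse (real (Suc n)))"
  have A: "conull X (?A n)" for n by (rule orbit_ball_conull) simp
  have "space X - X\<^sub>1 = (\<Union>n. space X - ?A n)" unfolding orbit_closure_eq by blast
  moreover have "\<dots> \<in> null_sets X"
    using A unfolding conull_def by (intro null_sets_UN) blast
  moreover have "X\<^sub>1 \<in> sets X"
    using A unfolding orbit_closure_eq conull_def by (intro sets.countable_INT) auto
  ultimately show ?thesis by (simp add: conull_def)
qed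

lemma X1_sets [measurable]: "X\<^sub>1 \<in> sets X"
  using X1_conull by (simp add: conull_def)

lemma X1_S: "x \<in> X\<^sub>1 \<Longrightarrow> x \<in> S"
  by (simp add: iso.orbit_closure_def)

lemma X1_AE: "AE x in X. x \<in> X\<^sub>1"
proof -
  have "AE x in X. x \<notin> space X - X\<^sub>1"
    using X1_conull unfolding conull_def by (intro AE_not_in) simp
  then show ?thesis by (rule AE_mp) auto
qed

lemma X1_invariant_conull: "invariant_conull G a X X\<^sub>1"
  unfolding invariant_conull_def
proof (intro conjI ballI X1_conull invariant_image)
  show "X\<^sub>1 \<subseteq> space X" by (rule sets.sets_into_space[OF X1_sets])
qed (rule iso.orbit_closure_act)

section \<open>Invariance of integrals of Lipschitz functions\<close>

abbreviation R :: "'x measure" where "R \<equiv> restrict_space X X\<^sub>1"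

text \<open>A strict sublevel set of an infimum over the enumeration is a countable union of balls
  about orbit points.\<close>

lemma infd_measurable:
  assumes "\<And>n. 0 \<le> \<alpha> n"
  shows "iso.infd \<alpha> \<in> borel_measurable R"
  unfolding borel_measurable_iff_less
proof
  fix r
  have "{x \<in> space R. iso.infd \<alpha> x < r} =
      X\<^sub>1 \<inter> (\<Union>m. {x\<in>S. d (a (iso.enum m) x\<^sub>0) x < r - \<alpha> m})"
    using X1_S S_space by (auto simp: space_restrict_space iso.infd_less_iff[OF assms] less_diff_eq add.commute)
  also have "\<dots> \<in> sets X"
    by (intro sets.Int X1_sets sets.countable_UN) (auto intro!: ball_sets)
  finally show "{x \<in> space R. iso.infd \<alpha> x < r} \<in> sets R"
    by (subst sets_restrict_space_iff) (auto simp: space_restrict_space)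
qed

text \<open>Lipschitz functions that tend to the indicator of the zero set of
  \<open>iso.infd \<alpha>\<close> as j grows. The maximum principle needs Lipschitz functions;
  measures of closed sets are recovered in the limit.\<close>

definition bump :: "nat \<Rightarrow> point \<Rightarrow> 'x \<Rightarrow> real" where
  "bump j \<alpha> x = indicator X\<^sub>1 x * max 0 (1 - j * iso.infd \<alpha> x)"

lemma bump_measurable:
  assumes "\<And>n. 0 \<le> \<alpha> n"
  shows "bump j \<alpha> \<in> borel_measurable X"
proof -
  have [measurable]: "iso.infd \<alpha> \<in> borel_measurable R"
    by (rule infd_measurable[OF assms])
  have "(\<lambda>x. max 0 (1 - j * iso.infd \<alpha> x)) \<in> borel_measurable R" by measurable
  then show ?thesis
    unfolding bump_def by (subst (asm) borel_measurable_restrict_space_iff) auto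
qed

lemma bump_bound:
  assumes "\<And>n. 0 \<le> \<alpha> n"
  shows "\<bar>bump j \<alpha> x\<bar> \<le> 1"
proof (cases "x \<in> X\<^sub>1")
  case True
  then show ?thesis using iso.infd_nonneg[OF assms X1_S[OF True]] by (auto simp: bump_def)
qed (simp add: bump_def)

lemma bump_integrable:
  assumes "\<And>n. 0 \<le> \<alpha> n"
  shows "integrable X (bump j \<alpha>)"
  by (rule integrable_const_bound[of _ 1]) (use bump_bound[OF assms] bump_measurable[OF assms] in auto)

lemma bump_act_integrable:
  assumes "\<And>n. 0 \<le> \<alpha> n" "g \<in> carrier G"
  shows "integrable X (\<lambda>x. bump j \<alpha> (a g x))"
  by (rule integrable_const_bound[of _ 1])
    (use bump_bound[OF assms(1)] measurable_compose[OF act_measurable[OF assms(2)] bump_measurable[OF assms(1)]] in auto)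

lemma bump_diff_le:
  assumes "x \<in> X\<^sub>1" "y \<in> X\<^sub>1" "\<bar>iso.infd \<alpha> x - iso.infd \<beta> y\<bar> \<le> \<epsilon>"
  shows "\<bar>bump j \<alpha> x - bump j \<beta> y\<bar> \<le> j * \<epsilon>"
proof -
  have "\<bar>max 0 (1 - u) - max 0 (1 - v)\<bar> \<le> \<bar>u - v\<bar>" for u v :: real
    unfolding max_def by (smt (verit))
  then have "\<bar>bump j \<alpha> x - bump j \<beta> y\<bar> \<le> \<bar>real j * iso.infd \<alpha> x - real j * iso.infd \<beta> y\<bar>"
    using assms(1,2) by (simp add: bump_def)
  also have "\<dots> = real j * \<bar>iso.infd \<alpha> x - iso.infd \<beta> y\<bar>"
    by (simp add: abs_mult flip: right_diff_distrib)
  also have "\<dots> \<le> j * \<epsilon>" using assms(3) by (intro mult_left_mono) auto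
  finally show ?thesis .
qed

lemma integral_abs_diff_le:
  fixes f g :: "'x \<Rightarrow> real"
  assumes "integrable X f" "integrable X g" "AE x in X. \<bar>f x - g x\<bar> \<le> C"
  shows "\<bar>(\<integral>x. f x \<partial>X) - (\<integral>x. g x \<partial>X)\<bar> \<le> C"
proof -
  have "\<bar>(\<integral>x. f x \<partial>X) - (\<integral>x. g x \<partial>X)\<bar> = \<bar>\<integral>x. f x - g x \<partial>X\<bar>" using assms by simp
  also have "\<dots> \<le> (\<integral>x. \<bar>f x - g x\<bar> \<partial>X)" by (rule integral_abs_bound)
  also have "\<dots> \<le> (\<integral>x. C \<partial>X)" by (rule integral_mono_AE) (use assms in auto)
  finally show ?thesis by (simp add: prob_space)
qed

lemma bump_integral_act:
  assumes \<alpha>: "\<And>n. 0 \<le> \<alpha> n" and g: "g \<in> carrier G"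
  shows "(\<integral>x. bump j \<alpha> (a g x) \<partial>X) = (\<integral>x. bump j \<alpha> x \<partial>X)"
proof -
  define \<phi> where "\<phi> g = (\<integral>x. bump j \<alpha> (a g x) \<partial>X)" for g
  have "\<phi> g = \<phi> \<one>"
  \<comment> \<open>The Lipschitz constant is j; one is added because a positive constant is
    required and j may be 0.\<close>
  proof (rule harmonic_constant[OF iso.D_bi_invariant, where C = "real j + 1"])
    fix g assume g: "g \<in> carrier G"
    have "((\<lambda>s. (\<integral>x. bump j \<alpha> (a g (a s x)) \<partial>X) * pmf \<mu> s) has_sum (\<integral>x. bump j \<alpha> (a g x) \<partial>X)) (carrier G)"
      by (rule stationary_has_sum[where C = 1])
        (use g bump_bound[OF \<alpha>] measurable_compose[OF act_measurable[OF g] bump_measurable[OF \<alpha>]] in auto)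
    also have "?this \<longleftrightarrow> ((\<lambda>s. \<phi> (g \<otimes> s) * pmf \<mu> s) has_sum \<phi> g) (carrier G)"
      unfolding \<phi>_def using g
      by (intro has_sum_cong arg_cong2[where f = times] Bochner_Integration.integral_cong) (auto simp: act_mult)
    finally show "((\<lambda>s. \<phi> (g \<otimes> s) * pmf \<mu> s) has_sum \<phi> g) (carrier G)" .
    fix h assume h: "h \<in> carrier G"
    have "AE x in X. \<bar>bump j \<alpha> (a g x) - bump j \<alpha> (a h x)\<bar> \<le> j * iso.D g h"
      using X1_AE
    proof eventually_elim
      case (elim x)
      have gh: "a g x \<in> X\<^sub>1" "a h x \<in> X\<^sub>1" using elim g h iso.orbit_closure_act by auto
      have "\<bar>iso.infd \<alpha> (a g x) - iso.infd \<alpha> (a h x)\<bar> \<le> d (a g x) (a h x)"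
        by (rule iso.infd_lipschitz[OF \<alpha> X1_S X1_S]) (rule gh)+
      also have "\<dots> \<le> iso.D g h" by (rule iso.d_act_le_D[OF g h elim])
      finally show ?case by (rule bump_diff_le[OF gh])
    qed
    then have "\<bar>\<phi> g - \<phi> h\<bar> \<le> j * iso.D g h"
      unfolding \<phi>_def by (intro integral_abs_diff_le bump_act_integrable \<alpha> g h)
    also have "\<dots> \<le> (real j + 1) * iso.D g h"
      using iso.D_nonneg[OF g h] by (intro mult_right_mono) auto
    finally show "\<bar>\<phi> g - \<phi> h\<bar> \<le> (real j + 1) * iso.D g h" .
  qed (use g in auto)
  moreover have "\<phi> \<one> = (\<integral>x. bump j \<alpha> x \<partial>X)"
    unfolding \<phi>_def by (intro Bochner_Integration.integral_cong) (auto simp: act_one)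
  ultimately show ?thesis by (simp add: \<phi>_def)
qed

text \<open>Invariance of the integral passes from \<open>G\<close> to its completion: a group
  element close to k changes the integrand by at most j \<delta> on the orbit closure, and \<delta>
  is arbitrary.\<close>

lemma bump_integral_translate:
  assumes C: "C \<subseteq> iso.ulimits" "C \<noteq> {}" and k: "k \<in> iso.ulimits"
  shows "(\<integral>x. bump j (iso.set_dist (iso.mul (iso.inve k) ` C)) x \<partial>X) = (\<integral>x. bump j (iso.set_dist C) x \<partial>X)"
    (is "?I = ?J")
proof -
  have kC: "iso.mul (iso.inve k) ` C \<subseteq> iso.ulimits" "iso.mul (iso.inve k) ` C \<noteq> {}"
    using C k by (auto intro!: iso.mul_closed iso.inve_closed)
  have "\<bar>?I - ?J\<bar> \<le> \<epsilon>" if \<epsilon>: "\<epsilon> > 0" for \<epsilon>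
  proof -
    define \<delta> where "\<delta> = \<epsilon> / (real j + 1)"
    have \<delta>: "\<delta> > 0" using \<epsilon> by (simp add: \<delta>_def)
    obtain g where g: "g \<in> carrier G" "near k (iso.emb g) \<delta>" by (rule iso.ulimitsE[OF k \<delta>])
    have "AE x in X. \<bar>bump j (iso.set_dist (iso.mul (iso.inve k) ` C)) x - bump j (iso.set_dist C) (a g x)\<bar> \<le> j * \<delta>"
      using X1_AE
    proof eventually_elim
      case (elim x)
      show ?case
        by (rule bump_diff_le[OF elim iso.orbit_closure_act[OF elim g(1)]])
          (rule iso.infd_set_dist_translate[OF C k g X1_S[OF elim]])
    qed
    then have "\<bar>?I - (\<integral>x. bump j (iso.set_dist C) (a g x) \<partial>X)\<bar> \<le> j * \<delta>"
      by (intro integral_abs_diff_le bump_integrable bump_act_integrable iso.set_dist_nonneg C kC g)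
    moreover have "j * \<delta> \<le> \<epsilon>" using \<epsilon> by (simp add: \<delta>_def field_simps)
    ultimately show ?thesis
      using bump_integral_act[of "iso.set_dist C" g j] iso.set_dist_nonneg[OF C] g by simp
  qed
  then have "\<bar>?I - ?J\<bar> \<le> 0" by (rule field_le_epsilon) simp
  then show ?thesis by simp
qed

lemma bump_tendsto:
  assumes \<alpha>: "\<And>n. 0 \<le> \<alpha> n"
  shows "(\<lambda>j. \<integral>x. bump j \<alpha> x \<partial>X) \<longlonglongrightarrow> measure X {x\<in>X\<^sub>1. iso.infd \<alpha> x = 0}"
proof -
  have sets: "{x\<in>X\<^sub>1. iso.infd \<alpha> x = 0} \<in> sets X"
  proof -
    have [measurable]: "iso.infd \<alpha> \<in> borel_measurable R"
      by (rule infd_measurable[OF \<alpha>])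
    have "{x\<in>space R. iso.infd \<alpha> x = 0} \<in> sets R" by measurable
    moreover have "{x\<in>space R. iso.infd \<alpha> x = 0} = {x\<in>X\<^sub>1. iso.infd \<alpha> x = 0}"
      using X1_S S_space by (auto simp: space_restrict_space)
    ultimately show ?thesis by (subst (asm) sets_restrict_space_iff) auto
  qed
  have "(\<lambda>j. \<integral>x. bump j \<alpha> x \<partial>X) \<longlonglongrightarrow> (\<integral>x. indicator {x\<in>X\<^sub>1. iso.infd \<alpha> x = 0} x \<partial>X)"
  proof (rule integral_dominated_convergence[where w = "\<lambda>_. 1"])
    show "AE x in X. (\<lambda>j. bump j \<alpha> x) \<longlonglongrightarrow> indicator {x\<in>X\<^sub>1. iso.infd \<alpha> x = 0} x"
    proof (rule AE_I2)
      fix x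
      show "(\<lambda>j. bump j \<alpha> x) \<longlonglongrightarrow> indicator {x\<in>X\<^sub>1. iso.infd \<alpha> x = 0} x"
      proof (cases "x \<in> X\<^sub>1 \<and> iso.infd \<alpha> x \<noteq> 0")
        case True
        then have pos: "iso.infd \<alpha> x > 0" using iso.infd_nonneg[of \<alpha> x] \<alpha> X1_S[of x] by fastforce
        obtain N where N: "1 < real N * iso.infd \<alpha> x" using reals_Archimedean3[OF pos] by blast
        have "bump j \<alpha> x = 0" if "j \<ge> N" for j
        proof -
          have "real N * iso.infd \<alpha> x \<le> real j * iso.infd \<alpha> x" using pos that by (intro mult_right_mono) auto
          then show ?thesis using N by (simp add: bump_def)
        qed
        then have "(\<lambda>j. bump j \<alpha> x) \<longlonglongrightarrow> 0"
          by (intro tendsto_eventually) (auto simp: eventually_sequentially)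
        then show ?thesis using True by simp
      qed (auto simp: bump_def indicator_def)
    qed
    show "AE x in X. norm (bump j \<alpha> x) \<le> 1" for j using bump_bound[OF \<alpha>] by simp
  qed (use bump_measurable[OF \<alpha>] sets in auto)
  then show ?thesis using sets sets.sets_into_space[OF sets] by (simp add: Int_absorb2)
qed

section \<open>The image measure on the coset space\<close>

abbreviation cosets :: "point set set" where
  "cosets \<equiv> lcosets\<^bsub>iso.completion\<^esub> iso.stab"

abbreviation coset_opens :: "point set set set" where
  "coset_opens \<equiv> {U. openin (coset_topology iso.completion iso.ulimits_top iso.stab) U}"

text \<open>The target \<open>sigma cosets coset_opens\<close> only supplies the sigma-algebra; the
  mass is that of \<open>R\<close>.\<close>

definition W :: "point set measure" where
  "W = distr R (sigma cosets coset_opens) iso.points"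

lemma coset_opens_Pow: "coset_opens \<subseteq> Pow cosets"
  by (auto simp: openin_coset_topology)

text \<open>The preimage in the completion of the complement of \<open>U\<close>. Complements are
  used because distance functions detect compact sets as their zero sets.\<close>

definition lift :: "point set set \<Rightarrow> point set" where
  "lift U = {k\<in>iso.ulimits. iso.coset k \<notin> U}"

lemma lift_subset: "lift U \<subseteq> iso.ulimits"
  by (auto simp: lift_def)

lemma compact_lift:
  assumes "U \<in> coset_opens"
  shows "compact (lift U)"
proof -
  have "openin iso.ulimits_top {k\<in>iso.ulimits. iso.coset k \<in> U}"
    using assms by (simp add: openin_coset_topology)
  from closedin_diff[OF closedin_topspace this]
  have "closedin iso.ulimits_top (iso.ulimits - {k\<in>iso.ulimits. iso.coset k \<in> U})"
    by simp
  moreover have "iso.ulimits - {k\<in>iso.ulimits. iso.coset k \<in> U} = lift U"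
    by (auto simp: lift_def)
  ultimately show ?thesis by (metis closedin_compact iso.compact_ulimits)
qed

lemma points_lift_iff:
  assumes x: "x \<in> X\<^sub>1" and l: "l \<in> iso.ulimits"
  shows "iso.translate l (iso.points x) \<notin> U \<longleftrightarrow>
    (\<exists>k\<in>iso.mul (iso.inve l) ` lift U. k \<in> iso.points x)"
proof -
  obtain k where k: "k \<in> iso.points x" using iso.points_nonempty[OF x] by blast
  then have ku: "k \<in> iso.ulimits" using iso.points_subset by auto
  have tr: "iso.translate l (iso.points x) = iso.coset (iso.mul l j)"
    if "j \<in> iso.points x" for j
    using iso.points_in_cosets[OF x] iso.points_eq_coset[OF X1_S[OF x] that] iso.translate_coset[of j l]
      that iso.points_subset l
    by (auto simp: coset_translation_def)
  have inv: "iso.mul (iso.inve l) (iso.mul l j) = j" "iso.mul l (iso.mul (iso.inve l) j) = j" if "j \<in> iso.ulimits" for j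
    using that l by (simp_all add: iso.mul_assoc[symmetric] iso.inve_closed iso.mul_inve iso.mul_one iso.mul_cancel)
      (simp add: iso.mul_assoc iso.inve_closed iso.mul_cancel)
  show ?thesis
  proof
    assume "iso.translate l (iso.points x) \<notin> U"
    then have "iso.mul l k \<in> lift U" using tr[OF k] ku l by (simp add: lift_def iso.mul_closed)
    then show "\<exists>k\<in>iso.mul (iso.inve l) ` lift U. k \<in> iso.points x"
      using inv(1)[OF ku] k by (metis image_eqI)
  next
    assume "\<exists>k\<in>iso.mul (iso.inve l) ` lift U. k \<in> iso.points x"
    then obtain j where j: "j \<in> lift U" "iso.mul (iso.inve l) j \<in> iso.points x" by blast
    have "iso.translate l (iso.points x) = iso.coset j"
      using tr[OF j(2)] inv(2)[of j] j(1) by (simp add: lift_def)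
    then show "iso.translate l (iso.points x) \<notin> U"
      using j(1) by (simp add: lift_def)
  qed
qed

lemma compact_mul_image:
  assumes "compact C" "C \<subseteq> iso.ulimits" "k \<in> iso.ulimits"
  shows "compact (iso.mul k ` C)"
proof (rule compact_continuous_image[OF _ assms(1)])
  have "continuous_on C (\<lambda>l. case (k, l) of (k, l) \<Rightarrow> iso.mul k l)"
    by (rule continuous_on_compose2[OF iso.continuous_mul]) (use assms in \<open>auto intro!: continuous_intros\<close>)
  then show "continuous_on C (iso.mul k)" by simp
qed

text \<open>The preimage of a translated closed set is the zero set of a distance function, hence
  measurable, and its measure is a limit of bump integrals, which do not change under
  translation.\<close>

lemma translate_preimage:
  assumes U: "U \<in> coset_opens" and l: "l \<in> iso.ulimits"
  defines "P \<equiv> {x\<in>X\<^sub>1. iso.translate l (iso.points x) \<notin> U}"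
  shows "P \<in> sets X" "measure X P = measure X {x\<in>X\<^sub>1. iso.points x \<notin> U}"
proof -
  let ?one = "iso.emb \<one>"
  have one: "iso.translate ?one (iso.points x) = iso.points x" if "x \<in> X\<^sub>1" for x
    using iso.coset_translation_points[OF that one_closed] iso.act_one[OF X1_S[OF that]] by simp
  have mul_one: "iso.mul (iso.inve ?one) ` lift U = lift U"
    using lift_subset iso.mul_one by (force simp: iso.inve_emb)
  have eq: "{x\<in>X\<^sub>1. iso.points x \<notin> U} = {x\<in>X\<^sub>1. \<exists>k\<in>lift U. k \<in> iso.points x}"
    using points_lift_iff[of _ ?one U] one mul_one by auto
  have P: "P = {x\<in>X\<^sub>1. \<exists>k\<in>iso.mul (iso.inve l) ` lift U. k \<in> iso.points x}"
    unfolding P_def using points_lift_iff[OF _ l] by blast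
  show "P \<in> sets X" "measure X P = measure X {x\<in>X\<^sub>1. iso.points x \<notin> U}"
  \<comment> \<open>An empty \<open>lift U\<close> is set apart, since the distance to the empty set
    would be an infimum over nothing; both preimages are empty then.\<close>
  proof (atomize (full), cases "lift U = {}")
    case False
    let ?C = "iso.mul (iso.inve l) ` lift U"
    have C: "compact ?C" "?C \<subseteq> iso.ulimits" "?C \<noteq> {}"
      using compact_mul_image[OF compact_lift[OF U] lift_subset iso.inve_closed[OF l]] False lift_subset l
      by (auto intro!: iso.mul_closed iso.inve_closed)
    have P': "P = {x\<in>X\<^sub>1. iso.infd (iso.set_dist ?C) x = 0}"
      unfolding P using iso.infd_set_dist_0_iff[OF C X1_S] by blast
    have eq': "{x\<in>X\<^sub>1. iso.points x \<notin> U} = {x\<in>X\<^sub>1. iso.infd (iso.set_dist (lift U)) x = 0}"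
      unfolding eq using iso.infd_set_dist_0_iff[OF compact_lift[OF U] lift_subset False X1_S] by blast
    have [measurable]: "iso.infd (iso.set_dist ?C) \<in> borel_measurable R"
      by (rule infd_measurable[OF iso.set_dist_nonneg[OF C(2,3)]])
    have "{x\<in>space R. iso.infd (iso.set_dist ?C) x = 0} \<in> sets R" by measurable
    moreover have "{x\<in>space R. iso.infd (iso.set_dist ?C) x = 0} = P"
      using X1_S S_space by (auto simp: space_restrict_space P')
    ultimately have "P \<in> sets X" by (subst (asm) sets_restrict_space_iff) auto
    moreover have "measure X P = measure X {x\<in>X\<^sub>1. iso.points x \<notin> U}"
      unfolding P' eq'
      using bump_tendsto[of "iso.set_dist ?C", OF iso.set_dist_nonneg[OF C(2,3)]]
        bump_tendsto[of "iso.set_dist (lift U)", OF iso.set_dist_nonneg[OF lift_subset False]]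
      unfolding bump_integral_translate[OF lift_subset False l] by (rule LIMSEQ_unique)
    ultimately show "P \<in> sets X \<and> measure X P = measure X {x\<in>X\<^sub>1. iso.points x \<notin> U}" by blast
  qed (simp add: P eq)
qed

lemma points_measurable: "iso.points \<in> measurable R (sigma cosets coset_opens)"
proof (rule measurable_measure_of[OF coset_opens_Pow])
  show "iso.points \<in> space R \<rightarrow> cosets"
    by (auto simp: space_restrict_space intro: iso.points_in_cosets)
  fix U assume U: "U \<in> coset_opens"
  have "{x\<in>X\<^sub>1. iso.translate (iso.emb \<one>) (iso.points x) \<notin> U} \<in> sets X"
    by (rule translate_preimage[OF U]) simp
  also have "{x\<in>X\<^sub>1. iso.translate (iso.emb \<one>) (iso.points x) \<notin> U} = {x\<in>X\<^sub>1. iso.points x \<notin> U}"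
    using iso.coset_translation_points[OF _ one_closed] iso.act_one[OF X1_S] by auto
  finally have "X\<^sub>1 - {x\<in>X\<^sub>1. iso.points x \<notin> U} \<in> sets X" by (intro sets.Diff X1_sets)
  moreover have "X\<^sub>1 - {x\<in>X\<^sub>1. iso.points x \<notin> U} = iso.points -` U \<inter> space R"
    using X1_S S_space by (auto simp: space_restrict_space)
  ultimately show "iso.points -` U \<inter> space R \<in> sets R"
    by (subst sets_restrict_space_iff) (auto simp: space_restrict_space)
qed

lemma space_W: "space W = cosets"
  by (simp add: W_def space_measure_of[OF coset_opens_Pow])

lemma sets_W: "sets W = sigma_sets cosets coset_opens"
  by (simp add: W_def sets_measure_of[OF coset_opens_Pow])

lemma emeasure_W:
  assumes "A \<in> sets W"
  shows "emeasure W A = emeasure X (iso.points -` A \<inter> X\<^sub>1)"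
proof -
  have "emeasure W A = emeasure R (iso.points -` A \<inter> space R)"
    unfolding W_def by (rule emeasure_distr[OF points_measurable]) (use assms in \<open>simp add: W_def\<close>)
  also have "iso.points -` A \<inter> space R = iso.points -` A \<inter> X\<^sub>1"
    using X1_S S_space by (auto simp: space_restrict_space)
  also have "emeasure R (iso.points -` A \<inter> X\<^sub>1) = emeasure X (iso.points -` A \<inter> X\<^sub>1)"
    by (rule emeasure_restrict_space) auto
  finally show ?thesis .
qed

lemma prob_space_W: "prob_space W"
proof -
  have "emeasure X X\<^sub>1 = 1"
    using X1_AE emeasure_eq_1_AE[OF X1_sets] by blast
  then have "prob_space R" by (intro prob_space_restrict_space) auto
  then show ?thesis unfolding W_def using points_measurable by (rule prob_space.prob_space_distr)
qed

lemma translation_measurable: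
  assumes l: "l \<in> iso.ulimits"
  shows "iso.translate l \<in> measurable W W"
proof -
  let ?t = "iso.translate l"
  have t: "?t (iso.coset k) = iso.coset (iso.mul l k)" if "k \<in> iso.ulimits" for k
    using that l iso.translate_coset[OF that l] by (auto simp: coset_translation_def LCOSETS_def)
  have "?t \<in> measurable W (sigma cosets coset_opens)"
  proof (rule measurable_measure_of[OF coset_opens_Pow])
    show "?t \<in> space W \<rightarrow> cosets"
      using t l by (auto simp: space_W LCOSETS_def intro!: bexI[of _ "iso.mul l _"] iso.mul_closed)
    fix U assume "U \<in> coset_opens"
    then have U: "openin iso.ulimits_top {k\<in>iso.ulimits. iso.coset k \<in> U}"
      by (simp add: openin_coset_topology)
    have "continuous_on iso.ulimits (\<lambda>k. case (l, k) of (l, k) \<Rightarrow> iso.mul l k)"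
      by (rule continuous_on_compose2[OF iso.continuous_mul]) (use l in \<open>auto intro!: continuous_intros\<close>)
    then have cont: "continuous_map iso.ulimits_top iso.ulimits_top (iso.mul l)"
      using l by (auto intro: iso.mul_closed)
    have "openin iso.ulimits_top {k\<in>iso.ulimits. iso.mul l k \<in> {k\<in>iso.ulimits. iso.coset k \<in> U}}"
      using openin_continuous_map_preimage[OF cont U] by simp
    also have "{k\<in>iso.ulimits. iso.mul l k \<in> {k\<in>iso.ulimits. iso.coset k \<in> U}} =
        {k\<in>iso.ulimits. iso.coset k \<in> ?t -` U \<inter> cosets}"
    proof (intro Collect_cong conj_cong refl)
      fix k assume k: "k \<in> iso.ulimits"
      then have "iso.coset k \<in> cosets" by (auto simp: LCOSETS_def)
      then show "iso.mul l k \<in> {k\<in>iso.ulimits. iso.coset k \<in> U} \<longleftrightarrow>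
          iso.coset k \<in> ?t -` U \<inter> cosets"
        using t[OF k] iso.mul_closed[OF l k] by simp
    qed
    finally have "?t -` U \<inter> space W \<in> coset_opens"
      by (simp add: openin_coset_topology space_W)
    then show "?t -` U \<inter> space W \<in> sets W" by (simp add: sets_W sigma_sets.Basic)
  qed
  then show ?thesis by (simp add: W_def cong: measurable_cong_sets)
qed

text \<open>The open sets form an intersection-stable generator that contains the whole space, so
  agreement on them suffices; it follows from \<open>translate_preimage\<close> by taking
  complements within the orbit closure.\<close>

lemma haar_W: "haar_prob iso.completion iso.ulimits_top iso.stab W"
  unfolding haar_prob_def
proof (intro conjI ballI)
  interpret W: prob_space W by (rule prob_space_W)
  fix l assume "l \<in> carrier iso.completion"
  then have l: "l \<in> iso.ulimits" by simp
  let ?t = "iso.translate l"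
  show meas: "?t \<in> measurable W W" by (rule translation_measurable[OF l])
  show "distr W W ?t = W"
  proof (rule measure_eqI_generator_eq[where E = coset_opens and \<Omega> = cosets and A = "\<lambda>_. cosets"])
    show "Int_stable coset_opens" by (auto simp: Int_stable_def)
    show "sets (distr W W ?t) = sigma_sets cosets coset_opens" by (simp add: sets_W)
    have "openin (coset_topology iso.completion iso.ulimits_top iso.stab) cosets"
      using topspace_coset_topology[of iso.ulimits_top iso.completion iso.stab]
      by (metis iso.completion_simps(1) openin_topspace topspace_euclidean_subtopology)
    then show "range (\<lambda>_. cosets) \<subseteq> coset_opens" by auto
    show "emeasure (distr W W ?t) cosets \<noteq> \<infinity>"
      using finite_measure.emeasure_finite[OF prob_space.finite_measure[OF W.prob_space_distr[OF meas]]] by simp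
    fix U assume U: "U \<in> coset_opens"
    then have UW: "U \<in> sets W" by (simp add: sets_W sigma_sets.Basic)
    have tU: "?t -` U \<inter> space W \<in> sets W" using measurable_sets[OF meas UW] .
    let ?P = "{x\<in>X\<^sub>1. ?t (iso.points x) \<notin> U}" and ?Q = "{x\<in>X\<^sub>1. iso.points x \<notin> U}"
    have one: "{x\<in>X\<^sub>1. iso.translate (iso.emb \<one>) (iso.points x) \<notin> U} = ?Q"
      using iso.coset_translation_points[OF _ one_closed] iso.act_one[OF X1_S] by auto
    have P: "?P \<in> sets X" "measure X ?P = measure X ?Q" using translate_preimage[OF U l] by auto
    have Q: "?Q \<in> sets X" using translate_preimage(1)[OF U, of "iso.emb \<one>"] unfolding one by simp
    have "emeasure (distr W W ?t) U = emeasure W (?t -` U \<inter> space W)" by (rule emeasure_distr[OF meas UW])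
    also have "\<dots> = emeasure X (iso.points -` (?t -` U \<inter> space W) \<inter> X\<^sub>1)" by (rule emeasure_W[OF tU])
    also have "iso.points -` (?t -` U \<inter> space W) \<inter> X\<^sub>1 = X\<^sub>1 - ?P"
      using iso.points_in_cosets by (auto simp: space_W)
    also have "emeasure X (X\<^sub>1 - ?P) = emeasure X (X\<^sub>1 - ?Q)"
      unfolding emeasure_eq_measure using P Q by (subst (1 2) finite_measure_Diff) auto
    also have "X\<^sub>1 - ?Q = iso.points -` U \<inter> X\<^sub>1" by auto
    also have "emeasure X \<dots> = emeasure W U" by (rule emeasure_W[OF UW, symmetric])
    finally show "emeasure (distr W W ?t) U = emeasure W U" .
  qed (use coset_opens_Pow in \<open>auto simp: sets_W\<close>)
qed (auto simp: prob_space_W space_W sets_W)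

section \<open>The isometric factor and its non-triviality\<close>

abbreviation c :: "'a \<Rightarrow> point set \<Rightarrow> point set" where
  "c g \<equiv> iso.translate (iso.emb g)"

lemma isometric_W: "isometric_space G c W"
proof (rule isometric_space_coset)
  show "closedin iso.ulimits_top iso.stab"
    using iso.compact_points[OF iso.base] iso.points_subset
    by (simp add: closed_subset compact_imp_closed)
qed (auto simp: iso.compact_sc_group_completion iso.emb_hom iso.emb_dense iso.subgroup_stab haar_W is_group)

lemma factor_W: "is_factor G a X c W"
  unfolding is_factor_def factor_map_def
proof (intro conjI exI)
  show "G_space G c W" using isometric_W by (simp add: isometric_space_def)
  show "iso.points \<in> measurable R W"
    using points_measurable by (simp add: W_def cong: measurable_cong_sets)
qed (auto simp: X1_invariant_conull iso.coset_translation_points emeasure_W)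

text \<open>A point mass would give almost all points the same coset, and points with equal cosets
  are at distance zero.\<close>

lemma nontrivial_W:
  assumes "\<And>x. x \<in> S \<Longrightarrow> \<not> (AE y in X. d x y = 0)"
  shows "\<not> trivial_space W"
proof
  assume "trivial_space W"
  then obtain w where "AE v in W. v = w" by (auto simp: trivial_space_def)
  then obtain N where N: "N \<in> null_sets W" "{v\<in>space W. v \<noteq> w} \<subseteq> N"
    by (auto simp: eventually_ae_filter)
  have "emeasure X (iso.points -` N \<inter> X\<^sub>1) = 0"
    using emeasure_W[OF null_setsD2[OF N(1)]] null_setsD1[OF N(1)] by simp
  moreover have "iso.points -` N \<inter> X\<^sub>1 \<in> sets X"
  proof -
    have "iso.points -` N \<inter> space R \<in> sets R"
      by (rule measurable_sets[OF points_measurable]) (use N(1) in \<open>auto simp: W_def\<close>)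
    moreover have "iso.points -` N \<inter> space R = iso.points -` N \<inter> X\<^sub>1"
      using X1_S S_space by (auto simp: space_restrict_space)
    ultimately show ?thesis by (subst (asm) sets_restrict_space_iff) auto
  qed
  ultimately have "iso.points -` N \<inter> X\<^sub>1 \<in> null_sets X" by auto
  then have "AE x in X. x \<notin> iso.points -` N \<inter> X\<^sub>1" by (rule AE_not_in)
  then have const: "AE x in X. x \<in> X\<^sub>1 \<and> iso.points x = w"
    using X1_AE
  proof eventually_elim
    case (elim x)
    then show ?case using N(2) iso.points_in_cosets by (auto simp: space_W)
  qed
  have "\<exists>x. x \<in> X\<^sub>1 \<and> iso.points x = w"
  proof (rule ccontr)
    assume nex: "\<nexists>x. x \<in> X\<^sub>1 \<and> iso.points x = w"
    have "AE x in X. False" using const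
    proof eventually_elim
      case (elim x)
      then show ?case using nex by blast
    qed
    then show False by simp
  qed
  then obtain x where x: "x \<in> X\<^sub>1" "iso.points x = w" by blast
  have "AE y in X. d x y = 0"
    using const
  proof eventually_elim
    case (elim y)
    then show ?case using iso.points_eq_imp_d[OF x(1) X1_S] x(2) by blast
  qed
  then show False using assms[OF X1_S[OF x(1)]] by simp
qed

end

section \<open>Bounded kernels on products of probability spaces\<close>

lemma mult_bound: "\<bar>x\<bar> \<le> 1 \<Longrightarrow> \<bar>y\<bar> \<le> 1 \<Longrightarrow> \<bar>x * y\<bar> \<le> (1::real)"
  unfolding abs_mult by (rule mult_le_one) auto

text \<open>Integrability is not assumed: the integral defaults to 0 otherwise, and C is nonnegative
  because it bounds an absolute value. This spares measurability conditions on slices.\<close>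

lemma (in prob_space) abs_integral_le:
  assumes "\<And>x. \<bar>h x\<bar> \<le> (C::real)"
  shows "\<bar>\<integral>x. h x \<partial>M\<bar> \<le> C"
proof (cases "integrable M h")
  case True
  have "\<bar>\<integral>x. h x \<partial>M\<bar> \<le> (\<integral>x. \<bar>h x\<bar> \<partial>M)" by (rule integral_abs_bound)
  also have "\<dots> \<le> (\<integral>x. C \<partial>M)" by (rule integral_mono) (use True assms in auto)
  finally show ?thesis by (simp add: prob_space)
next
  case False
  then show ?thesis using assms[of undefined] by (simp add: not_integrable_integral_eq)
qed

lemma (in prob_space) integrable_bounded:
  assumes "h \<in> borel_measurable M" "\<And>x. \<bar>h x\<bar> \<le> (C::real)"
  shows "integrable M h"
  by (rule integrable_const_bound[of _ C]) (use assms in auto)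

lemma fubini_bounded:
  fixes f :: "'a \<times> 'b \<Rightarrow> real"
  assumes M: "prob_space M" and N: "prob_space N"
    and f [measurable]: "f \<in> borel_measurable (M \<Otimes>\<^sub>M N)" and bound: "\<And>p. \<bar>f p\<bar> \<le> C"
  shows "integrable (M \<Otimes>\<^sub>M N) f"
    and "(\<integral>x. \<integral>y. f (x, y) \<partial>N \<partial>M) = (\<integral>p. f p \<partial>(M \<Otimes>\<^sub>M N))"
    and "(\<integral>y. \<integral>x. f (x, y) \<partial>M \<partial>N) = (\<integral>x. \<integral>y. f (x, y) \<partial>N \<partial>M)"
proof -
  interpret M: prob_space M by (rule M)
  interpret N: prob_space N by (rule N)
  interpret P: pair_prob_space M N ..
  show int: "integrable (M \<Otimes>\<^sub>M N) f" by (rule P.integrable_bounded[OF f bound])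
  then have int': "integrable (M \<Otimes>\<^sub>M N) (\<lambda>(x, y). f (x, y))" by simp
  show "(\<integral>x. \<integral>y. f (x, y) \<partial>N \<partial>M) = (\<integral>p. f p \<partial>(M \<Otimes>\<^sub>M N))"
    using P.integral_fst[OF int'] by simp
  show "(\<integral>y. \<integral>x. f (x, y) \<partial>M \<partial>N) = (\<integral>x. \<integral>y. f (x, y) \<partial>N \<partial>M)"
    using P.Fubini_integral[OF int'] by simp
qed

lemma pair_sets_induct [consumes 1, case_names rect compl union]:
  assumes E: "E \<in> sets (M \<Otimes>\<^sub>M N)"
    and rect: "\<And>A B. \<lbrakk>A \<in> sets M; B \<in> sets N\<rbrakk> \<Longrightarrow> P (A \<times> B)"
    and compl: "\<And>E. \<lbrakk>E \<in> sets (M \<Otimes>\<^sub>M N); P E\<rbrakk> \<Longrightarrow> P (space M \<times> space N - E)"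
    and disj: "\<And>A :: nat \<Rightarrow> _. \<lbrakk>disjoint_family A; range A \<subseteq> sets (M \<Otimes>\<^sub>M N); \<And>i. P (A i)\<rbrakk> \<Longrightarrow> P (\<Union>i. A i)"
  shows "P E"
proof -
  have "E \<in> sigma_sets (space M \<times> space N) {a \<times> b |a b. a \<in> sets M \<and> b \<in> sets N}"
    using E by (simp add: sets_pair_measure)
  with Int_stable_pair_measure_generator pair_measure_closed show ?thesis
  proof (induction rule: sigma_sets_induct_disjoint)
    case empty
    show ?case using rect[of "{}" "{}"] by simp
  next
    case (union A)
    then show ?case by (intro disj) (auto simp: sets_pair_measure)
  qed (auto intro: rect compl simp: sets_pair_measure)
qed

text \<open>The vectors \<open>F(x, \<cdot>)\<close> are almost surely pairwise orthogonal, including almost all pairs near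
  the diagonal; by joint measurability this forces them to vanish.\<close>

lemma gram_zero:
  fixes F :: "'a \<times> 'b \<Rightarrow> real"
  assumes M: "prob_space M" and N: "prob_space N"
    and F [measurable]: "F \<in> borel_measurable (M \<Otimes>\<^sub>M N)" and bound: "\<And>p. \<bar>F p\<bar> \<le> 1"
    and orth: "AE x in M. AE x' in M. (\<integral>z. F (x, z) * F (x', z) \<partial>N) = 0"
  shows "AE x in M. AE z in N. F (x, z) = 0"
proof -
  let ?P = "M \<Otimes>\<^sub>M N"
  interpret M: prob_space M by (rule M)
  interpret N: prob_space N by (rule N)
  interpret P: pair_prob_space M N ..
  \<comment> \<open>By Fubini the squared norm of the average of the vectors F(x, .) over x in A is
    the integral of their inner products over A \<times> A, which vanishes.\<close>
  have slice: "AE z in N. (\<integral>x. indicator A x * F (x, z) \<partial>M) = 0" if A [measurable]: "A \<in> sets M" for A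
  proof -
    define S where "S z = (\<integral>x. indicator A x * F (x, z) \<partial>M)" for z
    have [measurable]: "S \<in> borel_measurable N" unfolding S_def by measurable
    have b: "\<bar>indicator A x * F p\<bar> \<le> 1" for x p using bound by (auto simp: indicator_def)
    have S_bound: "\<bar>S z\<bar> \<le> 1" for z unfolding S_def by (rule M.abs_integral_le) (rule b)
    have b2: "\<bar>indicator A x * F p * (indicator A x' * F p')\<bar> \<le> 1" for x p x' p' by (intro mult_bound b)
    have b3: "\<bar>indicator A x * F p * S z\<bar> \<le> 1" for x p z by (intro mult_bound b S_bound)
    have "(\<integral>z. S z * S z \<partial>N) = (\<integral>z. \<integral>x. indicator A x * F (x, z) * S z \<partial>M \<partial>N)"
      by (simp add: S_def)
    also have "\<dots> = (\<integral>x. \<integral>z. indicator A x * F (x, z) * S z \<partial>N \<partial>M)"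
      using fubini_bounded(3)[OF M N, of "\<lambda>p. indicator A (fst p) * F p * S (snd p)" 1] b3 by simp
    also have "\<dots> = (\<integral>x. \<integral>z. \<integral>x'. indicator A x * F (x, z) * (indicator A x' * F (x', z)) \<partial>M \<partial>N \<partial>M)"
      by (simp add: S_def)
    also have "\<dots> = (\<integral>x. \<integral>x'. \<integral>z. indicator A x * F (x, z) * (indicator A x' * F (x', z)) \<partial>N \<partial>M \<partial>M)"
    proof (intro Bochner_Integration.integral_cong refl)
      fix x assume [measurable]: "x \<in> space M"
      show "(\<integral>z. \<integral>x'. indicator A x * F (x, z) * (indicator A x' * F (x', z)) \<partial>M \<partial>N) =
          (\<integral>x'. \<integral>z. indicator A x * F (x, z) * (indicator A x' * F (x', z)) \<partial>N \<partial>M)"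
        using fubini_bounded(3)[OF M N, of "\<lambda>p. indicator A x * F (x, snd p) * (indicator A (fst p) * F p)" 1] b2 by simp
    qed
    also have "\<dots> = (\<integral>x. \<integral>x'. indicator A x * indicator A x' * (\<integral>z. F (x, z) * F (x', z) \<partial>N) \<partial>M \<partial>M)"
      by (simp add: mult_ac flip: integral_mult_right_zero)
    also have "\<dots> = 0"
    proof (rule integral_eq_zero_AE)
      show "AE x in M. (\<integral>x'. indicator A x * indicator A x' * (\<integral>z. F (x, z) * F (x', z) \<partial>N) \<partial>M) = 0"
        using orth
      proof eventually_elim
        case (elim x)
        show ?case by (rule integral_eq_zero_AE) (rule eventually_mono[OF elim], simp)
      qed
    qed
    finally have "(\<integral>z. S z * S z \<partial>N) = 0" .
    moreover have "integrable N (\<lambda>z. S z * S z)"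
    proof (rule N.integrable_bounded[where C = 1])
      show "\<bar>S z * S z\<bar> \<le> 1" for z
        by (intro mult_bound S_bound)
    qed measurable
    ultimately have "AE z in N. S z * S z = 0"
      by (subst (asm) integral_nonneg_eq_0_iff_AE) auto
    then show ?thesis unfolding S_def by simp
  qed
  \<comment> \<open>The vanishing averages give integral zero over every rectangle, hence over every
    measurable set, which makes F vanish almost everywhere.\<close>
  have zero: "(\<integral>p. indicator E p * F p \<partial>?P) = 0" if "E \<in> sets ?P" for E
    using that
  proof (induction rule: pair_sets_induct)
    case (rect A B)
    note [measurable] = rect
    have "(\<integral>p. indicator (A \<times> B) p * F p \<partial>?P) = (\<integral>z. \<integral>x. indicator (A \<times> B) (x, z) * F (x, z) \<partial>M \<partial>N)"
      using fubini_bounded(2,3)[OF M N, of "\<lambda>p. indicator (A \<times> B) p * F p" 1] bound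
      by (auto simp: indicator_def)
    also have "\<dots> = (\<integral>z. indicator B z * (\<integral>x. indicator A x * F (x, z) \<partial>M) \<partial>N)"
      by (simp add: indicator_times mult_ac flip: integral_mult_right_zero)
    also have "\<dots> = 0"
      by (rule integral_eq_zero_AE) (use slice[OF rect(1)] in \<open>auto elim: eventually_mono\<close>)
    finally show ?case .
  next
    case (compl E)
    note [measurable] = compl(1)
    have rect: "(\<integral>p. F p \<partial>?P) = 0"
    proof -
      have "(\<integral>p. F p \<partial>?P) = (\<integral>z. \<integral>x. F (x, z) \<partial>M \<partial>N)"
        using fubini_bounded(2,3)[OF M N F bound] by simp
      also have "\<dots> = (\<integral>z. \<integral>x. indicator (space M) x * F (x, z) \<partial>M \<partial>N)"
        by (intro Bochner_Integration.integral_cong refl) simp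
      also have "\<dots> = 0"
        by (rule integral_eq_zero_AE) (use slice[of "space M"] in auto)
      finally show ?thesis .
    qed
    have "(\<integral>p. indicator (space M \<times> space N - E) p * F p \<partial>?P) = (\<integral>p. F p - indicator E p * F p \<partial>?P)"
      by (intro Bochner_Integration.integral_cong) (auto simp: space_pair_measure indicator_def)
    also have "\<dots> = (\<integral>p. F p \<partial>?P) - (\<integral>p. indicator E p * F p \<partial>?P)"
      by (intro Bochner_Integration.integral_diff P.integrable_bounded[where C = 1])
        (use bound in \<open>auto simp: indicator_def\<close>)
    finally show ?case using rect compl by simp
  next
    case (union A)
    then have [measurable]: "A i \<in> sets ?P" for i by auto
    have "(\<integral>p. indicator (\<Union>i. A i) p * F p \<partial>?P) = (\<Sum>i. \<integral>p. indicator (A i) p * F p \<partial>?P)"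
      using lebesgue_integral_countable_add[of A ?P F] union(1)
        P.integrable_bounded[where C = 1 and h = "\<lambda>p. indicator (\<Union>i. A i) p * F p"] bound
      by (auto simp: set_lebesgue_integral_def set_integrable_def disjoint_family_on_def indicator_def)
    then show ?case using union by simp
  qed
  have "AE p in ?P. F p = 0"
    by (rule P.density_zero[OF fubini_bounded(1)[OF M N F bound]]) (simp add: set_lebesgue_integral_def zero)
  then show ?thesis by (rule P.AE_pair)
qed

text \<open>An integral operator with a measurable kernel is compact; here it acts on uniformly bounded
  functions. The kernel is approximated by finite unions of rectangles.\<close>

lemma kernel_totally_bounded:
  fixes \<phi> :: "'i \<Rightarrow> 'b \<Rightarrow> real"
  assumes M: "prob_space M" and N: "prob_space N" and E: "E \<in> sets (M \<Otimes>\<^sub>M N)"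
    and \<phi> [measurable]: "\<And>i. i \<in> I \<Longrightarrow> \<phi> i \<in> borel_measurable N" and bound: "\<And>i y. \<bar>\<phi> i y\<bar> \<le> 1"
  shows "totally_bounded_on I (\<lambda>i j. \<integral>z. \<bar>\<integral>y. indicator E (z, y) * (\<phi> i y - \<phi> j y) \<partial>N\<bar> \<partial>M)"
    (is "totally_bounded_on I (?e E)")
  using E
proof (induction rule: pair_sets_induct)
  let ?P = "M \<Otimes>\<^sub>M N"
  let ?s = "\<lambda>E i j z. \<integral>y. indicator E (z, y) * (\<phi> i y - \<phi> j y) \<partial>N"
  interpret M: prob_space M by (rule M)
  interpret N: prob_space N by (rule N)
  interpret P: pair_prob_space M N ..
  have diff: "\<bar>\<phi> i y - \<phi> j y\<bar> \<le> 2" for i j y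
    using bound[of i y] bound[of j y] by linarith
  have ind: "\<bar>indicator A p * (\<phi> i y - \<phi> j y)\<bar> \<le> 2" for A :: "'c set" and p i j y
    using diff[of i y j] by (auto simp: indicator_def)
  {
    case (rect A B)
    note [measurable] = rect
    \<comment> \<open>A rectangle gives an operator of rank one, which sees a function only through
      its integral over B.\<close>
    have "?e (A \<times> B) i j \<le> \<bar>(\<integral>y. indicator B y * \<phi> i y \<partial>N) - (\<integral>y. indicator B y * \<phi> j y \<partial>N)\<bar>"
      if [measurable]: "i \<in> I" "j \<in> I" for i j
    proof -
      have int: "integrable N (\<lambda>y. indicator B y * \<phi> i y)" if [measurable]: "i \<in> I" for i
        by (rule N.integrable_bounded[where C = 1]) (use bound in \<open>auto simp: indicator_def\<close>)
      have "?e (A \<times> B) i j = (\<integral>z. indicator A z * \<bar>\<integral>y. indicator B y * (\<phi> i y - \<phi> j y) \<partial>N\<bar> \<partial>M)"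
        by (intro Bochner_Integration.integral_cong refl) (auto simp: indicator_times mult.assoc indicator_def)
      also have "\<dots> = measure M A * \<bar>\<integral>y. indicator B y * (\<phi> i y - \<phi> j y) \<partial>N\<bar>"
        by simp
      also have "\<dots> \<le> 1 * \<bar>\<integral>y. indicator B y * (\<phi> i y - \<phi> j y) \<partial>N\<bar>"
        by (intro mult_right_mono) auto
      also have "(\<integral>y. indicator B y * (\<phi> i y - \<phi> j y) \<partial>N) = (\<integral>y. indicator B y * \<phi> i y \<partial>N) - (\<integral>y. indicator B y * \<phi> j y \<partial>N)"
        using int[OF that(1)] int[OF that(2)] by (simp add: right_diff_distrib)
      finally show ?thesis by simp
    qed
    moreover have "totally_bounded_on I (\<lambda>i j. \<bar>(\<integral>y. indicator B y * \<phi> i y \<partial>N) - (\<integral>y. indicator B y * \<phi> j y \<partial>N)\<bar>)"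
      by (rule totally_bounded_on_bounded_function[where b = 1], rule N.abs_integral_le)
        (use bound in \<open>auto simp: indicator_def\<close>)
    ultimately show ?case by (rule totally_bounded_on_mono[rotated])
  next
    case (compl E)
    note [measurable] = compl(1)
    have "?e (space M \<times> space N - E) i j \<le> \<bar>(\<integral>y. \<phi> i y \<partial>N) - (\<integral>y. \<phi> j y \<partial>N)\<bar> + ?e E i j"
      if [measurable]: "i \<in> I" "j \<in> I" for i j
    proof -
      have int: "integrable N (\<phi> i)" "integrable N (\<phi> j)"
        by (auto intro!: N.integrable_bounded[where C = 1] bound)
      have "?e (space M \<times> space N - E) i j \<le>
          (\<integral>z. \<bar>(\<integral>y. \<phi> i y \<partial>N) - (\<integral>y. \<phi> j y \<partial>N)\<bar> + \<bar>?s E i j z\<bar> \<partial>M)"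
      proof (rule integral_mono)
        show "integrable M (\<lambda>z. \<bar>?s (space M \<times> space N - E) i j z\<bar>)"
          by (rule M.integrable_bounded[where C = 2]) (auto intro!: N.abs_integral_le ind)
        show "integrable M (\<lambda>z. \<bar>(\<integral>y. \<phi> i y \<partial>N) - (\<integral>y. \<phi> j y \<partial>N)\<bar> + \<bar>?s E i j z\<bar>)"
          by (intro Bochner_Integration.integrable_add M.integrable_bounded[where C = 2])
            (auto intro!: N.abs_integral_le ind simp: diff simp flip: Bochner_Integration.integral_diff[OF int])
        fix z assume z [measurable]: "z \<in> space M"
        have intE: "integrable N (\<lambda>y. indicator E (z, y) * (\<phi> i y - \<phi> j y))"
          by (rule N.integrable_bounded[where C = 2]) (auto intro!: ind)
        have "(?s (space M \<times> space N - E) i j z) =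
            (\<integral>y. (\<phi> i y - \<phi> j y) - indicator E (z, y) * (\<phi> i y - \<phi> j y) \<partial>N)"
          using z by (intro Bochner_Integration.integral_cong refl) (auto simp: indicator_def)
        also have "\<dots> = (\<integral>y. \<phi> i y \<partial>N) - (\<integral>y. \<phi> j y \<partial>N) - (?s E i j z)"
          using int intE by simp
        finally show "\<bar>?s (space M \<times> space N - E) i j z\<bar> \<le>
            \<bar>(\<integral>y. \<phi> i y \<partial>N) - (\<integral>y. \<phi> j y \<partial>N)\<bar> + \<bar>?s E i j z\<bar>" by linarith
      qed
      also have "\<dots> = \<bar>(\<integral>y. \<phi> i y \<partial>N) - (\<integral>y. \<phi> j y \<partial>N)\<bar> + ?e E i j"
        by (subst Bochner_Integration.integral_add)
          (auto intro!: M.integrable_bounded[where C = 2] N.abs_integral_le ind simp: M.prob_space)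
      finally show ?thesis .
    qed
    moreover have "totally_bounded_on I (\<lambda>i j. \<bar>(\<integral>y. \<phi> i y \<partial>N) - (\<integral>y. \<phi> j y \<partial>N)\<bar> + ?e E i j)"
      by (intro totally_bounded_on_add compl totally_bounded_on_bounded_function[where b = 1] N.abs_integral_le bound)
    ultimately show ?case by (rule totally_bounded_on_mono[rotated])
  next
    case (union A)
    then have A [measurable]: "A i \<in> sets ?P" for i by auto
    then have [measurable]: "(\<Union>i. A i) \<in> sets ?P" by blast
    show ?case
    proof (rule totally_bounded_on_approx)
      fix \<epsilon> :: real assume "\<epsilon> > 0"
      \<comment> \<open>The tail of the union has measure tending to 0. Differences of the functions
        are at most 2, so it contributes at most twice its measure; hence the threshold
        \<epsilon>/2.\<close>
      define T where "T n = (\<Union>i. A i) - (\<Union>i<n. A i)" for n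
      have T [measurable]: "T n \<in> sets ?P" for n unfolding T_def by measurable
      have "(\<lambda>n. measure ?P (T n)) \<longlonglongrightarrow> measure ?P (\<Inter>n. T n)"
        by (rule P.finite_Lim_measure_decseq) (auto simp: decseq_def T_def)
      moreover have "(\<Inter>n. T n) = {}" by (auto simp: T_def)
      ultimately have "(\<lambda>n. measure ?P (T n)) \<longlonglongrightarrow> 0" by simp
      then have "\<forall>\<^sub>F n in sequentially. measure ?P (T n) < \<epsilon> / 2"
        by (rule order_tendstoD) (use \<open>\<epsilon> > 0\<close> in simp)
      then obtain n where n: "measure ?P (T n) < \<epsilon> / 2" by (auto simp: eventually_sequentially)
      have "?e (\<Union>i. A i) i j \<le> (\<Sum>k<n. ?e (A k) i j) + \<epsilon>" if [measurable]: "i \<in> I" "j \<in> I" for i j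
      proof -
        have slice: "\<bar>?s (A k) i j z\<bar> \<le> 2" for k z
          by (rule N.abs_integral_le) (rule ind)
        have mass: "\<bar>\<integral>y. indicator (T n) (z, y) \<partial>N\<bar> \<le> (2::real)" for z
          by (rule N.abs_integral_le) (simp add: indicator_def)
        have split: "indicator (\<Union>i. A i) p = (\<Sum>k<n. indicator (A k) p) + (indicator (T n) p :: real)" for p
        proof -
          have "(\<Sum>k<n. indicator (A k) p :: real) = indicator (\<Union>k<n. A k) p"
            using union(1) by (intro indicator_UN_disjoint[symmetric]) (auto simp: disjoint_family_on_def)
          then show ?thesis by (auto simp: T_def indicator_def)
        qed
        have "?e (\<Union>i. A i) i j \<le> (\<integral>z. (\<Sum>k<n. \<bar>?s (A k) i j z\<bar>) +
            2 * (\<integral>y. indicator (T n) (z, y) \<partial>N) \<partial>M)"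
        proof (rule integral_mono)
          show "integrable M (\<lambda>z. \<bar>?s (\<Union>i. A i) i j z\<bar>)"
            by (rule M.integrable_bounded[where C = 2]) (auto intro!: N.abs_integral_le ind)
          show "integrable M (\<lambda>z. (\<Sum>k<n. \<bar>?s (A k) i j z\<bar>) + 2 * (\<integral>y. indicator (T n) (z, y) \<partial>N))"
            by (intro Bochner_Integration.integrable_add Bochner_Integration.integrable_sum integrable_mult_right
                M.integrable_bounded[where C = 2])
              (auto simp: slice abs_le_D1[OF mass])
          fix z assume z [measurable]: "z \<in> space M"
          have int: "integrable N (\<lambda>y. indicator E (z, y) * (\<phi> i y - \<phi> j y))" if [measurable]: "E \<in> sets ?P" for E
            by (rule N.integrable_bounded[where C = 2]) (auto intro!: ind)
          have "(?s (\<Union>i. A i) i j z) =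
              (\<integral>y. (\<Sum>k<n. indicator (A k) (z, y) * (\<phi> i y - \<phi> j y)) + indicator (T n) (z, y) * (\<phi> i y - \<phi> j y) \<partial>N)"
            by (simp only: split distrib_right sum_distrib_right)
          also have "\<dots> = (\<integral>y. (\<Sum>k<n. indicator (A k) (z, y) * (\<phi> i y - \<phi> j y)) \<partial>N) + (?s (T n) i j z)"
            by (intro Bochner_Integration.integral_add Bochner_Integration.integrable_sum int A T)
          also have "(\<integral>y. (\<Sum>k<n. indicator (A k) (z, y) * (\<phi> i y - \<phi> j y)) \<partial>N) =
              (\<Sum>k<n. ?s (A k) i j z)"
            by (intro Bochner_Integration.integral_sum int A)
          finally have "(?s (\<Union>i. A i) i j z) =
              (\<Sum>k<n. ?s (A k) i j z) + (?s (T n) i j z)" .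
          moreover have "\<bar>?s (T n) i j z\<bar> \<le> (\<integral>y. 2 * indicator (T n) (z, y) \<partial>N)"
          proof (rule order_trans[OF integral_abs_bound], rule integral_mono)
            show "integrable N (\<lambda>y. \<bar>indicator (T n) (z, y) * (\<phi> i y - \<phi> j y)\<bar>)" using int[OF T] by simp
            show "integrable N (\<lambda>y. 2 * indicator (T n) (z, y) :: real)"
              by (rule N.integrable_bounded[where C = 2]) (auto simp: indicator_def)
          qed (use diff in \<open>auto simp: indicator_def\<close>)
          moreover have "\<bar>\<Sum>k<n. ?s (A k) i j z\<bar> \<le>
              (\<Sum>k<n. \<bar>?s (A k) i j z\<bar>)" by (rule sum_abs)
          ultimately show "\<bar>?s (\<Union>i. A i) i j z\<bar> \<le>
              (\<Sum>k<n. \<bar>?s (A k) i j z\<bar>) + 2 * (\<integral>y. indicator (T n) (z, y) \<partial>N)"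
            unfolding integral_mult_right_zero by linarith
        qed
        also have "\<dots> = (\<Sum>k<n. ?e (A k) i j) + 2 * (\<integral>z. \<integral>y. indicator (T n) (z, y) \<partial>N \<partial>M)"
        proof (subst Bochner_Integration.integral_add)
          have int: "integrable M (\<lambda>z. \<bar>?s (A k) i j z\<bar>)" for k
            by (rule M.integrable_bounded[where C = 2]) (auto simp: slice)
          then show "integrable M (\<lambda>z. \<Sum>k<n. \<bar>?s (A k) i j z\<bar>)"
            by simp
          show "integrable M (\<lambda>z. 2 * (\<integral>y. indicator (T n) (z, y) \<partial>N) :: real)"
            by (intro integrable_mult_right M.integrable_bounded[where C = 2]) (auto simp: abs_le_D1[OF mass])
          show "(\<integral>z. (\<Sum>k<n. \<bar>?s (A k) i j z\<bar>) \<partial>M) +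
              (\<integral>z. 2 * (\<integral>y. indicator (T n) (z, y) \<partial>N) \<partial>M) =
              (\<Sum>k<n. ?e (A k) i j) + 2 * (\<integral>z. \<integral>y. indicator (T n) (z, y) \<partial>N \<partial>M)"
            using int by simp
        qed
        also have "(\<integral>z. \<integral>y. indicator (T n) (z, y) \<partial>N \<partial>M) = measure ?P (T n)"
        proof -
          have "(\<integral>z. \<integral>y. indicator (T n) (z, y) \<partial>N \<partial>M) = (\<integral>p. indicator (T n) p \<partial>?P :: real)"
            by (rule fubini_bounded(2)[OF M N, where C = 1]) (auto simp: indicator_def)
          then show ?thesis by simp
        qed
        finally show ?thesis using n by linarith
      qed
      moreover have "totally_bounded_on I (\<lambda>i j. \<Sum>k<n. ?e (A k) i j)"
        by (rule totally_bounded_on_sum) (rule union(3))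
      ultimately show "\<exists>e'. totally_bounded_on I e' \<and> (\<forall>i\<in>I. \<forall>j\<in>I. ?e (\<Union>i. A i) i j \<le> e' i j + \<epsilon>)" by blast
    qed
  }
qed

text \<open>The support has full measure, with total boundedness in place of second countability:
  points whose ball of radius \<open>r n\<close> is null are covered by finitely many such balls.
  These points need not form a measurable set, so null supersets are carried along.\<close>

lemma totally_bounded_base_point:
  assumes "S \<in> sets M" "S \<notin> null_sets M" "totally_bounded_on S d"
    and sym: "\<And>x y. \<lbrakk>x \<in> S; y \<in> S\<rbrakk> \<Longrightarrow> d x y = d y x"
    and balls: "\<And>x r. x \<in> S \<Longrightarrow> {y\<in>S. d x y < r} \<in> sets M"
  obtains x\<^sub>0 where "x\<^sub>0 \<in> S" "\<And>r. r > 0 \<Longrightarrow> {y\<in>S. d x\<^sub>0 y < r} \<notin> null_sets M"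
proof -
  define r where "r n = inverse (real (Suc n))" for n
  define Z where "Z n = {x\<in>S. {y\<in>S. d x y < r n} \<in> null_sets M}" for n
  have "\<exists>N\<in>null_sets M. Z n \<subseteq> N" for n
  proof -
    have tb: "totally_bounded_on (Z n) d"
      using totally_bounded_on_comp[OF assms(3), of "Z n" "\<lambda>x. x"] by (simp add: Z_def)
    have "r n > 0" by (simp add: r_def)
    then obtain F where F: "finite F" "F \<subseteq> Z n" "\<And>x. x \<in> Z n \<Longrightarrow> \<exists>y\<in>F. d x y < r n"
      by (rule totally_bounded_on_net[OF tb]) blast
    have "(\<Union>x\<in>F. {y\<in>S. d x y < r n}) \<in> null_sets M"
      using F(1,2) by (intro null_sets.finite_UN) (auto simp: Z_def)
    moreover have "Z n \<subseteq> (\<Union>x\<in>F. {y\<in>S. d x y < r n})"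
    proof
      fix x assume x: "x \<in> Z n"
      then obtain y where y: "y \<in> F" "d x y < r n" using F(3) by blast
      have "x \<in> S" "y \<in> S" using x y(1) F(2) by (auto simp: Z_def)
      then show "x \<in> (\<Union>x\<in>F. {y\<in>S. d x y < r n})"
        using y sym[of x y] by auto
    qed
    ultimately show ?thesis by blast
  qed
  then obtain N where N: "\<And>n. N n \<in> null_sets M" "\<And>n. Z n \<subseteq> N n" by metis
  have "\<not> S \<subseteq> (\<Union>n. N n)"
  proof
    assume "S \<subseteq> (\<Union>n. N n)"
    then have "S \<in> null_sets M" using null_sets_UN[of N M] N(1) assms(1) null_sets_subset by blast
    then show False using assms(2) by blast
  qed
  then obtain x\<^sub>0 where x\<^sub>0: "x\<^sub>0 \<in> S" "\<And>n. x\<^sub>0 \<notin> N n" by blast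
  show ?thesis
  proof
    show "x\<^sub>0 \<in> S" by (rule x\<^sub>0)
    fix s :: real assume "s > 0"
    then obtain n where n: "r n < s" using reals_Archimedean unfolding r_def by blast
    show "{y\<in>S. d x\<^sub>0 y < s} \<notin> null_sets M"
    proof
      assume "{y\<in>S. d x\<^sub>0 y < s} \<in> null_sets M"
      then have "{y\<in>S. d x\<^sub>0 y < r n} \<in> null_sets M"
        by (rule null_sets_subset) (use n x\<^sub>0(1) balls in auto)
      then show False using x\<^sub>0 N(2)[of n] by (auto simp: Z_def)
    qed
  qed
qed

section \<open>Averages of stationary families are invariant\<close>

lemma AE_pair_fst_snd:
  assumes Y: "prob_space Y" and P: "AE y in Y. P y"
  shows "AE p in Y \<Otimes>\<^sub>M Y. P (fst p) \<and> P (snd p)"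
proof -
  interpret Y: prob_space Y by (rule Y)
  interpret YY: pair_prob_space Y Y ..
  obtain N where N [measurable]: "N \<in> sets Y" and "N \<in> null_sets Y" "{y\<in>space Y. \<not> P y} \<subseteq> N"
    using P by (auto simp: eventually_ae_filter)
  then have AE: "AE y in Y. y \<notin> N" by (intro AE_not_in) simp
  have "AE p in Y \<Otimes>\<^sub>M Y. fst p \<notin> N \<and> snd p \<notin> N"
  proof (rule YY.AE_pair_measure)
    show "AE x in Y. AE y in Y. fst (x, y) \<notin> N \<and> snd (x, y) \<notin> N"
      using AE by eventually_elim (use AE in simp)
  qed measurable
  then show ?thesis
    by (rule AE_mp) (use \<open>{y\<in>space Y. \<not> P y} \<subseteq> N\<close> in \<open>auto intro!: AE_I2 simp: space_pair_measure\<close>)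
qed

context stationary_action
begin

text \<open>If the mean of the translates of a vector in a Hilbert space is the vector itself and all of
  them have the same norm, then they coincide. The mean is evaluated with stationarity, after
  exchanging the order of integration.\<close>

lemma average_invariant:
  fixes F :: "'x \<times> 'z \<Rightarrow> real"
  assumes Z: "prob_space Z" and F [measurable]: "F \<in> borel_measurable (M \<Otimes>\<^sub>M Z)" and bound: "\<And>p. \<bar>F p\<bar> \<le> 1"
    and c: "\<And>g. g \<in> carrier G \<Longrightarrow> c g \<in> measurable Z Z" "\<And>g. g \<in> carrier G \<Longrightarrow> distr Z Z (c g) = Z"
    and inv: "\<And>g. g \<in> carrier G \<Longrightarrow> AE x in M. AE z in Z. F (a g x, z) = F (x, c g z)"
    and s: "s \<in> set_pmf \<mu>"
  shows "AE z in Z. (\<integral>x. F (x, c s z) \<partial>M) = (\<integral>x. F (x, z) \<partial>M)"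
proof -
  interpret Z: prob_space Z by (rule Z)
  interpret P: pair_prob_space M Z ..
  define u where "u z = (\<integral>x. F (x, z) \<partial>M)" for z
  define v where "v g z = (\<integral>x. F (a g x, z) \<partial>M)" for g z
  \<comment> \<open>Integrating \<Psi> over the translate by g gives the inner product of u with v
    g, so stationarity says that these inner products average to r, the squared norm of u.\<close>
  define \<Psi> where "\<Psi> x = (\<integral>z. u z * F (x, z) \<partial>Z)" for x
  define r where "r = (\<integral>z. u z * u z \<partial>Z)"
  note [measurable] = act_measurable c(1)
  have u [measurable]: "u \<in> borel_measurable Z" unfolding u_def by measurable
  have u_bound: "\<bar>u z\<bar> \<le> 1" for z unfolding u_def by (rule abs_integral_le) (rule bound)
  have v [measurable]: "v g \<in> borel_measurable Z" if [measurable]: "g \<in> carrier G" for g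
    unfolding v_def by measurable
  have v_bound: "\<bar>v g z\<bar> \<le> 1" for g z unfolding v_def by (rule abs_integral_le) (rule bound)
  have \<Psi> [measurable]: "\<Psi> \<in> borel_measurable M" unfolding \<Psi>_def by measurable
  have \<Psi>_bound: "\<bar>\<Psi> x\<bar> \<le> 1" for x
    unfolding \<Psi>_def by (rule Z.abs_integral_le) (intro mult_bound u_bound bound)
  have v_eq: "AE z in Z. v g z = u (c g z)" if g [measurable]: "g \<in> carrier G" for g
  proof -
    have "AE z in Z. AE x in M. F (a g x, z) = F (x, c g z)"
      using inv[OF g] by (subst (asm) P.AE_commute) auto
    then show ?thesis
    proof (rule AE_mp, intro AE_I2 impI)
      fix z assume [measurable]: "z \<in> space Z" and "AE x in M. F (a g x, z) = F (x, c g z)"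
      then show "v g z = u (c g z)"
        unfolding v_def u_def by (intro integral_cong_AE) auto
    qed
  qed
  have \<Psi>_act: "(\<integral>x. \<Psi> (a g x) \<partial>M) = (\<integral>z. u z * v g z \<partial>Z)" if [measurable]: "g \<in> carrier G" for g
  proof -
    have "(\<integral>z. \<integral>x. u z * F (a g x, z) \<partial>M \<partial>Z) = (\<integral>x. \<integral>z. u z * F (a g x, z) \<partial>Z \<partial>M)"
      using fubini_bounded(3)[OF prob_space_axioms Z, of "\<lambda>p. u (snd p) * F (a g (fst p), snd p)" 1]
        mult_bound[OF u_bound bound] by simp
    then show ?thesis by (simp add: \<Psi>_def v_def)
  qed
  have \<Psi>_int: "(\<integral>x. \<Psi> x \<partial>M) = r"
  proof -
    have "(\<integral>x. \<Psi> x \<partial>M) = (\<integral>x. \<Psi> (a \<one> x) \<partial>M)"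
      by (intro Bochner_Integration.integral_cong) (auto simp: act_one)
    also have "\<dots> = (\<integral>z. u z * v \<one> z \<partial>Z)" by (rule \<Psi>_act) simp
    also have "\<dots> = r" unfolding r_def v_def u_def
      by (intro Bochner_Integration.integral_cong refl arg_cong2[where f = times]) (auto simp: act_one)
    finally show ?thesis .
  qed
  have norm: "(\<integral>z. v g z * v g z \<partial>Z) = r" if g [measurable]: "g \<in> carrier G" for g
  proof -
    have "(\<integral>z. v g z * v g z \<partial>Z) = (\<integral>z. u (c g z) * u (c g z) \<partial>Z)"
      using v_eq[OF g] by (intro integral_cong_AE) auto
    also have "\<dots> = (\<integral>z. u z * u z \<partial>distr Z Z (c g))" by (subst integral_distr) auto
    finally show ?thesis by (simp add: c(2)[OF g] r_def)
  qed
  have square: "(\<integral>z. (v g z - u z) * (v g z - u z) \<partial>Z) = 2 * (r - (\<integral>z. u z * v g z \<partial>Z))"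
    if g [measurable]: "g \<in> carrier G" for g
  proof -
    have "(\<integral>z. (v g z - u z) * (v g z - u z) \<partial>Z) = (\<integral>z. v g z * v g z + u z * u z - 2 * (u z * v g z) \<partial>Z)"
      by (simp add: algebra_simps)
    also have "\<dots> = (\<integral>z. v g z * v g z \<partial>Z) + (\<integral>z. u z * u z \<partial>Z) - 2 * (\<integral>z. u z * v g z \<partial>Z)"
    proof -
      have "integrable Z (\<lambda>z. p z * q z)"
        if [measurable]: "p \<in> borel_measurable Z" "q \<in> borel_measurable Z" and "\<And>z. \<bar>p z\<bar> \<le> 1" "\<And>z. \<bar>q z\<bar> \<le> 1"
        for p q :: "'z \<Rightarrow> real"
        by (rule Z.integrable_bounded[where C = 1], measurable) (rule mult_bound[OF that(3,4)])
      note this[OF v[OF g] v[OF g] v_bound v_bound] this[OF u u u_bound u_bound] this[OF u v[OF g] u_bound v_bound]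
      then show ?thesis by simp
    qed
    finally show ?thesis using norm[OF g] by (simp add: r_def)
  qed
  have sc: "s \<in> carrier G" using s by (rule set_pmf_carrier)
  \<comment> \<open>Since v g and u have equal norms, \<open>square\<close> shows that each inner
    product is at most r. Their average is r, so no s of positive weight leaves a deficit, and v s =
    u almost everywhere.\<close>
  have "pmf \<mu> s * (r - (\<integral>z. u z * v s z \<partial>Z)) \<le> r - r"
  proof (rule deviation_from_average[OF _ _ sc])
    have "((\<lambda>g. (\<integral>x. \<Psi> (a g x) \<partial>M) * pmf \<mu> g) has_sum (\<integral>x. \<Psi> x \<partial>M)) (carrier G)"
      by (rule stationary_has_sum[OF \<Psi>]) (rule \<Psi>_bound)
    then show "((\<lambda>g. (\<integral>z. u z * v g z \<partial>Z) * pmf \<mu> g) has_sum r) (carrier G)"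
      unfolding \<Psi>_int by (rule has_sum_cong[THEN iffD1, rotated]) (simp add: \<Psi>_act)
    show "(\<integral>z. u z * v g z \<partial>Z) \<le> r" if "g \<in> carrier G" for g
      using square[OF that] Bochner_Integration.integral_nonneg[of Z "\<lambda>z. (v g z - u z) * (v g z - u z)"] by simp
  qed
  moreover have "pmf \<mu> s > 0" using s by (simp add: pmf_positive)
  ultimately have "r - (\<integral>z. u z * v s z \<partial>Z) \<le> 0" by (simp add: mult_le_0_iff)
  then have "(\<integral>z. (v s z - u z) * (v s z - u z) \<partial>Z) \<le> 0" using square[OF sc] by simp
  then have "(\<integral>z. (v s z - u z) * (v s z - u z) \<partial>Z) = 0"
    by (intro antisym Bochner_Integration.integral_nonneg) auto
  moreover have "integrable Z (\<lambda>z. (v s z - u z) * (v s z - u z))"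
  proof (rule Z.integrable_bounded[where C = 4])
    show "\<bar>(v s z - u z) * (v s z - u z)\<bar> \<le> 4" for z
    proof -
      have "\<bar>v s z - u z\<bar> \<le> 2" using v_bound[of s z] u_bound[of z] by linarith
      then have "\<bar>v s z - u z\<bar> * \<bar>v s z - u z\<bar> \<le> 2 * 2" by (intro mult_mono) auto
      then show ?thesis by (simp add: abs_mult)
    qed
  qed (use sc in measurable)
  ultimately have "AE z in Z. (v s z - u z) * (v s z - u z) = 0"
    by (subst (asm) integral_nonneg_eq_0_iff_AE) auto
  then have "AE z in Z. u (c s z) = u z"
    using v_eq[OF sc] by eventually_elim auto
  then show ?thesis by (simp add: u_def)
qed

text \<open>\<open>c\<close> is a right action because it arises from the inverses of an action on
  \<open>Y\<close>. Invariance spreads from the support along the generated semigroup; preservation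
  of the measure moves the exceptional null sets.\<close>

lemma average_invariant_group:
  fixes F :: "'x \<times> 'z \<Rightarrow> real"
  assumes Z: "prob_space Z" and F: "F \<in> borel_measurable (M \<Otimes>\<^sub>M Z)" and bound: "\<And>p. \<bar>F p\<bar> \<le> 1"
    and c: "\<And>g. g \<in> carrier G \<Longrightarrow> c g \<in> measurable Z Z" "\<And>g. g \<in> carrier G \<Longrightarrow> distr Z Z (c g) = Z"
    and inv: "\<And>g. g \<in> carrier G \<Longrightarrow> AE x in M. AE z in Z. F (a g x, z) = F (x, c g z)"
    and c_mult: "\<And>g h z. \<lbrakk>g \<in> carrier G; h \<in> carrier G; z \<in> space Z\<rbrakk> \<Longrightarrow> c (g \<otimes> h) z = c h (c g z)"
    and g: "g \<in> carrier G"
  shows "AE z in Z. (\<integral>x. F (x, c g z) \<partial>M) = (\<integral>x. F (x, z) \<partial>M)"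
proof -
  have "g \<in> generated_semigroup G (set_pmf \<mu>)" using g generated by simp
  then show ?thesis
  proof induction
    case (generator s)
    show ?case by (rule average_invariant[OF Z F bound c inv generator])
  next
    case (mult s t)
    have st: "s \<in> carrier G" "t \<in> carrier G" using mult(1,2) generated by auto
    have "AE z in distr Z Z (c s). (\<integral>x. F (x, c t z) \<partial>M) = (\<integral>x. F (x, z) \<partial>M)"
      unfolding c(2)[OF st(1)] by (rule mult.IH(2))
    then have "AE z in Z. (\<integral>x. F (x, c t (c s z)) \<partial>M) = (\<integral>x. F (x, c s z) \<partial>M)"
      by (rule AE_distrD[OF c(1)[OF st(1)]])
    with mult.IH(1) AE_space show ?case
      by eventually_elim (simp add: c_mult[OF st])
  qed
qed

end

section \<open>The invariant pseudometric of a non-ergodic product\<close>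

locale nonergodic_product =
  X: stationary_action G \<mu> a X + Y: measured_action G b Y
  for G (structure) and \<mu> :: "'a pmf" and a :: "'a \<Rightarrow> 'x \<Rightarrow> 'x" and X :: "'x measure"
    and b :: "'a \<Rightarrow> 'y \<Rightarrow> 'y" and Y :: "'y measure" +
  fixes B :: "('x \<times> 'y) set"
  assumes preserving: "\<And>g. g \<in> carrier G \<Longrightarrow> distr Y Y (b g) = Y"
    and ergodic_X: "ergodic G a X" and ergodic_Y: "ergodic G b Y"
    and B [measurable]: "B \<in> sets (X \<Otimes>\<^sub>M Y)"
    and B_measure: "0 < measure (X \<Otimes>\<^sub>M Y) B" "measure (X \<Otimes>\<^sub>M Y) B < 1"
    and B_invariant: "\<And>g. g \<in> carrier G \<Longrightarrow> AE x in X. AE y in Y. (a g x, b g y) \<in> B \<longleftrightarrow> (x, y) \<in> B"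
begin

section \<open>The centred indicator and its correlation kernel on pairs from
  \<open>Y\<close>\<close>

sublocale XY: pair_prob_space X Y ..

sublocale YY: pair_prob_space Y Y ..

abbreviation Y\<^sub>2 :: "('y \<times> 'y) measure" where "Y\<^sub>2 \<equiv> Y \<Otimes>\<^sub>M Y"

declare X.act_measurable [measurable] Y.act_measurable [measurable]

definition f :: "'x \<times> 'y \<Rightarrow> real" where
  "f p = indicator B p - measure (X \<Otimes>\<^sub>M Y) B"

lemma f_measurable [measurable]: "f \<in> borel_measurable (X \<Otimes>\<^sub>M Y)"
  unfolding f_def by measurable

lemma f_bound: "\<bar>f p\<bar> \<le> 1"
  using B_measure by (auto simp: f_def indicator_def)

lemma f_invariant: "g \<in> carrier G \<Longrightarrow> AE x in X. AE y in Y. f (a g x, b g y) = f (x, y)"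
proof -
  assume "g \<in> carrier G"
  from B_invariant[OF this] show ?thesis
  proof eventually_elim
    case (elim x)
    then show ?case by eventually_elim (simp add: f_def indicator_def)
  qed
qed

lemma f_invariant': "g \<in> carrier G \<Longrightarrow> AE x in X. AE y in Y. f (a g x, y) = f (x, b (inv g) y)"
proof -
  assume g: "g \<in> carrier G"
  show ?thesis using f_invariant[OF g]
  proof eventually_elim
    case (elim x)
    have "AE y in Y. f (a g x, b g (b (inv g) y)) = f (x, b (inv g) y)"
      by (rule Y.AE_act[OF _ elim]) (use g in simp)
    with AE_space show ?case by eventually_elim (use g in simp)
  qed
qed

text \<open>The averaging argument makes the mean over \<open>X\<close> an invariant function on
  \<open>Y\<close>; ergodicity of \<open>Y\<close> makes it constant, and the centring of f makes
  the constant 0.\<close>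

lemma f_integral_zero: "AE y in Y. (\<integral>x. f (x, y) \<partial>X) = 0"
proof -
  define u where "u y = (\<integral>x. f (x, y) \<partial>X)" for y
  have u [measurable]: "u \<in> borel_measurable Y" unfolding u_def by measurable
  have inv: "AE y in Y. u (b (inv g) y) = u y" if g: "g \<in> carrier G" for g
    unfolding u_def
    by (rule X.average_invariant_group[where c = "\<lambda>g. b (inv g)"])
      (use g f_bound f_invariant' preserving in
        \<open>auto simp: Y.prob_space_axioms X.inv_mult_group Y.act_mult\<close>)
  have "AE y in Y. u y = (\<integral>y. u y \<partial>Y)"
  proof (rule Y.ergodic_AE_const[OF ergodic_Y u, where C = 1])
    show "\<bar>u y\<bar> \<le> 1" for y unfolding u_def by (rule X.abs_integral_le) (rule f_bound)
    show "AE y in Y. u (b g y) = u y" if "g \<in> carrier G" for g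
      using inv[of "inv g"] that by simp
  qed
  moreover have "(\<integral>y. u y \<partial>Y) = (\<integral>p. f p \<partial>(X \<Otimes>\<^sub>M Y))"
    using fubini_bounded(2,3)[OF X.prob_space_axioms Y.prob_space_axioms f_measurable f_bound] by (simp add: u_def)
  moreover have "(\<integral>p. f p \<partial>(X \<Otimes>\<^sub>M Y)) = 0"
    unfolding f_def
    by (subst Bochner_Integration.integral_diff)
      (auto simp: XY.prob_space XY.emeasure_eq_measure intro!: integrable_real_indicator)
  ultimately show ?thesis by (simp add: u_def)
qed

definition t :: "'y \<times> 'y \<Rightarrow> real" where
  "t p = (\<integral>x. f (x, fst p) * f (x, snd p) \<partial>X)"

lemma t_measurable [measurable]: "t \<in> borel_measurable Y\<^sub>2"
  unfolding t_def by measurable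

lemma pair_preserving:
  assumes [measurable]: "g \<in> carrier G"
  shows "distr Y\<^sub>2 Y\<^sub>2 (\<lambda>p. (b g (fst p), b g (snd p))) = Y\<^sub>2"
proof -
  have "distr Y Y (b g) \<Otimes>\<^sub>M distr Y Y (b g) = distr Y\<^sub>2 Y\<^sub>2 (\<lambda>(x, y). (b g x, b g y))"
    by (rule pair_measure_distr) (auto simp: preserving[OF assms] Y.sigma_finite_measure_axioms)
  then show ?thesis using assms by (simp add: preserving case_prod_beta')
qed

lemma t_invariant:
  assumes g: "g \<in> carrier G"
  shows "AE p in Y\<^sub>2. t (b g (fst p), b g (snd p)) = t p"
proof -
  define F where "F q = f (fst q, fst (snd q)) * f (fst q, snd (snd q))" for q :: "'x \<times> 'y \<times> 'y"
  have [measurable]: "F \<in> borel_measurable (X \<Otimes>\<^sub>M Y\<^sub>2)" unfolding F_def by measurable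
  \<comment> \<open>The averaging lemma produces translations by inverses, so it is applied to the
    inverse of g.\<close>
  have "AE p in Y\<^sub>2. (\<integral>x. F (x, (b (inv (inv g)) (fst p), b (inv (inv g)) (snd p))) \<partial>X) = (\<integral>x. F (x, p) \<partial>X)"
  proof (rule X.average_invariant_group[where c = "\<lambda>g p. (b (inv g) (fst p), b (inv g) (snd p))"])
    show "prob_space Y\<^sub>2" by (rule YY.prob_space_axioms)
    show "\<bar>F p\<bar> \<le> 1" for p unfolding F_def by (intro mult_bound f_bound)
    fix g assume g [measurable]: "g \<in> carrier G"
    have [measurable]: "inv g \<in> carrier G" using g by simp
    show "(\<lambda>p. (b (inv g) (fst p), b (inv g) (snd p))) \<in> measurable Y\<^sub>2 Y\<^sub>2" by measurable
    show "distr Y\<^sub>2 Y\<^sub>2 (\<lambda>p. (b (inv g) (fst p), b (inv g) (snd p))) = Y\<^sub>2"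
      using g by (intro pair_preserving) simp
    show "AE x in X. AE p in Y\<^sub>2. F (a g x, p) = F (x, (b (inv g) (fst p), b (inv g) (snd p)))"
      using f_invariant'[OF g]
    proof eventually_elim
      case (elim x)
      show ?case using AE_pair_fst_snd[OF Y.prob_space_axioms elim] by eventually_elim (simp add: F_def)
    qed
    fix h p assume "h \<in> carrier G" "p \<in> space Y\<^sub>2"
    then show "(b (inv (g \<otimes> h)) (fst p), b (inv (g \<otimes> h)) (snd p)) =
        (b (inv h) (fst (b (inv g) (fst p), b (inv g) (snd p))), b (inv h) (snd (b (inv g) (fst p), b (inv g) (snd p))))"
      using g by (auto simp: X.inv_mult_group Y.act_mult space_pair_measure)
  qed (use g in auto)
  then show ?thesis using g by (simp add: F_def t_def)
qed

section \<open>The invariant kernel on pairs from \<open>X\<close>\<close>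

definition k :: "'x \<Rightarrow> 'x \<Rightarrow> real" where
  "k x z = (\<integral>y. f (x, y) * f (z, y) \<partial>Y)"

text \<open>\<open>k\<close> is the Gram kernel of the slices f(x, .) over \<open>Y\<close>, and
  \<open>q\<close> is the Gram kernel of the slices of \<open>k\<close>. Vanishing of
  \<open>q\<close> can thus be traced back to \<open>k\<close>, and then to \<open>f\<close>, by two
  uses of \<open>gram_zero\<close>.\<close>

definition q :: "'x \<Rightarrow> 'x \<Rightarrow> real" where
  "q x x' = (\<integral>z. k x z * k x' z \<partial>X)"

lemma k_measurable [measurable]: "(\<lambda>p. k (fst p) (snd p)) \<in> borel_measurable (X \<Otimes>\<^sub>M X)"
  unfolding k_def by measurable

lemma k_section_measurable [measurable]:
  "x \<in> space X \<Longrightarrow> k x \<in> borel_measurable X" "x \<in> space X \<Longrightarrow> (\<lambda>z. k z x) \<in> borel_measurable X"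
  unfolding k_def by measurable

lemma k_bound: "\<bar>k x z\<bar> \<le> 1"
  unfolding k_def by (rule Y.abs_integral_le) (intro mult_bound f_bound)

lemma q_bound: "\<bar>q x x'\<bar> \<le> 1"
  unfolding q_def by (rule X.abs_integral_le) (intro mult_bound k_bound)

lemma q_measurable [measurable]:
  "(\<lambda>p. q (fst p) (snd p)) \<in> borel_measurable (X \<Otimes>\<^sub>M X)"
proof -
  have "(\<lambda>p. \<integral>z. (\<integral>y. f (fst p, y) * f (z, y) \<partial>Y) * (\<integral>y. f (snd p, y) * f (z, y) \<partial>Y) \<partial>X) \<in> borel_measurable (X \<Otimes>\<^sub>M X)"
    by measurable
  then show ?thesis by (simp add: q_def k_def)
qed

lemma q_section_measurable:
  assumes [measurable]: "x' \<in> space X"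
  shows "(\<lambda>x. q x x') \<in> borel_measurable X"
proof -
  have "(\<lambda>x. (\<lambda>p. q (fst p) (snd p)) (x, x')) \<in> borel_measurable X" by measurable
  then show ?thesis by simp
qed

lemma q_sym: "q x x' = q x' x"
  by (simp add: q_def mult.commute)

text \<open>Through \<^term>\<open>t\<close>, the kernel \<^term>\<open>q\<close> only depends on the action on \<^term>\<open>Y\<close>, which
  preserves the measure.\<close>

lemma q_eq:
  assumes [measurable]: "x \<in> space X" "x' \<in> space X"
  shows "q x x' = (\<integral>p. f (x, fst p) * f (x', snd p) * t p \<partial>Y\<^sub>2)"
proof -
  have kk: "k x z * k x' z = (\<integral>p. f (x, fst p) * f (x', snd p) * (f (z, fst p) * f (z, snd p)) \<partial>Y\<^sub>2)"
    if [measurable]: "z \<in> space X" for z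
  proof -
    have "(\<integral>p. f (x, fst p) * f (x', snd p) * (f (z, fst p) * f (z, snd p)) \<partial>Y\<^sub>2) =
        (\<integral>y. \<integral>y'. f (x, y) * f (x', y') * (f (z, y) * f (z, y')) \<partial>Y \<partial>Y)"
      using fubini_bounded(2)[OF Y.prob_space_axioms Y.prob_space_axioms,
          of "\<lambda>p. f (x, fst p) * f (x', snd p) * (f (z, fst p) * f (z, snd p))" 1]
        mult_bound[OF mult_bound[OF f_bound f_bound] mult_bound[OF f_bound f_bound]] by simp
    also have "\<dots> = (\<integral>y. \<integral>y'. (f (x, y) * f (z, y)) * (f (x', y') * f (z, y')) \<partial>Y \<partial>Y)"
      by (simp add: mult_ac)
    also have "\<dots> = k x z * k x' z" by (simp add: k_def)
    finally show ?thesis by simp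
  qed
  have "q x x' = (\<integral>z. \<integral>p. f (x, fst p) * f (x', snd p) * (f (z, fst p) * f (z, snd p)) \<partial>Y\<^sub>2 \<partial>X)"
    unfolding q_def by (intro Bochner_Integration.integral_cong refl kk)
  also have "\<dots> = (\<integral>p. \<integral>z. f (x, fst p) * f (x', snd p) * (f (z, fst p) * f (z, snd p)) \<partial>X \<partial>Y\<^sub>2)"
    using fubini_bounded(3)[OF X.prob_space_axioms YY.prob_space_axioms,
        of "\<lambda>w. f (x, fst (snd w)) * f (x', snd (snd w)) * (f (fst w, fst (snd w)) * f (fst w, snd (snd w)))" 1]
      mult_bound[OF mult_bound[OF f_bound f_bound] mult_bound[OF f_bound f_bound]] by simp
  finally show ?thesis by (simp add: t_def)
qed

text \<open>Countability of the group allows one conull set for all g. On it \<open>q\<close> and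
  \<open>d w\<close> are invariant at every point, not merely almost everywhere.\<close>

definition S :: "'x set" where
  "S = {x\<in>space X. \<forall>g\<in>carrier G. AE y in Y. f (a g x, b g y) = f (x, y)}"

lemma S_space: "x \<in> S \<Longrightarrow> x \<in> space X"
  by (simp add: S_def)

lemma S_sets: "S \<in> sets X"
proof -
  have [measurable]: "countable (carrier G)" by (rule X.countable_carrier)
  have "{x\<in>space X. AE y in Y. f (a g x, b g y) = f (x, y)} \<in> sets X" if [measurable]: "g \<in> carrier G" for g
  proof -
    \<comment> \<open>Almost sure equality of two slices is the vanishing of an integral that
      depends measurably on x.\<close>
    have "{x\<in>space X. AE y in Y. f (a g x, b g y) = f (x, y)} =
        {x\<in>space X. (\<integral>y. \<bar>f (a g x, b g y) - f (x, y)\<bar> \<partial>Y) = 0}"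
    proof (intro Collect_cong conj_cong refl)
      fix x assume [measurable]: "x \<in> space X"
      have "\<bar>f (a g x, b g y) - f (x, y)\<bar> \<le> 2" for y
        using f_bound[of "(a g x, b g y)"] f_bound[of "(x, y)"] by linarith
      then have "integrable Y (\<lambda>y. \<bar>f (a g x, b g y) - f (x, y)\<bar>)"
        by (intro Y.integrable_bounded[where C = 2]) auto
      then show "(AE y in Y. f (a g x, b g y) = f (x, y)) \<longleftrightarrow> (\<integral>y. \<bar>f (a g x, b g y) - f (x, y)\<bar> \<partial>Y) = 0"
        by (subst integral_nonneg_eq_0_iff_AE) auto
    qed
    also have "\<dots> \<in> sets X" by measurable
    finally show ?thesis .
  qed
  then have "{x\<in>space X. \<forall>g\<in>carrier G. AE y in Y. f (a g x, b g y) = f (x, y)} \<in> sets X"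
    by (intro sets.sets_Collect_countable_All' X.countable_carrier)
  then show ?thesis by (simp add: S_def)
qed

lemma S_AE: "AE x in X. x \<in> S"
proof -
  have "AE x in X. \<forall>g\<in>carrier G. AE y in Y. f (a g x, b g y) = f (x, y)"
    using f_invariant by (subst AE_ball_countable[OF X.countable_carrier]) auto
  with AE_space show ?thesis by eventually_elim (auto simp: S_def)
qed

lemma S_act:
  assumes h: "h \<in> carrier G" and x: "x \<in> S"
  shows "a h x \<in> S"
  unfolding S_def mem_Collect_eq
proof (intro conjI ballI)
  have xX: "x \<in> space X" using x by (rule S_space)
  then show "a h x \<in> space X" using h by (rule X.act_space[rotated])
  fix g assume g: "g \<in> carrier G"
  have gh: "AE y in Y. f (a (g \<otimes> h) x, b (g \<otimes> h) y) = f (x, y)" "AE y in Y. f (a h x, b h y) = f (x, y)"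
    using x g h by (auto simp: S_def)
  \<comment> \<open>Both identities are evaluated at the preimage of y under h, where each compares
    with the same value of the slice at x.\<close>
  from AE_space Y.AE_act[OF X.inv_closed[OF h] gh(1)] Y.AE_act[OF X.inv_closed[OF h] gh(2)]
  show "AE y in Y. f (a g (a h x), b g y) = f (a h x, y)"
  proof eventually_elim
    case (elim y)
    have "b (inv h) y \<in> space Y" using elim h by (simp add: Y.act_space)
    then show ?case using elim g h xX by (simp add: X.act_mult Y.act_mult)
  qed
qed

lemma q_invariant:
  assumes g [measurable]: "g \<in> carrier G" and x: "x \<in> S" and x': "x' \<in> S"
  shows "q (a g x) (a g x') = q x x'"
proof -
  have [measurable]: "x \<in> space X" "x' \<in> space X" using x x' S_space by auto
  have [measurable]: "a g x \<in> space X" "a g x' \<in> space X" using x x' g S_space X.act_space by auto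
  let ?h = "\<lambda>p. f (a g x, fst p) * f (a g x', snd p) * t p"
  have "q (a g x) (a g x') = (\<integral>p. ?h p \<partial>distr Y\<^sub>2 Y\<^sub>2 (\<lambda>p. (b g (fst p), b g (snd p))))"
    unfolding pair_preserving[OF g] by (rule q_eq) measurable
  also have "\<dots> = (\<integral>p. ?h (b g (fst p), b g (snd p)) \<partial>Y\<^sub>2)"
    by (rule integral_distr) measurable
  also have "\<dots> = (\<integral>p. f (x, fst p) * f (x', snd p) * t p \<partial>Y\<^sub>2)"
  proof (rule integral_cong_AE)
    have "AE y in Y. f (a g x, b g y) = f (x, y) \<and> f (a g x', b g y) = f (x', y)"
      using x x' g by (auto simp: S_def)
    from AE_pair_fst_snd[OF Y.prob_space_axioms this] t_invariant[OF g]
    show "AE p in Y\<^sub>2. ?h (b g (fst p), b g (snd p)) = f (x, fst p) * f (x', snd p) * t p"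
      by eventually_elim simp
  qed measurable
  also have "\<dots> = q x x'" by (rule q_eq[symmetric]) measurable
  finally show ?thesis .
qed

text \<open>An L2 distance between the slices of \<open>q\<close> would not be invariant, since the
  measure on \<open>X\<close> is not. A supremum over the orbit of w is, and being countable it
  stays measurable.\<close>

definition d :: "'x \<Rightarrow> 'x \<Rightarrow> 'x \<Rightarrow> real" where
  "d w x x' = (SUP g\<in>carrier G. \<bar>q x (a g w) - q x' (a g w)\<bar>)"

lemma q_diff_le: "\<bar>q x w - q x' w'\<bar> \<le> 2"
  using q_bound[of x w] q_bound[of x' w'] by linarith

lemma d_upper: "g \<in> carrier G \<Longrightarrow> \<bar>q x (a g w) - q x' (a g w)\<bar> \<le> d w x x'"
  unfolding d_def by (rule cSUP_upper) (auto intro!: bdd_aboveI[of _ 2] q_diff_le)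

lemma d_least: "(\<And>g. g \<in> carrier G \<Longrightarrow> \<bar>q x (a g w) - q x' (a g w)\<bar> \<le> r) \<Longrightarrow> d w x x' \<le> r"
  unfolding d_def by (rule cSUP_least) (use X.one_closed in auto)

lemma d_le: "d w x x' \<le> 2"
  by (rule d_least) (rule q_diff_le)

lemma d_nonneg: "0 \<le> d w x x'"
  using d_upper[OF X.one_closed, of x w x'] by linarith

lemma d_self: "d w x x = 0"
  using d_nonneg[of w x x] d_least[of x w x 0] by simp

lemma d_sym: "d w x x' = d w x' x"
  unfolding d_def by (simp add: abs_minus_commute)

lemma d_triangle: "d w x z \<le> d w x y + d w y z"
proof (rule d_least)
  fix g assume "g \<in> carrier G"
  then show "\<bar>q x (a g w) - q z (a g w)\<bar> \<le> d w x y + d w y z"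
    using d_upper[of g x w y] d_upper[of g y w z] by linarith
qed

lemma d_measurable:
  assumes "w \<in> space X" "x \<in> space X"
  shows "d w x \<in> borel_measurable X"
  unfolding d_def
proof (rule borel_measurable_cSUP[OF X.countable_carrier])
  fix g assume "g \<in> carrier G"
  then have "(\<lambda>x'. q x' (a g w)) \<in> borel_measurable X"
    using assms by (intro q_section_measurable X.act_space)
  then show "(\<lambda>x'. \<bar>q x (a g w) - q x' (a g w)\<bar>) \<in> borel_measurable X" by measurable
qed (auto intro!: bdd_aboveI[of _ 2] q_diff_le)

lemma d_invariant:
  assumes g: "g \<in> carrier G" and w: "w \<in> S" and x: "x \<in> S" and x': "x' \<in> S"
  shows "d w (a g x) (a g x') = d w x x'"
proof -
  have le: "d w (a g x) (a g x') \<le> d w x x'" if g: "g \<in> carrier G" and x: "x \<in> S" and x': "x' \<in> S" for g x x'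
  proof (rule d_least)
    fix h assume h: "h \<in> carrier G"
    have "a h w = a g (a (inv g \<otimes> h) w)"
      using g h w by (simp add: S_space X.act_space X.act_mult)
    then have "q (a g z) (a h w) = q z (a (inv g \<otimes> h) w)" if "z \<in> S" for z
      using q_invariant[OF g that S_act[of "inv g \<otimes> h" w]] g h w by simp
    then show "\<bar>q (a g x) (a h w) - q (a g x') (a h w)\<bar> \<le> d w x x'"
      using d_upper[of "inv g \<otimes> h" x w x'] g h x x' by simp
  qed
  show ?thesis
    using le[OF g x x'] le[of "inv g" "a g x" "a g x'"] g x x' S_act by (simp add: S_space)
qed

text \<open>As \<open>k\<close> is bounded by 1, the difference of \<open>q\<close> at any translate
  of w is at most the L1 norm of k(x, .) - k(x', .), uniformly in g. This is the image of f(x, .) -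
  f(x', .) under the operator with kernel f, and f is the indicator of \<open>B\<close> minus a
  multiple of that of the whole product, so \<open>kernel_totally_bounded\<close> covers both
  pieces.\<close>

lemma d_totally_bounded:
  assumes w: "w \<in> S"
  shows "totally_bounded_on S (d w)"
proof -
  let ?e = "\<lambda>E x x'. \<integral>z. \<bar>\<integral>y. indicator E (z, y) * (f (x, y) - f (x', y)) \<partial>Y\<bar> \<partial>X"
  have f_diff: "\<bar>f (x, y) - f (x', y)\<bar> \<le> 2" for x x' y
    using f_bound[of "(x, y)"] f_bound[of "(x', y)"] by linarith
  have ind: "\<bar>indicator E (z, y) * (f (x, y) - f (x', y))\<bar> \<le> 2" for E x x' y z
    using f_diff[of x y x'] by (auto simp: indicator_def)
  have tb: "totally_bounded_on S (?e E)" if "E \<in> sets (X \<Otimes>\<^sub>M Y)" for E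
    by (rule kernel_totally_bounded[OF X.prob_space_axioms Y.prob_space_axioms that])
      (use S_space f_bound in auto)
  have le: "d w x x' \<le> ?e B x x' + ?e (space X \<times> space Y) x x'" if x: "x \<in> S" and x': "x' \<in> S" for x x'
  proof (rule d_least)
    fix g assume g: "g \<in> carrier G"
    let ?s = "\<lambda>E z. \<integral>y. indicator E (z, y) * (f (x, y) - f (x', y)) \<partial>Y"
    note [measurable] = S_space[OF x] S_space[OF x']
    have slice: "\<bar>?s E z\<bar> \<le> 2" for E z
      by (rule Y.abs_integral_le) (rule ind)
    have int: "integrable X (\<lambda>z. \<bar>?s E z\<bar>)"
      if [measurable]: "E \<in> sets (X \<Otimes>\<^sub>M Y)" for E
      by (rule X.integrable_bounded[where C = 2]) (auto simp: slice)
    have kint: "integrable X (\<lambda>z. k x z * k v z)" if "x \<in> space X" "v \<in> space X" for x v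
      using that by (intro X.integrable_bounded[where C = 1] mult_bound k_bound) measurable
    show "\<bar>q x (a g w) - q x' (a g w)\<bar> \<le> ?e B x x' + ?e (space X \<times> space Y) x x'"
    proof -
      have [measurable]: "a g w \<in> space X" using g S_space[OF w] by (rule X.act_space)
      have "q x (a g w) - q x' (a g w) = (\<integral>z. (k x z - k x' z) * k (a g w) z \<partial>X)"
        unfolding q_def left_diff_distrib by (rule Bochner_Integration.integral_diff[symmetric]; rule kint) measurable
      then have "\<bar>q x (a g w) - q x' (a g w)\<bar> \<le> (\<integral>z. \<bar>(k x z - k x' z) * k (a g w) z\<bar> \<partial>X)"
        by simp
      also have "\<dots> \<le> (\<integral>z. \<bar>?s B z\<bar> +
          \<bar>?s (space X \<times> space Y) z\<bar> \<partial>X)"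
      proof (rule integral_mono)
        have "\<bar>(k x z - k x' z) * k (a g w) z\<bar> \<le> 2" for z
        proof -
          have "\<bar>k x z - k x' z\<bar> \<le> 2" using k_bound[of x z] k_bound[of x' z] by linarith
          then have "\<bar>k x z - k x' z\<bar> * \<bar>k (a g w) z\<bar> \<le> 2 * 1" using k_bound by (intro mult_mono) auto
          then show ?thesis by (simp add: abs_mult)
        qed
        then show "integrable X (\<lambda>z. \<bar>(k x z - k x' z) * k (a g w) z\<bar>)"
          by (intro X.integrable_bounded[where C = 2]) auto
        show "integrable X (\<lambda>z. \<bar>?s B z\<bar> +
            \<bar>?s (space X \<times> space Y) z\<bar>)"
          by (intro Bochner_Integration.integrable_add int) measurable
        fix z assume z [measurable]: "z \<in> space X"
        have fint: "integrable Y (\<lambda>y. f (x, y) * f (z, y))" if "x \<in> space X" for x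
          using that z by (intro Y.integrable_bounded[where C = 1] mult_bound f_bound) measurable
        have eint: "integrable Y (\<lambda>y. indicator E (z, y) * (f (x, y) - f (x', y)))"
          if [measurable]: "E \<in> sets (X \<Otimes>\<^sub>M Y)" for E
          by (rule Y.integrable_bounded[where C = 2]) (auto simp: ind)
        let ?m = "measure (X \<Otimes>\<^sub>M Y) B"
        have "k x z - k x' z = (\<integral>y. f (x, y) * f (z, y) - f (x', y) * f (z, y) \<partial>Y)"
          unfolding k_def by (rule Bochner_Integration.integral_diff[symmetric]; rule fint) measurable
        also have "\<dots> = (\<integral>y. indicator B (z, y) * (f (x, y) - f (x', y)) -
            ?m * (indicator (space X \<times> space Y) (z, y) * (f (x, y) - f (x', y))) \<partial>Y)"
          using z by (intro Bochner_Integration.integral_cong refl) (simp add: f_def[of "(z, _)"] algebra_simps)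
        also have "\<dots> = (?s B z) -
            ?m * (?s (space X \<times> space Y) z)"
          by (subst Bochner_Integration.integral_diff) (auto intro!: eint)
        finally have eq: "k x z - k x' z = \<dots>" .
        have "\<bar>(k x z - k x' z) * k (a g w) z\<bar> \<le> \<bar>k x z - k x' z\<bar> * 1"
          unfolding abs_mult by (intro mult_left_mono k_bound) auto
        also have "\<dots> \<le> \<bar>?s B z\<bar> +
            \<bar>?m * (?s (space X \<times> space Y) z)\<bar>"
          unfolding eq mult_1_right by (rule abs_triangle_ineq4)
        also have "\<bar>?m * (?s (space X \<times> space Y) z)\<bar> \<le>
            1 * \<bar>?s (space X \<times> space Y) z\<bar>"
          unfolding abs_mult using B_measure by (intro mult_right_mono) auto
        finally show "\<bar>(k x z - k x' z) * k (a g w) z\<bar> \<le> \<bar>?s B z\<bar> +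
            \<bar>?s (space X \<times> space Y) z\<bar>"
          by simp
      qed
      also have "\<dots> = ?e B x x' + ?e (space X \<times> space Y) x x'"
        by (intro Bochner_Integration.integral_add int) measurable
      finally show ?thesis .
    qed
  qed
  have "totally_bounded_on S (\<lambda>x x'. ?e B x x' + ?e (space X \<times> space Y) x x')"
    by (intro totally_bounded_on_add tb) auto
  then show ?thesis using le by (rule totally_bounded_on_mono)
qed

text \<open>Otherwise, for each w in \<open>S\<close>, q(., w) is almost surely constant and equals
  its mean, which is 0 because f has mean 0 over \<open>X\<close>. Two applications of
  \<open>gram_zero\<close> make \<open>k\<close> and then \<open>f\<close> vanish almost everywhere,
  while f takes only the values 1 - c and -c, with c strictly between 0 and 1.\<close>

lemma exists_nontrivial:
  obtains w where "w \<in> S" "\<And>x. x \<in> S \<Longrightarrow> \<not> (AE y in X. d w x y = 0)"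
proof -
  have "\<exists>w\<in>S. \<forall>x\<in>S. \<not> (AE y in X. d w x y = 0)"
  proof (rule ccontr)
    assume neg: "\<not> ?thesis"
    have "AE y in X. q w y = 0" if w: "w \<in> S" for w
    proof -
      obtain x where x: "x \<in> S" "AE y in X. d w x y = 0" using neg w by blast
      have const: "AE y in X. q y w = q x w"
        using x(2)
      proof eventually_elim
        case (elim y)
        then show ?case using d_upper[OF X.one_closed, of x w y] X.act_one[OF S_space[OF w]] by simp
      qed
      note [measurable] = S_space[OF w] q_section_measurable
      have "q x w = (\<integral>y. q y w \<partial>X)"
      proof -
        have "(\<integral>y. q y w \<partial>X) = (\<integral>y. q x w \<partial>X)" using const by (intro integral_cong_AE) auto
        then show ?thesis by (simp add: X.prob_space)
      qed
      also have "\<dots> = (\<integral>z. \<integral>y. k y z * k w z \<partial>X \<partial>X)"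
        unfolding q_def
        using fubini_bounded(3)[OF X.prob_space_axioms X.prob_space_axioms, of "\<lambda>p. k (fst p) (snd p) * k w (snd p)" 1]
          mult_bound[OF k_bound k_bound] by simp
      also have "\<dots> = (\<integral>z. 0 \<partial>X)"
      proof (intro Bochner_Integration.integral_cong refl)
        fix z assume [measurable]: "z \<in> space X"
        have "(\<integral>y. k y z \<partial>X) = (\<integral>y. \<integral>x. f (x, y) * f (z, y) \<partial>X \<partial>Y)"
          unfolding k_def
          using fubini_bounded(3)[OF X.prob_space_axioms Y.prob_space_axioms, of "\<lambda>p. f p * f (z, snd p)" 1]
            mult_bound[OF f_bound f_bound] by simp
        also have "\<dots> = 0"
          by (rule integral_eq_zero_AE) (use f_integral_zero in \<open>auto elim: eventually_mono\<close>)
        finally show "(\<integral>y. k y z * k w z \<partial>X) = 0" by simp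
      qed
      finally have "q x w = 0" by simp
      from const show ?thesis by eventually_elim (use \<open>q x w = 0\<close> q_sym in simp)
    qed
    with S_AE have "AE w in X. AE y in X. q w y = 0" by (auto elim: eventually_mono)
    then have "AE w in X. AE y in X. (\<integral>z. k w z * k y z \<partial>X) = 0" by (simp add: q_def)
    then have "AE x in X. AE z in X. k x z = 0"
      using gram_zero[OF X.prob_space_axioms X.prob_space_axioms k_measurable k_bound] by simp
    then have "AE x in X. AE z in X. (\<integral>y. f (x, y) * f (z, y) \<partial>Y) = 0" by (simp add: k_def)
    then have "AE x in X. AE y in Y. f (x, y) = 0"
      by (rule gram_zero[OF X.prob_space_axioms Y.prob_space_axioms f_measurable f_bound])
    moreover have "f p \<noteq> 0" for p using B_measure by (auto simp: f_def indicator_def)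
    ultimately show False by simp
  qed
  then show ?thesis using that by blast
qed

lemma exists_isometric_factor:
  "\<exists>(W :: point set measure) c. is_factor G a X c W \<and> \<not> trivial_space W \<and> isometric_space G c W"
proof -
  obtain w where w: "w \<in> S" and nontrivial: "\<And>x. x \<in> S \<Longrightarrow> \<not> (AE y in X. d w x y = 0)"
    by (rule exists_nontrivial) blast
  have meas: "d w x \<in> borel_measurable X" if "x \<in> S" for x
    using w that by (intro d_measurable S_space)
  have S_nonnull: "S \<notin> null_sets X"
  proof
    assume "S \<in> null_sets X"
    then have "AE x in X. x \<notin> S" by (rule AE_not_in)
    with S_AE have "AE x in X. False" by eventually_elim simp
    then show False by simp
  qed
  have balls: "{y\<in>S. d w x y < r} \<in> sets X" if x: "x \<in> S" for x r
  proof -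
    have [measurable]: "d w x \<in> borel_measurable X" by (rule meas[OF x])
    have "{y\<in>S. d w x y < r} = S \<inter> {y\<in>space X. d w x y < r}" using S_space by auto
    also have "\<dots> \<in> sets X" using S_sets by measurable
    finally show ?thesis .
  qed
  have "\<exists>x\<^sub>0\<in>S. \<forall>r>0. {y\<in>S. d w x\<^sub>0 y < r} \<notin> null_sets X"
    using totally_bounded_base_point[OF S_sets S_nonnull d_totally_bounded[OF w] d_sym balls] by blast
  then obtain x\<^sub>0 where x\<^sub>0: "x\<^sub>0 \<in> S" "\<And>r. r > 0 \<Longrightarrow> {y\<in>S. d w x\<^sub>0 y < r} \<notin> null_sets X"
    by blast
  interpret model: isometric_model G \<mu> a X S "d w" 2 x\<^sub>0
  proof unfold_locales
    fix g h x y z assume "g \<in> carrier G" "h \<in> carrier G" "x \<in> S"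
    then show "a (g \<otimes> h) x = a g (a h x)" by (simp add: X.act_mult S_space)
  next
    show "d w x z \<le> d w x y + d w y z" for x y z by (rule d_triangle)
    show "d w x y = d w y x" for x y by (rule d_sym)
    show "totally_bounded_on S (d w)" by (rule d_totally_bounded[OF w])
  qed (use w x\<^sub>0 in \<open>auto simp: X.countable_carrier S_act X.act_one S_space d_self d_nonneg d_le d_invariant
      ergodic_X S_sets meas\<close>)
  show ?thesis
    using model.factor_W model.isometric_W model.nontrivial_W[OF nontrivial] by blast
qed

end

theorem theorem4p1:
  fixes G :: "('g, 'c) monoid_scheme" and \<mu> :: "'g pmf"
    and X :: "'x measure" and a :: "'g \<Rightarrow> 'x \<Rightarrow> 'x"
    and Y :: "'y measure" and b :: "'g \<Rightarrow> 'y \<Rightarrow> 'y"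
  assumes "measured_group G \<mu>"
    and "stationary_space G \<mu> a X" and "ergodic G a X"
    and "pmp_space G b Y" and "ergodic G b Y"
    and "\<not> ergodic G (diagonal_action a X b Y) (X \<Otimes>\<^sub>M Y)"
  shows "\<exists>(W :: point set measure) c.
    is_factor G a X c W \<and> \<not> trivial_space W \<and> isometric_space G c W"
proof -
  interpret X: stationary_action G \<mu> a X
    using assms(1,2) by (rule stationary_action.intro)
  interpret Y: measured_action G b Y
    by (rule measured_action.intro) (use assms(4) in \<open>simp add: pmp_space_def\<close>)
  interpret XY: pair_prob_space X Y ..
  let ?c = "diagonal_action a X b Y"
  obtain B where B: "B \<in> sets (X \<Otimes>\<^sub>M Y)"
    and inv: "\<And>g. g \<in> carrier G \<Longrightarrow> sym_diff B (?c g ` B) \<in> null_sets (X \<Otimes>\<^sub>M Y)"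
    and nontriv: "B \<notin> null_sets (X \<Otimes>\<^sub>M Y)" "\<not> conull (X \<Otimes>\<^sub>M Y) B"
    using assms(6) unfolding ergodic_def by blast
  have BX: "(x, y) \<in> B \<Longrightarrow> x \<in> space X \<and> y \<in> space Y" for x y
    using sets.sets_into_space[OF B] by (auto simp: space_pair_measure)
  have B_inv: "AE x in X. AE y in Y. (a g x, b g y) \<in> B \<longleftrightarrow> (x, y) \<in> B" if g: "g \<in> carrier G" for g
  proof -
    \<comment> \<open>Invariance is given through images; the image under the inverse of g is the
      preimage under g.\<close>
    have image: "(x, y) \<in> ?c (inv\<^bsub>G\<^esub> g) ` B \<longleftrightarrow> (a g x, b g y) \<in> B" if "x \<in> space X" "y \<in> space Y" for x y
    proof
      assume "(x, y) \<in> ?c (inv\<^bsub>G\<^esub> g) ` B"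
      then obtain x' y' where "(x', y') \<in> B" "(x, y) = ?c (inv\<^bsub>G\<^esub> g) (x', y')" by auto
      then show "(a g x, b g y) \<in> B"
        using g BX[of x' y'] by (simp add: diagonal_action_def)
    next
      assume "(a g x, b g y) \<in> B"
      moreover from this have "?c (inv\<^bsub>G\<^esub> g) (a g x, b g y) = (x, y)"
        using g that BX[of "a g x" "b g y"] by (simp add: diagonal_action_def)
      ultimately show "(x, y) \<in> ?c (inv\<^bsub>G\<^esub> g) ` B" by (metis image_eqI)
    qed
    have "AE p in X \<Otimes>\<^sub>M Y. p \<notin> sym_diff B (?c (inv\<^bsub>G\<^esub> g) ` B)"
      using g by (intro AE_not_in inv) simp
    from XY.AE_pair[OF this] AE_space show ?thesis
    proof eventually_elim
      case (elim x)
      from elim(1) AE_space show ?case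
        by eventually_elim (use elim(2) image in blast)
    qed
  qed
  have "measure (X \<Otimes>\<^sub>M Y) B \<noteq> 0"
    using nontriv(1) B by (auto simp: null_sets_def XY.emeasure_eq_measure)
  moreover have "measure (X \<Otimes>\<^sub>M Y) B \<noteq> 1"
  proof
    assume "measure (X \<Otimes>\<^sub>M Y) B = 1"
    then have "measure (X \<Otimes>\<^sub>M Y) (space (X \<Otimes>\<^sub>M Y) - B) = 0" using XY.prob_compl[OF B] by simp
    then show False
      using nontriv(2) B by (auto simp: conull_def null_sets_def XY.emeasure_eq_measure)
  qed
  ultimately interpret nonergodic_product G \<mu> a X b Y B
    using assms B B_inv
    by unfold_locales (auto simp: pmp_space_def order_less_le)
  show ?thesis by (rule exists_isometric_factor)
qed

end
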